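(* Let $\mathcal{L} u = \sum_{0 \le |\sigma|, |\gamma| \le k} (-1)^{|\sigma|} D^{\sigma} (a_{\sigma \gamma}(x) D^{\gamma} u)$ be self-adjoint on the bounded domain $D\subset\mathbb{R}^d$ with $a_{\sigma\gamma}\in L^\infty(D)$. Assume that there are $\theta_{k,\max}>0$, $\theta_{0,\max}\ge0$ such that for any $x \in D$ $$\sum_{0 \le |\sigma|, |\gamma| \le k} a_{\sigma \gamma}(x) \zeta_{\sigma} \zeta_{\gamma} \le \theta_{k,\max} \sum_{|\sigma| = k} \zeta_{\sigma}^2 + \theta_{0,\max} \sum_{|\sigma| < k} \zeta_{\sigma}^2 \qquad \forall \zeta=(\zeta_\sigma)_{|\sigma|\le k} \in \mathbb{R}^{\binom{k+d}{k}}.$$ Let $C_f$ be the constant in Friedrichs' inequality (see context). Then for any domain partition with $\frac{h^2(1-h^{2k})}{1-h^2} \le \frac{\theta_{k,\max}}{2 \theta_{0,\max} C_f^2}$ we have $$\|\mathcal{L} v\|_{L^2(\tau_j)} \le \sqrt{2 \theta_{k,\max}}\, C(k, d, \delta)\, h^{-k} \|v\|_{H(\tau_j)} \qquad \forall v \in \Psi,\ \forall j = 1, \ldots, m.$$ If $\mathcal{L}$ contains only the highest order terms, i.e. $\mathcal{L} u = (-1)^k \sum_{|\sigma|=|\gamma|=k} D^{\sigma}(a_{\sigma \gamma} D^{\gamma} u)$, then $\|\mathcal{L} v\|_{L^2(\tau_j)} \le \sqrt{\theta_{k,\max}}\, C(k,d,\delta)\, h^{-k} \|v\|_{H(\tau_j)}$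 (for all $v\in\Psi$ and all $j$) for all $h > 0$.
   Context: Notation: $|u|_{p,2,S}^2=\sum_{|\sigma|=p}\int_S|D^\sigma u|^2$. $B(x,r)$ is the ball of center $x$ and radius $r$. The quotient $\frac{h^2(1-h^{2k})}{1-h^2}$ is read as $\sum_{j=1}^{k}h^{2j}$; a quotient with denominator $\theta_{0,\max}=0$ is $+\infty$. Setting: the bilinear form of $\mathcal{L}$ is $B(u,v)=\sum_{0\le|\sigma|,|\gamma|\le k}\int_D a_{\sigma\gamma}D^\sigma u\,D^\gamma v$ on $H_0^k(D)$. Self-adjoint means $B$ is symmetric on $H_0^k(D)$. Standing assumption: there are $0<a_{\min}\le a_{\max}$ with $a_{\min}|u|_{k,2,D}^2\le B(u,u)\le a_{\max}|u|_{k,2,D}^2$ for all $u\in H_0^k(D)$. $\mathcal{K}:L^2(D)\to L^2(D)$ maps $f$ to the unique weak solution $u\in H_0^k(D)$ of $\mathcal{L}u=f$. For $S\subset D$ the local energy norm is given by $\|\psi\|_{H(S)}^2=\sum_{0\le|\sigma|,|\gamma|\le k}\int_S a_{\sigma\gamma}D^\sigma\psi\,D^\gamma\psi$. Partition: $D$ is divided into elements $\tau_1,\dots,\tau_m$ (each a triangle or quadrilateral in 2D, a tetrahedron or hexahedron in 3D). The mesh size $h$ is the maximum element diameter. The partition is regular: if $h_i$ is the diameter of $\tau_i$ and $\rho_i$ is the maximum diameter of a ball inscribed in $\tau_i$, then $\rho_i/h_i\ge\delta$ for all $i$, with a constant $\delta>0$. Spaces: $\Phi$ is the space of (discontinuous)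 piecewise polynomials on the partition whose restriction to each $\tau_i$ has degree at most $k-1$, and $\Psi=\mathcal{K}\Phi$; for $v=\mathcal{K}g\in\Psi$ with $g\in\Phi$, $\mathcal{L}v=g$. Constants: $C_f=C_f(d,k)$ is the constant in Friedrichs' inequality: $|u|_{p,2,\Omega}\le C_ft^{k-p}|u|_{k,2,\Omega}$ for all smooth, bounded, open $\Omega\subset\mathbb{R}^d$ of diameter at most $t$, all $u\in H_0^k(\Omega)$, $0\le p\le k$. $C(k,d,\delta)$ is a constant depending only on $k,d,\delta$ such that, for every $t>0$ and every smooth, bounded, open $\Omega\subset\mathbb{R}^d$ of diameter at most $t$ with $B(0,\delta t/2)\subset\Omega$, every $u\in H_0^k(\Omega)$ for which $(-1)^k\sum_{|\sigma|=k}D^{2\sigma}u$ equals a polynomial $p$ of degree at most $k-1$ satisfies $\|p\|_{L^2(\Omega)}\le C(k,d,\delta)t^{-k}|u|_{k,2,\Omega}$.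
   Formalization: The bound is stated with h_j^{-k} (h_j the diameter of τ_j), and with h^{-k} only on elements with ρ_j ≥ δh, since h^{-k} fails on graded meshes; the squared local energy norm is assumed nonnegative on every τ_j for all functions in H_0^k(D). *)

theory Defs
  imports "HOL-Analysis.Analysis"
begin

section \<open>Multi-indices, derivatives, test functions\<close>

type_synonym 'n mindex = "'n \<Rightarrow> nat"

definition msize :: "'n::finite mindex \<Rightarrow> nat" where
  "msize \<sigma> = (\<Sum>i\<in>UNIV. \<sigma> i)"

lemma finite_msize_le: "finite {\<sigma> :: 'n::finite mindex. msize \<sigma> \<le> k}"
proof (rule finite_subset)
  show "{\<sigma> :: 'n mindex. msize \<sigma> \<le> k} \<subseteq> (\<Pi>\<^sub>E i\<in>UNIV. {..k})"
  proof
    fix \<sigma> :: "'n mindex" assume *: "\<sigma> \<in> {\<sigma>. msize \<sigma> \<le> k}"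
    have "\<sigma> i \<le> msize \<sigma>" for i
      unfolding msize_def by (rule member_le_sum) auto
    with * show "\<sigma> \<in> (\<Pi>\<^sub>E i\<in>UNIV. {..k})"
      by (auto intro: order_trans)
  qed
qed (simp add: finite_PiE)

definition partial :: "'n::finite \<Rightarrow> (real^'n \<Rightarrow> real) \<Rightarrow> real^'n \<Rightarrow> real" where
  "partial i f x = frechet_derivative f (at x) (axis i 1)"

definition smooth :: "(real^'n::finite \<Rightarrow> real) \<Rightarrow> bool" where
  "smooth f \<longleftrightarrow> (\<forall>is x. foldr partial is f differentiable at x)"

text \<open>
  The index type carries no order, so an arbitrary ordering of the partial derivatives is chosen.
  This is only applied to smooth functions, for which the ordering is irrelevant.
\<close>
definition mderiv :: "'n::finite mindex \<Rightarrow> (real^'n \<Rightarrow> real) \<Rightarrow> real^'n \<Rightarrow> real" where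
  "mderiv \<sigma> f = foldr partial (SOME is. \<forall>i. count_list is i = \<sigma> i) f"

definition test_functions :: "(real^'n::finite) set \<Rightarrow> (real^'n \<Rightarrow> real) set" where
  "test_functions D =
    {\<phi>. smooth \<phi> \<and> compact (closure {x. \<phi> x \<noteq> 0}) \<and> closure {x. \<phi> x \<noteq> 0} \<subseteq> D}"


section \<open>Lebesgue and Sobolev spaces\<close>

text \<open>
  Elements of the function spaces on \<open>D\<close> are functions on the whole space; only their values
  on \<open>D\<close>, up to null sets, matter.
\<close>

definition L2 :: "(real^'n::finite) set \<Rightarrow> (real^'n \<Rightarrow> real) set" where
  "L2 S = {f. f \<in> borel_measurable (lebesgue_on S) \<and> integrable (lebesgue_on S) (\<lambda>x. (f x)\<^sup>2)}"

definition L2_norm :: "(real^'n::finite) set \<Rightarrow> (real^'n \<Rightarrow> real) \<Rightarrow> real" where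
  "L2_norm S f = sqrt (\<integral>x. (f x)\<^sup>2 \<partial>lebesgue_on S)"

definition Linfty :: "(real^'n::finite) set \<Rightarrow> (real^'n \<Rightarrow> real) set" where
  "Linfty S = {f. f \<in> borel_measurable (lebesgue_on S) \<and>
                 (\<exists>M. AE x in lebesgue_on S. \<bar>f x\<bar> \<le> M)}"

definition is_weak_deriv ::
  "(real^'n::finite) set \<Rightarrow> 'n mindex \<Rightarrow> (real^'n \<Rightarrow> real) \<Rightarrow> (real^'n \<Rightarrow> real) \<Rightarrow> bool" where
  "is_weak_deriv D \<sigma> u w \<longleftrightarrow> u \<in> L2 D \<and> w \<in> L2 D \<and>
     (\<forall>\<phi>\<in>test_functions D.
        (\<integral>x. u x * mderiv \<sigma> \<phi> x \<partial>lebesgue_on D) =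
        (-1) ^ msize \<sigma> * (\<integral>x. w x * \<phi> x \<partial>lebesgue_on D))"

text \<open>Weak derivatives are unique up to null sets, so the choice does not affect any integral.\<close>
definition wderiv ::
  "(real^'n::finite) set \<Rightarrow> 'n mindex \<Rightarrow> (real^'n \<Rightarrow> real) \<Rightarrow> real^'n \<Rightarrow> real" where
  "wderiv D \<sigma> u = (SOME w. is_weak_deriv D \<sigma> u w)"

definition sobolev :: "nat \<Rightarrow> (real^'n::finite) set \<Rightarrow> (real^'n \<Rightarrow> real) set" where
  "sobolev k D = {u. \<forall>\<sigma>. msize \<sigma> \<le> k \<longrightarrow> (\<exists>w. is_weak_deriv D \<sigma> u w)}"

definition sobolev_norm :: "nat \<Rightarrow> (real^'n::finite) set \<Rightarrow> (real^'n \<Rightarrow> real) \<Rightarrow> real" where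
  "sobolev_norm k D u =
     sqrt (\<Sum>\<sigma>\<in>{\<sigma>. msize \<sigma> \<le> k}. (L2_norm D (wderiv D \<sigma> u))\<^sup>2)"

definition sobolev_seminorm :: "nat \<Rightarrow> (real^'n::finite) set \<Rightarrow> (real^'n \<Rightarrow> real) \<Rightarrow> real" where
  "sobolev_seminorm p D u =
     sqrt (\<Sum>\<sigma>\<in>{\<sigma>. msize \<sigma> = p}. \<integral>x. (wderiv D \<sigma> u x)\<^sup>2 \<partial>lebesgue_on D)"

definition sobolev0 :: "nat \<Rightarrow> (real^'n::finite) set \<Rightarrow> (real^'n \<Rightarrow> real) set" where
  "sobolev0 k D = {u \<in> sobolev k D.
     \<forall>\<epsilon>>0. \<exists>\<phi>\<in>test_functions D. sobolev_norm k D (\<lambda>x. u x - \<phi> x) < \<epsilon>}"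


section \<open>The bilinear form and its solution operator\<close>

text \<open>
  \<open>form_on a k D S u v\<close> integrates over \<open>S \<subseteq> D\<close>, with the weak derivatives taken in \<open>D\<close>;
  the bilinear form of the operator is the case \<open>S = D\<close>.
\<close>
definition form_on ::
  "('n::finite mindex \<Rightarrow> 'n mindex \<Rightarrow> real^'n \<Rightarrow> real) \<Rightarrow> nat \<Rightarrow> (real^'n) set \<Rightarrow> (real^'n) set
    \<Rightarrow> (real^'n \<Rightarrow> real) \<Rightarrow> (real^'n \<Rightarrow> real) \<Rightarrow> real" where
  "form_on a k D S u v =
     (\<Sum>\<sigma>\<in>{\<sigma>. msize \<sigma> \<le> k}. \<Sum>\<gamma>\<in>{\<gamma>. msize \<gamma> \<le> k}.
        \<integral>x. a \<sigma> \<gamma> x * wderiv D \<sigma> u x * wderiv D \<gamma> v x \<partial>lebesgue_on S)"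

abbreviation "bilinear_form a k D \<equiv> form_on a k D D"

definition energy_norm ::
  "('n::finite mindex \<Rightarrow> 'n mindex \<Rightarrow> real^'n \<Rightarrow> real) \<Rightarrow> nat \<Rightarrow> (real^'n) set \<Rightarrow> (real^'n) set
    \<Rightarrow> (real^'n \<Rightarrow> real) \<Rightarrow> real" where
  "energy_norm a k D S \<psi> = sqrt (form_on a k D S \<psi> \<psi>)"

definition weak_solution ::
  "('n::finite mindex \<Rightarrow> 'n mindex \<Rightarrow> real^'n \<Rightarrow> real) \<Rightarrow> nat \<Rightarrow> (real^'n) set
    \<Rightarrow> (real^'n \<Rightarrow> real) \<Rightarrow> (real^'n \<Rightarrow> real) \<Rightarrow> bool" where
  "weak_solution a k D f u \<longleftrightarrow> f \<in> L2 D \<and> u \<in> sobolev0 k D \<and>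
     (\<forall>\<phi>\<in>sobolev0 k D. bilinear_form a k D u \<phi> = (\<integral>x. f x * \<phi> x \<partial>lebesgue_on D))"

text \<open>The solution \<open>\<K> f\<close>, as the class of all its representatives (equal up to null sets).\<close>
definition solution_class ::
  "('n::finite mindex \<Rightarrow> 'n mindex \<Rightarrow> real^'n \<Rightarrow> real) \<Rightarrow> nat \<Rightarrow> (real^'n) set
    \<Rightarrow> (real^'n \<Rightarrow> real) \<Rightarrow> (real^'n \<Rightarrow> real) set" where
  "solution_class a k D f = {u. weak_solution a k D f u}"

text \<open>
  \<open>\<L>\<close> as the inverse of \<open>\<K>\<close>; the right-hand side is determined by \<open>v\<close> up to null sets.
\<close>
definition L_op ::
  "('n::finite mindex \<Rightarrow> 'n mindex \<Rightarrow> real^'n \<Rightarrow> real) \<Rightarrow> nat \<Rightarrow> (real^'n) set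
    \<Rightarrow> (real^'n \<Rightarrow> real) \<Rightarrow> real^'n \<Rightarrow> real" where
  "L_op a k D v = (SOME g. weak_solution a k D g v)"


section \<open>Partitions and the discrete spaces\<close>

text \<open>
  Elements are open polytopal sets, not necessarily convex. In the plane this includes all
  triangles and quadrilaterals, in space all tetrahedra and (flat-faced) hexahedra.
\<close>
definition element :: "(real^'n::finite) set \<Rightarrow> bool" where
  "element T \<longleftrightarrow> (\<exists>\<P>. finite \<P> \<and> \<P> \<noteq> {} \<and> (\<forall>P\<in>\<P>. polytope P \<and> interior P \<noteq> {}) \<and>
                     T = interior (\<Union>\<P>))"

definition domain_partition ::
  "(real^'n::finite) set \<Rightarrow> nat \<Rightarrow> (nat \<Rightarrow> (real^'n) set) \<Rightarrow> bool" where
  "domain_partition D m \<tau> \<longleftrightarrow>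
     (\<forall>j\<in>{1..m}. element (\<tau> j) \<and> \<tau> j \<subseteq> D) \<and>
     (\<forall>i\<in>{1..m}. \<forall>j\<in>{1..m}. i \<noteq> j \<longrightarrow> \<tau> i \<inter> \<tau> j = {}) \<and>
     closure D = (\<Union>j\<in>{1..m}. closure (\<tau> j))"

definition mesh_size :: "nat \<Rightarrow> (nat \<Rightarrow> (real^'n::finite) set) \<Rightarrow> real" where
  "mesh_size m \<tau> = Max ((\<lambda>j. diameter (\<tau> j)) ` {1..m})"

definition inscribed_diameter :: "(real^'n::finite) set \<Rightarrow> real" where
  "inscribed_diameter T = Sup {2 * r | r. 0 \<le> r \<and> (\<exists>x. ball x r \<subseteq> T)}"

definition regular_partition :: "real \<Rightarrow> nat \<Rightarrow> (nat \<Rightarrow> (real^'n::finite) set) \<Rightarrow> bool" where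
  "regular_partition \<delta> m \<tau> \<longleftrightarrow>
     (\<forall>j\<in>{1..m}. inscribed_diameter (\<tau> j) / diameter (\<tau> j) \<ge> \<delta>)"

definition poly_functions :: "nat \<Rightarrow> (real^'n::finite \<Rightarrow> real) set" where
  "poly_functions n =
     {p. \<exists>c. p = (\<lambda>x. \<Sum>\<sigma>\<in>{\<sigma>. msize \<sigma> \<le> n}. c \<sigma> * (\<Prod>i\<in>UNIV. (x $ i) ^ \<sigma> i))}"

definition Phi :: "nat \<Rightarrow> nat \<Rightarrow> (nat \<Rightarrow> (real^'n::finite) set) \<Rightarrow> (real^'n \<Rightarrow> real) set" where
  "Phi k m \<tau> = {g. \<forall>j\<in>{1..m}. \<exists>p\<in>poly_functions (k - 1). \<forall>x\<in>\<tau> j. g x = p x}"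

definition Psi ::
  "('n::finite mindex \<Rightarrow> 'n mindex \<Rightarrow> real^'n \<Rightarrow> real) \<Rightarrow> nat \<Rightarrow> (real^'n) set
    \<Rightarrow> nat \<Rightarrow> (nat \<Rightarrow> (real^'n) set) \<Rightarrow> (real^'n \<Rightarrow> real) set" where
  "Psi a k D m \<tau> = (\<Union>g\<in>Phi k m \<tau>. solution_class a k D g)"


section \<open>The constants\<close>

text \<open>Open sets with smooth boundary, described by local defining functions.\<close>
definition smooth_open :: "(real^'n::finite) set \<Rightarrow> bool" where
  "smooth_open \<Omega> \<longleftrightarrow> open \<Omega> \<and>
     (\<forall>x\<in>frontier \<Omega>. \<exists>U \<phi>. open U \<and> x \<in> U \<and> smooth \<phi> \<and> (\<exists>i. partial i \<phi> x \<noteq> 0) \<and>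
        \<Omega> \<inter> U = {y \<in> U. \<phi> y < 0})"

text \<open>The type argument fixes the dimension \<open>d = CARD('n)\<close>.\<close>
definition friedrichs_constant :: "'n::finite itself \<Rightarrow> nat \<Rightarrow> real \<Rightarrow> bool" where
  "friedrichs_constant _ k C \<longleftrightarrow>
     (\<forall>(\<Omega> :: (real^'n) set) t u p.
        smooth_open \<Omega> \<longrightarrow> bounded \<Omega> \<longrightarrow> diameter \<Omega> \<le> t \<longrightarrow> u \<in> sobolev0 k \<Omega> \<longrightarrow> p \<le> k \<longrightarrow>
        sobolev_seminorm p \<Omega> u \<le> C * t ^ (k - p) * sobolev_seminorm k \<Omega> u)"

text \<open>The equation \<open>(-1)\<^sup>k \<Sum>|\<sigma>|=k D\<^sup>2\<^sup>\<sigma> u = p\<close> in \<open>\<Omega>\<close> in the sense of distributions.\<close>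
definition polyharmonic_eq ::
  "nat \<Rightarrow> (real^'n::finite) set \<Rightarrow> (real^'n \<Rightarrow> real) \<Rightarrow> (real^'n \<Rightarrow> real) \<Rightarrow> bool" where
  "polyharmonic_eq k \<Omega> u p \<longleftrightarrow>
     (\<forall>\<phi>\<in>test_functions \<Omega>.
        (-1) ^ k * (\<Sum>\<sigma>\<in>{\<sigma>. msize \<sigma> = k}.
                      \<integral>x. u x * mderiv (\<lambda>i. 2 * \<sigma> i) \<phi> x \<partial>lebesgue_on \<Omega>) =
        (\<integral>x. p x * \<phi> x \<partial>lebesgue_on \<Omega>))"

definition inverse_constant :: "'n::finite itself \<Rightarrow> nat \<Rightarrow> real \<Rightarrow> real \<Rightarrow> bool" where
  "inverse_constant _ k \<delta> C \<longleftrightarrow>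
     (\<forall>(\<Omega> :: (real^'n) set) t u. \<forall>p\<in>poly_functions (k - 1).
        t > 0 \<longrightarrow> smooth_open \<Omega> \<longrightarrow> bounded \<Omega> \<longrightarrow> diameter \<Omega> \<le> t \<longrightarrow> ball 0 (\<delta> * t / 2) \<subseteq> \<Omega> \<longrightarrow>
        u \<in> sobolev0 k \<Omega> \<longrightarrow> polyharmonic_eq k \<Omega> u p \<longrightarrow>
        L2_norm \<Omega> p \<le> C / t ^ k * sobolev_seminorm k \<Omega> u)"

end

theory Submission
  imports Defs "HOL-Computational_Algebra.Polynomial"
begin

text \<open>
  Let \<open>p\<close> be the polynomial that \<open>\<L> v\<close> equals on the element \<open>T\<close>, and let \<open>\<Omega> \<subseteq> T\<close> be smooth. For a
  test function \<open>\<phi>\<close> on \<open>\<Omega>\<close>, the integral of \<open>p \<phi>\<close> is \<open>B(v, \<phi>)\<close>, which the Cauchy--Schwarz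
  inequality for the local energy form bounds by the product of the energy norms of \<open>v\<close> and \<open>\<phi>\<close> on
  \<open>T\<close>; by ellipticity and Friedrichs' inequality the latter is at most \<open>sqrt (2 \<theta>k)\<close> times the
  \<open>k\<close>-th seminorm of \<open>\<phi>\<close>. Hence the solution in \<open>H_0^k(\<Omega>)\<close> of the polyharmonic equation with
  right-hand side \<open>p\<close> has seminorm at most \<open>sqrt (2 \<theta>k)\<close> times the energy norm of \<open>v\<close>, and the
  defining property of \<open>C(k,d,\<delta>)\<close> bounds \<open>p\<close> in \<open>L\<^sup>2(\<Omega>)\<close>. It remains to exhaust \<open>T\<close> by smooth
  sets containing its inscribed ball. As these need not be connected, the inscribed ball together
  with finitely many disjoint balls of a Vitali covering of the rest of \<open>T\<close> will do.
\<close>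

text \<open>Inserting the polyharmonic solution itself into the form of \<open>v\<close> would
  require its extension by zero to lie in H_0^k(D). Bounding the functional on test functions, for
  which extension by zero is trivial, turns the seminorm of the solution into a dual norm, and that
  norm is at most the bound of the functional. The Cauchy--Schwarz inequality is needed over the
  element, on whose boundary \<open>v\<close> does not vanish. Nonnegativity of the form there is a
  matter of its own: ellipticity on H_0^k(D) does not localise. The constant C(k,d,\<delta>) refers
  to balls about the origin, hence the translations. Its sign decides whether the seminorm in the
  inverse estimate may be replaced by its upper bound, so positivity is derived from the defining
  property. The length scale \<open>t\<close> stays free until the end and becomes the diameter of
  the element or the mesh size. The factor 2 under the root leaves room for the lower-order terms,
  which Friedrichs' inequality and the mesh condition bound by half of
  \<open>\<theta>k\<close>.\<close>

section \<open>Smooth functions\<close>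

text \<open>Coinduction: \<open>smooth\<close> is the largest set of differentiable functions closed
  under all partial derivatives. The sets \<open>S\<close> chosen below are spans that the product
  or chain rule maps into themselves.\<close>

lemma smoothI:
  assumes "f \<in> S"
    and diff: "\<And>g x. g \<in> S \<Longrightarrow> g differentiable at x"
    and part: "\<And>g i. g \<in> S \<Longrightarrow> partial i g \<in> S"
  shows "smooth f"
proof -
  have "foldr partial is f \<in> S" for "is"
    by (induction "is") (simp_all add: assms(1) part)
  then show ?thesis
    unfolding smooth_def using diff by blast
qed

lemma smooth_foldr: "smooth f \<Longrightarrow> smooth (foldr partial xs f)"
  unfolding smooth_def by (metis foldr_append)

lemma smooth_partial: "smooth f \<Longrightarrow> smooth (partial i f)"
  using smooth_foldr[of f "[i]"] by simp

lemma smooth_differentiable: "smooth f \<Longrightarrow> f differentiable at x"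
  unfolding smooth_def by (metis foldr_Nil id_apply)

lemma smooth_continuous: "smooth f \<Longrightarrow> continuous_on S f"
  by (meson continuous_at_imp_continuous_on differentiable_imp_continuous_within smooth_differentiable)

lemma smooth_measurable: "smooth f \<Longrightarrow> f \<in> borel_measurable borel"
  by (simp add: borel_measurable_continuous_onI smooth_continuous)

lemma partial_eqI: "(f has_derivative f') (at x) \<Longrightarrow> partial i f x = f' (axis i 1)"
  unfolding partial_def by (metis frechet_derivative_at)

lemma partial_const: "partial i (\<lambda>x. c) = (\<lambda>x. 0)"
  by (rule ext, rule partial_eqI[where f' = "\<lambda>_. 0", simplified]) simp

lemma partial_add:
  assumes "\<And>x. f differentiable at x" "\<And>x. g differentiable at x"
  shows "partial i (\<lambda>x. f x + g x) = (\<lambda>x. partial i f x + partial i g x)"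
proof
  fix x
  have "(f has_derivative frechet_derivative f (at x)) (at x)"
    "(g has_derivative frechet_derivative g (at x)) (at x)"
    using assms frechet_derivative_works by blast+
  from partial_eqI[OF has_derivative_add[OF this]]
  show "partial i (\<lambda>x. f x + g x) x = partial i f x + partial i g x"
    by (simp add: partial_def)
qed

lemma partial_mult:
  assumes "\<And>x. f differentiable at x" "\<And>x. g differentiable at x"
  shows "partial i (\<lambda>x. f x * g x) = (\<lambda>x. f x * partial i g x + partial i f x * g x)"
proof
  fix x
  have "(f has_derivative frechet_derivative f (at x)) (at x)"
    "(g has_derivative frechet_derivative g (at x)) (at x)"
    using assms frechet_derivative_works by blast+
  from partial_eqI[OF has_derivative_mult[OF this]]
  show "partial i (\<lambda>x. f x * g x) x = f x * partial i g x + partial i f x * g x"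
    by (simp add: partial_def)
qed

lemma smooth_const: "smooth (\<lambda>x. c)"
  by (rule smoothI[where S = "{\<lambda>x. c, \<lambda>x. 0}"]) (auto simp: partial_const)

lemma partial_coord: "partial i (\<lambda>x. x $ j) = (\<lambda>x. if i = j then 1 else 0)"
  by (rule ext, subst partial_eqI[OF bounded_linear_imp_has_derivative[OF bounded_linear_vec_nth]])
    (auto simp: axis_def)

lemma smooth_coord: "smooth (\<lambda>x. x $ j)"
proof (rule smoothI[where S = "insert (\<lambda>x. x $ j) (range (\<lambda>c x. c))"])
  show "g differentiable at x" if "g \<in> insert (\<lambda>x. x $ j) (range (\<lambda>c x. c))" for g and x :: "real^'a"
    using that by (auto intro: bounded_linear_imp_differentiable bounded_linear_vec_nth)
qed (auto simp: partial_const partial_coord)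

lemma smooth_add:
  assumes "smooth f" "smooth g" shows "smooth (\<lambda>x. f x + g x)"
proof (rule smoothI[where S = "{\<lambda>x. f x + g x |f g. smooth f \<and> smooth g}"])
  fix h i assume "h \<in> {\<lambda>x. f x + g x |f g :: real^'a \<Rightarrow> real. smooth f \<and> smooth g}"
  then obtain f g where "smooth f" "smooth g" "h = (\<lambda>x. f x + g x)"
    by blast
  then show "partial i h \<in> {\<lambda>x. f x + g x |f g. smooth f \<and> smooth g}"
    using smooth_partial by (auto simp: partial_add smooth_differentiable)
qed (use assms in \<open>auto intro: differentiable_add smooth_differentiable\<close>)

text \<open>The product rule leads from one product to a sum of two, so the invariant set for
  \<open>smoothI\<close> has to contain sums as well.\<close>

inductive_set prod_span :: "(real^'n::finite \<Rightarrow> real) set" where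
  "smooth f \<Longrightarrow> smooth g \<Longrightarrow> (\<lambda>x. f x * g x) \<in> prod_span"
| "f \<in> prod_span \<Longrightarrow> g \<in> prod_span \<Longrightarrow> (\<lambda>x. f x + g x) \<in> prod_span"

lemma smooth_mult:
  assumes "smooth f" "smooth g" shows "smooth (\<lambda>x. f x * g x)"
proof (rule smoothI[where S = prod_span])
  show diff: "h differentiable at x" if "h \<in> prod_span" for h and x :: "real^'a"
    using that by (induction arbitrary: x) (auto intro: smooth_differentiable differentiable_mult)
  show "partial i h \<in> prod_span" if "h \<in> prod_span" for h :: "real^'a \<Rightarrow> real" and i
    using that
  proof induction
    case (1 f g)
    then show ?case
      by (simp add: partial_mult smooth_differentiable prod_span.intros smooth_partial)
  next
    case (2 f g)
    then show ?case
      by (simp add: partial_add diff prod_span.intros)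
  qed
qed (use assms in \<open>auto intro: prod_span.intros\<close>)

lemma smooth_cmult: "smooth f \<Longrightarrow> smooth (\<lambda>x. c * f x)"
  by (rule smooth_mult[OF smooth_const])

lemma smooth_diff: "smooth f \<Longrightarrow> smooth g \<Longrightarrow> smooth (\<lambda>x. f x - g x)"
  using smooth_add[of f "\<lambda>x. (-1) * g x"] smooth_cmult[of g "-1"] by simp

lemma smooth_sum: "(\<And>i. i \<in> A \<Longrightarrow> smooth (f i)) \<Longrightarrow> smooth (\<lambda>x. \<Sum>i\<in>A. f i x)"
  by (induction A rule: infinite_finite_induct) (auto intro: smooth_const smooth_add)

lemma smooth_prod: "(\<And>i. i \<in> A \<Longrightarrow> smooth (f i)) \<Longrightarrow> smooth (\<lambda>x. \<Prod>i\<in>A. f i x)"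
  by (induction A rule: infinite_finite_induct) (auto intro: smooth_const smooth_mult)

lemma smooth_power: "smooth f \<Longrightarrow> smooth (\<lambda>x. f x ^ n)"
  by (induction n) (auto intro: smooth_const smooth_mult)

lemma partial_cmult: "smooth f \<Longrightarrow> partial i (\<lambda>x. c * f x) = (\<lambda>x. c * partial i f x)"
  by (subst partial_mult) (auto simp: partial_const smooth_differentiable)

text \<open>\<open>G\<close> lists a function of one variable together with all its derivatives. The
  chain rule turns \<open>G m (s x)\<close> into \<open>G (Suc m) (s x)\<close> times a smooth
  factor; the coefficients \<open>q\<close> absorb these factors.\<close>

inductive_set comp_span :: "(nat \<Rightarrow> real \<Rightarrow> real) \<Rightarrow> (real^'n::finite \<Rightarrow> real) \<Rightarrow> (real^'n \<Rightarrow> real) set"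
  for G s where
  "smooth q \<Longrightarrow> (\<lambda>x. q x * G m (s x)) \<in> comp_span G s"
| "f \<in> comp_span G s \<Longrightarrow> g \<in> comp_span G s \<Longrightarrow> (\<lambda>x. f x + g x) \<in> comp_span G s"

lemma smooth_compose:
  fixes G :: "nat \<Rightarrow> real \<Rightarrow> real"
  assumes G: "\<And>m t. (G m has_real_derivative G (Suc m) t) (at t)" and s: "smooth s"
  shows "smooth (\<lambda>x. G 0 (s x))"
proof (rule smoothI[where S = "comp_span G s"])
  have der: "((\<lambda>x. G m (s x)) has_derivative (\<lambda>v. frechet_derivative s (at x) v * G (Suc m) (s x))) (at x)"
    for m x
    using has_derivative_compose[OF frechet_derivative_works[THEN iffD1, OF smooth_differentiable[OF s]]
        G[unfolded has_field_derivative_def]]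
    by (simp add: mult.commute)
  then have d: "(\<lambda>x. G m (s x)) differentiable at x" for m x
    using differentiable_def by blast
  have p: "partial i (\<lambda>x. G m (s x)) = (\<lambda>x. partial i s x * G (Suc m) (s x))" for m i
    using partial_eqI[OF der] by (simp add: partial_def fun_eq_iff)
  show diff: "h differentiable at x" if "h \<in> comp_span G s" for h x
    using that by (induction arbitrary: x) (auto intro: smooth_differentiable differentiable_mult d)
  show "partial i h \<in> comp_span G s" if "h \<in> comp_span G s" for h i
    using that
  proof induction
    case (1 q m)
    have "(\<lambda>x. q x * (partial i s x * G (Suc m) (s x))) = (\<lambda>x. (q x * partial i s x) * G (Suc m) (s x))"
      by (simp add: mult.assoc)
    also have "\<dots> \<in> comp_span G s"
      by (intro comp_span.intros smooth_mult 1 smooth_partial s)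
    finally show ?case
      by (simp add: partial_mult[OF smooth_differentiable[OF 1] d] p comp_span.intros smooth_partial 1)
  next
    case (2 f g)
    then show ?case
      by (simp add: partial_add diff comp_span.intros)
  qed
  show "(\<lambda>x. G 0 (s x)) \<in> comp_span G s"
    using comp_span.intros(1)[OF smooth_const[of 1], of G 0 s] by simp
qed

section \<open>The flat function exp(-1/t), from which test functions are built\<close>

definition flat_step :: "real \<Rightarrow> real" where
  "flat_step t = (if t \<le> 0 then 0 else exp (- (1 / t)))"

lemma flat_step_bounds: "0 \<le> flat_step t" "flat_step t \<le> 1" "flat_step t = 0 \<longleftrightarrow> t \<le> 0"
  by (auto simp: flat_step_def)

lemma tendsto_poly_inverse_exp:
  "((\<lambda>t. poly p (1 / t) * exp (- (1 / t))) \<longlongrightarrow> 0) (at_right (0::real))"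
proof (induction p)
  case 0
  then show ?case by simp
next
  case (pCons c p)
  have *: "((\<lambda>y. poly q y * exp (- y)) \<longlongrightarrow> 0) at_top" for q :: "real poly"
  proof -
    have "(\<lambda>y. poly q y * exp (- y)) = (\<lambda>y. \<Sum>i\<le>degree q. coeff q i * (y ^ i / exp y))"
      by (simp add: poly_altdef sum_divide_distrib exp_minus divide_inverse sum_distrib_right mult.assoc)
    moreover have "((\<lambda>y. \<Sum>i\<le>degree q. coeff q i * (y ^ i / exp y)) \<longlongrightarrow> 0) at_top"
      by (intro tendsto_null_sum tendsto_mult_right_zero tendsto_power_div_exp_0)
    ultimately show ?thesis by simp
  qed
  show ?case
    using filterlim_compose[OF * filterlim_inverse_at_top_right, of "pCons c p"]
    by (simp add: inverse_eq_divide)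
qed

text \<open>The functions p(1/t) exp(-1/t), extended by 0, are closed under differentiation: away
  from 0 the derivative carries the polynomial X^2 (p - p'). At 0 the right difference quotient is
  of the same kind with polynomial X p, so it tends to 0.\<close>

lemma flat_step_poly_deriv:
  fixes p :: "real poly"
  shows "((\<lambda>t. if t \<le> 0 then 0 else poly p (1 / t) * exp (- (1 / t))) has_real_derivative
    (if t \<le> 0 then 0 else poly ([:0, 0, 1:] * (p - pderiv p)) (1 / t) * exp (- (1 / t)))) (at t)"
    (is "(?g has_real_derivative _) _")
proof (cases "t = 0")
  case False
  show ?thesis
  proof (cases "t < 0")
    case True
    have "((\<lambda>t. 0) has_real_derivative 0) (at t)" by simp
    moreover have "\<forall>\<^sub>F x in nhds t. ?g x = 0"
      by (rule eventually_mono[OF eventually_nhds_in_open[of "{..<0}"]]) (use True in auto)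
    ultimately show ?thesis
      using True DERIV_cong_ev[of t t ?g "\<lambda>_. 0" 0 0] by auto
  next
    case nt: False
    then have t: "t > 0" using False by simp
    have "((\<lambda>t. poly p (1 / t) * exp (- (1 / t))) has_real_derivative
        poly ([:0, 0, 1:] * (p - pderiv p)) (1 / t) * exp (- (1 / t))) (at t)"
      using t by (auto intro!: derivative_eq_intros DERIV_chain2[OF poly_DERIV]
          simp: field_simps power2_eq_square)
    moreover have "\<forall>\<^sub>F x in nhds t. ?g x = poly p (1 / x) * exp (- (1 / x))"
      by (rule eventually_mono[OF eventually_nhds_in_open[of "{0<..}"]]) (use t in auto)
    ultimately show ?thesis
      using t DERIV_cong_ev[of t t ?g "\<lambda>t. poly p (1 / t) * exp (- (1 / t))"] by auto
  qed
next
  case True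
  have "((\<lambda>h. (?g (0 + h) - ?g 0) / h) \<longlongrightarrow> 0) (at_left 0)"
    by (rule tendsto_eventually) (auto simp: eventually_at_filter)
  moreover have "((\<lambda>h. (?g (0 + h) - ?g 0) / h) \<longlongrightarrow> 0) (at_right 0)"
  proof (rule Lim_transform_eventually[OF tendsto_poly_inverse_exp[of "pCons 0 p"]])
    show "\<forall>\<^sub>F x in at_right 0. poly (pCons 0 p) (1 / x) * exp (- (1 / x)) = (?g (0 + x) - ?g 0) / x"
      by (auto simp: eventually_at_filter)
  qed
  ultimately have "((\<lambda>h. (?g (0 + h) - ?g 0) / h) \<longlongrightarrow> 0) (at 0)"
    by (simp add: filterlim_split_at)
  then show ?thesis
    using True by (simp add: DERIV_def)
qed

lemma smooth_flat_step:
  assumes "smooth s" shows "smooth (\<lambda>x. flat_step (s x))"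
proof -
  define P where "P m = ((\<lambda>p::real poly. [:0, 0, 1:] * (p - pderiv p)) ^^ m) 1" for m
  define G where "G m t = (if t \<le> 0 then 0 else poly (P m) (1 / t) * exp (- (1 / t)))" for m and t :: real
  have "(G m has_real_derivative G (Suc m) t) (at t)" for m t
    unfolding G_def[abs_def] P_def funpow.simps o_apply by (rule flat_step_poly_deriv)
  moreover have "G 0 = flat_step"
    by (simp add: G_def P_def flat_step_def fun_eq_iff)
  ultimately show ?thesis
    using smooth_compose[where G = G, OF _ assms] by simp
qed

section \<open>Commutation of partial derivatives\<close>

lemma partial_along_axis:
  assumes "smooth f"
  shows "((\<lambda>s. f (y + s *\<^sub>R axis i 1)) has_real_derivative partial i f (y + s *\<^sub>R axis i 1)) (at s)"
proof -
  let ?D = "frechet_derivative f (at (y + s *\<^sub>R axis i 1))"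
  have f: "(f has_derivative ?D) (at (y + s *\<^sub>R axis i 1))"
    using smooth_differentiable[OF assms] frechet_derivative_works by blast
  have "((\<lambda>s. f (y + s *\<^sub>R axis i 1)) has_derivative (\<lambda>v. ?D (v *\<^sub>R axis i 1))) (at s)"
    by (rule has_derivative_compose[where g = f and f = "\<lambda>s. y + s *\<^sub>R axis i 1", OF _ f]) (auto intro!: derivative_eq_intros)
  moreover have "?D (v *\<^sub>R axis i 1) = partial i f (y + s *\<^sub>R axis i 1) * v" for v
    using linear_scale[OF has_derivative_linear[OF f]] by (simp add: partial_def)
  ultimately show ?thesis
    by (simp add: has_field_derivative_def)
qed

text \<open>Mean value theorem twice: first in direction \<open>i\<close> for the increment of
  \<open>f\<close> in direction \<open>j\<close>, then in direction \<open>j\<close> for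
  \<open>partial i f\<close>. The left-hand side is symmetric in \<open>i\<close> and
  \<open>j\<close>, so exchanging them expresses it by the other mixed derivative too.\<close>

lemma second_difference:
  assumes f: "smooth f" and h: "h > 0"
  shows "\<exists>y. dist y x < 2 * h \<and>
    f (x + h *\<^sub>R axis i 1 + h *\<^sub>R axis j 1) - f (x + h *\<^sub>R axis i 1) - f (x + h *\<^sub>R axis j 1) + f x
      = h * h * partial j (partial i f) y"
proof -
  define g where "g s = f ((x + h *\<^sub>R axis j 1) + s *\<^sub>R axis i 1) - f (x + s *\<^sub>R axis i 1)" for s
  have "(g has_real_derivative (partial i f ((x + h *\<^sub>R axis j 1) + s *\<^sub>R axis i 1)
      - partial i f (x + s *\<^sub>R axis i 1))) (at s)" for s
    unfolding g_def[abs_def] by (intro DERIV_diff partial_along_axis f)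
  from MVT2[OF h this] obtain s where s: "0 < s" "s < h"
    and 1: "g h - g 0 = h * (partial i f ((x + h *\<^sub>R axis j 1) + s *\<^sub>R axis i 1)
      - partial i f (x + s *\<^sub>R axis i 1))"
    by auto
  from MVT2[OF h partial_along_axis[OF smooth_partial[OF f]], of i "x + s *\<^sub>R axis i 1" j]
  obtain t where t: "0 < t" "t < h"
    and 2: "partial i f (x + s *\<^sub>R axis i 1 + h *\<^sub>R axis j 1) - partial i f (x + s *\<^sub>R axis i 1)
      = h * partial j (partial i f) (x + s *\<^sub>R axis i 1 + t *\<^sub>R axis j 1)"
    by auto
  have "dist (x + s *\<^sub>R axis i 1 + t *\<^sub>R axis j 1) x = norm (s *\<^sub>R axis i (1::real) + t *\<^sub>R axis j 1)"
    by (simp add: dist_norm)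
  also have "\<dots> < 2 * h"
    using norm_triangle_ineq[of "s *\<^sub>R axis i (1::real)" "t *\<^sub>R axis j 1"] s t by simp
  finally show ?thesis
    using 1 2 by (intro exI[of _ "x + s *\<^sub>R axis i 1 + t *\<^sub>R axis j 1"]) (simp add: g_def algebra_simps)
qed

lemma partial_commute:
  assumes f: "smooth f"
  shows "partial i (partial j f) = partial j (partial i f)"
proof
  fix x
  define h where "h n = inverse (real (Suc n))" for n
  have h: "h n > 0" for n by (simp add: h_def)
  have h0: "h \<longlonglongrightarrow> 0"
    unfolding h_def by (rule LIMSEQ_inverse_real_of_nat)
  have "\<exists>y z. dist y x < 2 * h n \<and> dist z x < 2 * h n \<and> partial j (partial i f) y = partial i (partial j f) z"
    for n
  proof -
    obtain y where y: "dist y x < 2 * h n"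
      "f (x + h n *\<^sub>R axis i 1 + h n *\<^sub>R axis j 1) - f (x + h n *\<^sub>R axis i 1) - f (x + h n *\<^sub>R axis j 1) + f x
      = h n * h n * partial j (partial i f) y"
      using second_difference[OF f h] by blast
    obtain z where z: "dist z x < 2 * h n"
      "f (x + h n *\<^sub>R axis j 1 + h n *\<^sub>R axis i 1) - f (x + h n *\<^sub>R axis j 1) - f (x + h n *\<^sub>R axis i 1) + f x
      = h n * h n * partial i (partial j f) z"
      using second_difference[OF f h] by blast
    have "h n * h n * partial j (partial i f) y = h n * h n * partial i (partial j f) z"
      using y(2) z(2) by (simp add: algebra_simps)
    then show ?thesis
      using y(1) z(1) h[of n] by auto
  qed
  then obtain y z where yz: "\<And>n. dist (y n) x < 2 * h n" "\<And>n. dist (z n) x < 2 * h n"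
    and eq: "\<And>n. partial j (partial i f) (y n) = partial i (partial j f) (z n)"
    by metis
  have lim: "(\<lambda>n. g (u n)) \<longlonglongrightarrow> g x" if u: "\<And>n. dist (u n) x < 2 * h n" and g: "smooth g" for u g
  proof (rule isCont_tendsto_compose[where g = g and l = x])
    show "isCont g x"
      using smooth_continuous[OF g, of UNIV] by (simp add: continuous_on_eq_continuous_within)
    have "(\<lambda>n. 2 * h n) \<longlonglongrightarrow> 0"
      using tendsto_mult_right_zero[OF h0] .
    then have "(\<lambda>n. dist (u n) x) \<longlonglongrightarrow> 0"
      by (rule tendsto_sandwich[OF _ _ tendsto_const, rotated 2])
        (auto intro!: always_eventually less_imp_le u)
    then show "u \<longlonglongrightarrow> x"
      using tendsto_dist_iff by blast
  qed
  have "(\<lambda>n. partial j (partial i f) (y n)) \<longlonglongrightarrow> partial j (partial i f) x"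
    by (intro lim yz smooth_partial f)
  moreover have "(\<lambda>n. partial i (partial j f) (z n)) \<longlonglongrightarrow> partial i (partial j f) x"
    by (intro lim yz smooth_partial f)
  ultimately show "partial i (partial j f) x = partial j (partial i f) x"
    unfolding eq by (rule LIMSEQ_unique[symmetric])
qed

lemma foldr_partial_insert:
  assumes "smooth f"
  shows "foldr partial (xs @ i # ys) f = partial i (foldr partial (xs @ ys) f)"
  by (induction xs) (use assms in \<open>simp_all add: partial_commute smooth_foldr del: foldr_append\<close>)

text \<open>The head of \<open>xs\<close> occurs somewhere in \<open>ys\<close> and can be pulled to
  the front there. With this, the arbitrary ordering inside \<open>mderiv\<close> has no effect on
  smooth functions.\<close>

lemma foldr_partial_perm:
  assumes "smooth f" "\<And>i. count_list xs i = count_list ys i"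
  shows "foldr partial xs f = foldr partial ys f"
  using assms(2)
proof (induction xs arbitrary: ys)
  case Nil
  then have "ys = []"
    by (metis count_list.simps(1) count_list_0_iff list.set_intros(1) neq_Nil_conv)
  then show ?case by simp
next
  case (Cons i xs)
  have "i \<in> set ys"
    using Cons.prems[of i] by (metis Zero_not_Suc count_list.simps(2) count_notin plus_1_eq_Suc add.commute)
  then obtain as bs where ys: "ys = as @ i # bs"
    by (meson split_list)
  have "count_list xs l = count_list (as @ bs) l" for l
    using Cons.prems[of l] by (auto simp: ys split: if_splits)
  from Cons.IH[OF this] show ?case
    by (simp add: ys foldr_partial_insert assms(1) del: foldr_append)
qed

lemma ex_list_count: "\<exists>xs. \<forall>i::'n::finite. count_list xs i = \<sigma> i"
proof -
  obtain xs where "mset xs = (\<Sum>i\<in>UNIV. replicate_mset (\<sigma> i) i)"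
    using ex_mset by blast
  then have "count_list xs i = (\<Sum>j\<in>UNIV. if j = i then \<sigma> j else 0)" for i
    by (simp add: count_mset[symmetric] count_sum)
  then show ?thesis by auto
qed

lemma mderiv_eq:
  assumes "smooth f" "\<And>i. count_list xs i = \<sigma> i"
  shows "mderiv \<sigma> f = foldr partial xs f"
proof -
  have "\<forall>i. count_list (SOME is. \<forall>i. count_list is i = \<sigma> i) i = \<sigma> i"
    by (rule someI_ex[OF ex_list_count])
  then show ?thesis
    unfolding mderiv_def by (intro foldr_partial_perm assms(1)) (simp add: assms(2))
qed

lemma obtain_mderiv:
  fixes \<sigma> :: "'n::finite mindex"
  obtains xs where "\<And>f. smooth f \<Longrightarrow> mderiv \<sigma> f = foldr partial xs f" "length xs = msize \<sigma>"
    "\<And>i. count_list xs i = \<sigma> i"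
proof -
  obtain xs where xs: "\<And>i. count_list xs i = \<sigma> i"
    using ex_list_count by blast
  have "length xs = (\<Sum>i\<in>UNIV. count_list xs i)"
    by (metis finite sum_count_set subset_UNIV)
  then show ?thesis
    using that[of xs] xs mderiv_eq by (auto simp: msize_def)
qed

lemma smooth_mderiv: "smooth f \<Longrightarrow> smooth (mderiv \<sigma> f)"
  by (metis obtain_mderiv smooth_foldr)

lemma mderiv_zero: "smooth f \<Longrightarrow> msize \<sigma> = 0 \<Longrightarrow> mderiv \<sigma> f = f"
  using mderiv_eq[of f "[]" \<sigma>] by (simp add: msize_def)

lemma mderiv_mderiv:
  assumes "smooth f" shows "mderiv \<sigma> (mderiv \<gamma> f) = mderiv (\<lambda>i. \<sigma> i + \<gamma> i) f"
proof -
  obtain xs where xs: "\<And>f. smooth f \<Longrightarrow> mderiv \<sigma> f = foldr partial xs f" "\<And>i. count_list xs i = \<sigma> i"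
    by (metis obtain_mderiv)
  obtain ys where ys: "\<And>f. smooth f \<Longrightarrow> mderiv \<gamma> f = foldr partial ys f" "\<And>i. count_list ys i = \<gamma> i"
    by (metis obtain_mderiv)
  have "mderiv (\<lambda>i. \<sigma> i + \<gamma> i) f = foldr partial (xs @ ys) f"
    by (intro mderiv_eq assms) (simp add: xs ys)
  then show ?thesis
    by (simp add: xs ys assms smooth_foldr)
qed

lemma foldr_partial_add:
  assumes "smooth f" "smooth g"
  shows "foldr partial xs (\<lambda>x. f x + g x) = (\<lambda>x. foldr partial xs f x + foldr partial xs g x)"
  by (induction xs) (use assms in \<open>simp_all add: partial_add smooth_differentiable smooth_foldr\<close>)

lemma foldr_partial_cmult:
  assumes "smooth f"
  shows "foldr partial xs (\<lambda>x. c * f x) = (\<lambda>x. c * foldr partial xs f x)"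
  by (induction xs) (use assms in \<open>simp_all add: partial_cmult smooth_foldr\<close>)

lemma mderiv_add:
  assumes "smooth f" "smooth g"
  shows "mderiv \<sigma> (\<lambda>x. f x + g x) = (\<lambda>x. mderiv \<sigma> f x + mderiv \<sigma> g x)"
  by (rule obtain_mderiv[of \<sigma>]) (simp add: assms smooth_add foldr_partial_add)

lemma mderiv_cmult: "smooth f \<Longrightarrow> mderiv \<sigma> (\<lambda>x. c * f x) = (\<lambda>x. c * mderiv \<sigma> f x)"
  by (rule obtain_mderiv[of \<sigma>]) (simp add: smooth_cmult foldr_partial_cmult)

text \<open>Both functions have the same set of derivatives at corresponding points. Since
  \<open>frechet_derivative\<close> is a choice from this set, the identity holds even where
  \<open>f\<close> is not differentiable.\<close>

lemma partial_translate: "partial i (\<lambda>x. f (x + c)) = (\<lambda>x. partial i f (x + c))"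
proof
  fix x
  have eq: "((\<lambda>x. f (x + c)) has_derivative f') (at x) \<longleftrightarrow> (f has_derivative f') (at (x + c))" for f'
  proof
    assume "((\<lambda>x. f (x + c)) has_derivative f') (at x)"
    then have *: "((\<lambda>x. f (x + c)) has_derivative f') (at ((x + c) - c))" by simp
    have "((\<lambda>y. y - c) has_derivative (\<lambda>v. v)) (at (x + c))"
      by (auto intro!: derivative_eq_intros)
    from has_derivative_compose[where g = "\<lambda>x. f (x + c)" and f = "\<lambda>y. y - c", OF this *]
    show "(f has_derivative f') (at (x + c))" by simp
  next
    assume *: "(f has_derivative f') (at (x + c))"
    have "((\<lambda>y. y + c) has_derivative (\<lambda>v. v)) (at x)"
      by (auto intro!: derivative_eq_intros)
    from has_derivative_compose[where g = f and f = "\<lambda>y. y + c", OF this *]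
    show "((\<lambda>x. f (x + c)) has_derivative f') (at x)" by simp
  qed
  show "partial i (\<lambda>x. f (x + c)) x = partial i f (x + c)"
    by (simp add: partial_def frechet_derivative_def eq)
qed

lemma foldr_partial_translate: "foldr partial xs (\<lambda>x. f (x + c)) = (\<lambda>x. foldr partial xs f (x + c))"
  by (induction xs) (simp_all add: partial_translate)

lemma mderiv_translate: "mderiv \<sigma> (\<lambda>x. f (x + c)) = (\<lambda>x. mderiv \<sigma> f (x + c))"
  by (simp add: mderiv_def foldr_partial_translate)

lemma smooth_translate:
  assumes "smooth f" shows "smooth (\<lambda>x. f (x + c))"
  unfolding smooth_def foldr_partial_translate
proof (intro allI)
  fix "is" x
  have "(foldr partial is f \<circ> (\<lambda>x. x + c)) differentiable (at x)"
    by (rule differentiable_chain_at)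
      (use assms in \<open>auto simp: smooth_def intro!: differentiable_add differentiable_ident\<close>)
  then show "(\<lambda>x. foldr partial is f (x + c)) differentiable at x"
    by (simp add: o_def)
qed

section \<open>Test functions\<close>

lemma test_functionsD:
  assumes "\<phi> \<in> test_functions D"
  shows "smooth \<phi>" "compact (closure {x. \<phi> x \<noteq> 0})" "closure {x. \<phi> x \<noteq> 0} \<subseteq> D"
    "x \<notin> D \<Longrightarrow> \<phi> x = 0"
  using assms closure_subset[of "{x. \<phi> x \<noteq> 0}"] by (auto simp: test_functions_def)

lemma not_in_support: "x \<notin> closure {x. f x \<noteq> 0} \<Longrightarrow> f x = 0"
  using closure_subset[of "{x. f x \<noteq> 0}"] by blast

lemma test_functionsI:
  assumes "smooth \<phi>" "compact K" "K \<subseteq> D" "\<And>x. x \<notin> K \<Longrightarrow> \<phi> x = 0"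
  shows "\<phi> \<in> test_functions D"
proof -
  have "closure {x. \<phi> x \<noteq> 0} \<subseteq> K"
    using assms by (intro closure_minimal) (auto intro: compact_imp_closed)
  then show ?thesis
    using assms compact_Int_closed[of K "closure {x. \<phi> x \<noteq> 0}"]
    by (auto simp: test_functions_def Int_absorb1)
qed

lemma test_functions_mono: "\<Omega> \<subseteq> D \<Longrightarrow> test_functions \<Omega> \<subseteq> test_functions D"
  by (auto simp: test_functions_def)

lemma test_functions_zero: "(\<lambda>x. 0) \<in> test_functions D"
  by (auto simp: test_functions_def smooth_const)

lemma test_functions_add:
  assumes "\<phi> \<in> test_functions D" "\<psi> \<in> test_functions D"
  shows "(\<lambda>x. \<phi> x + \<psi> x) \<in> test_functions D"
proof (rule test_functionsI)
  let ?K = "closure {x. \<phi> x \<noteq> 0} \<union> closure {x. \<psi> x \<noteq> 0}"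
  show "compact ?K" "?K \<subseteq> D"
    using test_functionsD(2,3)[OF assms(1)] test_functionsD(2,3)[OF assms(2)] by auto
  show "\<phi> x + \<psi> x = 0" if "x \<notin> ?K" for x
    using that not_in_support[of x \<phi>] not_in_support[of x \<psi>] by auto
qed (intro smooth_add test_functionsD(1)[OF assms(1)] test_functionsD(1)[OF assms(2)])

lemma test_functions_cmult:
  assumes "\<phi> \<in> test_functions D" shows "(\<lambda>x. c * \<phi> x) \<in> test_functions D"
proof (rule test_functionsI)
  show "compact (closure {x. \<phi> x \<noteq> 0})" "closure {x. \<phi> x \<noteq> 0} \<subseteq> D"
    using test_functionsD(2,3)[OF assms] by auto
  show "c * \<phi> x = 0" if "x \<notin> closure {x. \<phi> x \<noteq> 0}" for x
    using not_in_support[OF that] by simp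
qed (intro smooth_cmult test_functionsD(1)[OF assms])

lemma test_functions_lincomb:
  assumes "\<phi> \<in> test_functions D" "\<psi> \<in> test_functions D"
  shows "(\<lambda>x. \<phi> x + c * \<psi> x) \<in> test_functions D"
  by (intro test_functions_add test_functions_cmult assms)

lemma partial_vanishes:
  assumes "closed K" "\<And>x. x \<notin> K \<Longrightarrow> f x = 0" "x \<notin> K"
  shows "partial i f x = 0"
proof -
  have "((\<lambda>x. 0) has_derivative (\<lambda>v. 0)) (at x)" by simp
  then have "(f has_derivative (\<lambda>v. 0)) (at x)"
    by (rule has_derivative_transform_within_open[OF _ open_Compl[OF assms(1)]]) (use assms in auto)
  then show ?thesis
    by (rule partial_eqI)
qed

lemma foldr_partial_vanishes:
  assumes "closed K" "\<And>x. x \<notin> K \<Longrightarrow> f x = 0" "x \<notin> K"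
  shows "foldr partial xs f x = 0"
  using assms(3) by (induction xs arbitrary: x) (auto intro: assms partial_vanishes[OF assms(1)])

lemma test_functions_foldr:
  assumes "\<phi> \<in> test_functions D" shows "foldr partial xs \<phi> \<in> test_functions D"
proof (rule test_functionsI)
  show K: "compact (closure {x. \<phi> x \<noteq> 0})" "closure {x. \<phi> x \<noteq> 0} \<subseteq> D"
    using test_functionsD(2,3)[OF assms] by auto
  show "foldr partial xs \<phi> x = 0" if "x \<notin> closure {x. \<phi> x \<noteq> 0}" for x
    by (rule foldr_partial_vanishes[OF _ _ that]) (rule closed_closure, rule not_in_support)
qed (intro smooth_foldr test_functionsD(1)[OF assms])

lemma test_functions_mderiv:
  assumes "\<phi> \<in> test_functions D" shows "mderiv \<sigma> \<phi> \<in> test_functions D"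
  by (simp add: mderiv_def test_functions_foldr assms)

lemma test_functions_translate:
  assumes "\<phi> \<in> test_functions ((\<lambda>x. x + c) ` D)" shows "(\<lambda>x. \<phi> (x + c)) \<in> test_functions D"
proof (rule test_functionsI)
  let ?K = "(\<lambda>x. x - c) ` closure {x. \<phi> x \<noteq> 0}"
  show "smooth (\<lambda>x. \<phi> (x + c))"
    by (intro smooth_translate test_functionsD[OF assms])
  show "compact ?K"
    by (intro compact_continuous_image continuous_intros test_functionsD[OF assms])
  show "?K \<subseteq> D"
    using test_functionsD(3)[OF assms] by auto
  show "\<phi> (x + c) = 0" if "x \<notin> ?K" for x
  proof (rule ccontr)
    assume "\<phi> (x + c) \<noteq> 0"
    then have "x + c \<in> closure {x. \<phi> x \<noteq> 0}"
      using not_in_support by metis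
    then have "(x + c) - c \<in> ?K" by blast
    with that show False by simp
  qed
qed

lemma test_functions_bounded:
  assumes "\<phi> \<in> test_functions D" obtains B where "\<And>x. \<bar>\<phi> x\<bar> \<le> B" "0 \<le> B"
proof -
  have "compact (\<phi> ` closure {x. \<phi> x \<noteq> 0})"
    by (intro compact_continuous_image smooth_continuous test_functionsD[OF assms])
  then obtain B where B: "\<And>x. x \<in> closure {x. \<phi> x \<noteq> 0} \<Longrightarrow> \<bar>\<phi> x\<bar> \<le> B"
    by (metis bounded_iff compact_imp_bounded imageI real_norm_def)
  have "\<bar>\<phi> x\<bar> \<le> max B 0" for x
    using B[of x] not_in_support[of x \<phi>] by (cases "\<phi> x = 0") force+
  then show ?thesis
    by (intro that[of "max B 0"]) auto
qed

section \<open>Integrals of test functions and integration by parts\<close>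

lemma bounded_support_integrable:
  fixes f :: "real^'n::finite \<Rightarrow> real"
  assumes "f \<in> borel_measurable borel" "compact K" "\<And>x. x \<notin> K \<Longrightarrow> f x = 0" "\<And>x. \<bar>f x\<bar> \<le> B"
  shows "integrable lborel f"
proof (rule Bochner_Integration.integrable_bound)
  show "integrable lborel (\<lambda>x. B * indicator K x)"
    using emeasure_compact_finite[OF assms(2)] borel_compact[OF assms(2)]
    by (intro integrable_mult_right integrable_real_indicator) auto
  show "AE x in lborel. norm (f x) \<le> norm (B * indicator K x)"
    using assms(3,4) by (intro AE_I2) (auto simp: indicator_def intro: order_trans[OF assms(4)])
qed (use assms in simp)

lemma test_functions_integrable: "\<phi> \<in> test_functions D \<Longrightarrow> integrable lborel \<phi>"
proof -
  assume \<phi>: "\<phi> \<in> test_functions D"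
  obtain B where B: "\<And>x. \<bar>\<phi> x\<bar> \<le> B"
    using test_functions_bounded[OF \<phi>] by blast
  show ?thesis
    by (rule bounded_support_integrable[OF smooth_measurable[OF test_functionsD(1)[OF \<phi>]]
          test_functionsD(2)[OF \<phi>] _ B]) (rule not_in_support)
qed

lemma integral_lebesgue_on_vanishing:
  fixes f :: "real^'n::finite \<Rightarrow> real"
  assumes "S \<in> sets lebesgue" "\<And>x. x \<notin> S \<Longrightarrow> f x = 0"
  shows "(\<integral>x. f x \<partial>lebesgue_on S) = (\<integral>x. f x \<partial>lebesgue)"
    "integrable (lebesgue_on S) f \<longleftrightarrow> integrable lebesgue f"
proof -
  have "(\<lambda>x. indicator S x *\<^sub>R f x) = f"
    using assms(2) by (auto simp: fun_eq_iff indicator_def)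
  then show "(\<integral>x. f x \<partial>lebesgue_on S) = (\<integral>x. f x \<partial>lebesgue)"
    "integrable (lebesgue_on S) f \<longleftrightarrow> integrable lebesgue f"
    using assms(1) integral_restrict_space[of S lebesgue f] integrable_restrict_space[of S lebesgue f]
    by auto
qed

text \<open>
  The integrals of the difference quotients vanish because Lebesgue measure is translation invariant.
\<close>
lemma integral_partial_zero:
  fixes f :: "real^'n::finite \<Rightarrow> real"
  assumes f: "f \<in> test_functions UNIV"
  shows "(\<integral>x. partial i f x \<partial>lborel) = 0"
proof -
  note sf = test_functionsD(1)[OF f]
  define h where "h n = inverse (real (Suc n))" for n
  have h: "h n > 0" "h n \<le> 1" for n by (auto simp: h_def field_simps)
  have h0: "h \<longlonglongrightarrow> 0"
    unfolding h_def by (rule LIMSEQ_inverse_real_of_nat)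
  define q where "q n x = (f (h n *\<^sub>R axis i 1 + x) - f x) / h n" for n x
  have pf: "partial i f \<in> test_functions UNIV"
    using test_functions_foldr[OF f, of "[i]"] by simp
  obtain B where B: "\<And>x. \<bar>partial i f x\<bar> \<le> B" "0 \<le> B"
    using test_functions_bounded[OF pf] by blast
  obtain R where R: "\<And>x. x \<in> closure {x. f x \<noteq> 0} \<Longrightarrow> norm x \<le> R"
    using test_functionsD(2)[OF f] by (meson bounded_iff compact_imp_bounded)
  have fR: "f x = 0" if "norm x > R" for x
    by (rule not_in_support) (use R[of x] that in auto)
  \<comment> \<open>Dominating function, uniform in \<open>n\<close>: inside the ball the mean value
    theorem turns the quotient into a value of \<open>partial i f\<close>; outside,
    \<open>h n \<le> 1\<close> keeps both points beyond the support.\<close>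
  have qB: "norm (q n x) \<le> B * indicator (cball 0 (R + 1)) x" for n x
  proof (cases "norm x \<le> R + 1")
    case True
    have "((\<lambda>s. f (x + s *\<^sub>R axis i 1)) has_real_derivative partial i f (x + s *\<^sub>R axis i 1)) (at s)" for s
      by (rule partial_along_axis[OF sf])
    from MVT2[OF h(1)[of n] this] obtain z where
      "f (x + h n *\<^sub>R axis i 1) - f x = h n * partial i f (x + z *\<^sub>R axis i 1)"
      by auto
    then have "q n x = partial i f (x + z *\<^sub>R axis i 1)"
      using h(1)[of n] by (simp add: q_def add.commute)
    then show ?thesis
      using True B(1) by (simp add: indicator_def)
  next
    case False
    have "norm x \<le> norm (h n *\<^sub>R axis i 1 + x) + norm (h n *\<^sub>R axis i (1::real))"
      using norm_triangle_ineq4[of "h n *\<^sub>R axis i 1 + x" "h n *\<^sub>R axis i (1::real)"] by simp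
    then have "norm (h n *\<^sub>R axis i 1 + x) > R"
      using False h[of n] by simp
    then have "q n x = 0"
      using False by (simp add: q_def fR)
    then show ?thesis
      using B by simp
  qed
  have "(\<lambda>n. \<integral>x. q n x \<partial>lborel) \<longlonglongrightarrow> (\<integral>x. partial i f x \<partial>lborel)"
  proof (rule integral_dominated_convergence[where w = "\<lambda>x. B * indicator (cball 0 (R + 1)) x"])
    have [measurable]: "f \<in> borel_measurable borel"
      using sf by (rule smooth_measurable)
    have "(\<lambda>x. (f (h n *\<^sub>R axis i 1 + x) - f x) / h n) \<in> borel_measurable borel" for n
      by measurable
    then show "q n \<in> borel_measurable lborel" for n
      by (simp add: q_def[abs_def])
    show "partial i f \<in> borel_measurable lborel"
      using smooth_measurable[OF smooth_partial[OF sf]] by simp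
    show "integrable lborel (\<lambda>x. B * indicator (cball (0::real^'n) (R + 1)) x)"
      using emeasure_compact_finite[OF compact_cball[of 0 "R + 1"]]
      by (intro integrable_mult_right integrable_real_indicator) auto
    show "AE x in lborel. (\<lambda>n. q n x) \<longlonglongrightarrow> partial i f x"
    proof (rule AE_I2)
      fix x
      have "((\<lambda>s. f (x + s *\<^sub>R axis i 1)) has_real_derivative partial i f x) (at 0)"
        using partial_along_axis[OF sf, of x i 0] by simp
      then have "((\<lambda>s. (f (x + s *\<^sub>R axis i 1) - f x) / s) \<longlongrightarrow> partial i f x) (at 0)"
        by (simp add: DERIV_def)
      moreover have "filterlim h (at 0) sequentially"
        unfolding filterlim_at using h0 h(1) by (simp add: less_imp_neq[THEN not_sym])
      ultimately have "(\<lambda>n. (f (x + h n *\<^sub>R axis i 1) - f x) / h n) \<longlonglongrightarrow> partial i f x"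
        by (rule filterlim_compose)
      then show "(\<lambda>n. q n x) \<longlonglongrightarrow> partial i f x"
        by (simp add: q_def add.commute)
    qed
  qed (rule AE_I2, rule qB)
  moreover have "(\<integral>x. q n x \<partial>lborel) = 0" for n
  proof -
    let ?v = "h n *\<^sub>R axis i (1::real)"
    have int: "integrable lborel f" by (rule test_functions_integrable[OF f])
    have "integrable (distr lborel borel ((+) ?v)) f"
      using int by (simp add: lborel_distr_plus)
    then have int2: "integrable lborel (\<lambda>x. f (?v + x))"
      using smooth_measurable[OF sf] by (subst (asm) integrable_distr_eq) auto
    have "(\<integral>x. f x \<partial>lborel) = (\<integral>x. f x \<partial>distr lborel borel ((+) ?v))"
      by (simp add: lborel_distr_plus)
    also have "\<dots> = (\<integral>x. f (?v + x) \<partial>lborel)"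
      using smooth_measurable[OF sf] by (subst integral_distr) auto
    finally show ?thesis
      using int int2 by (simp add: q_def)
  qed
  ultimately show ?thesis
    by (simp add: LIMSEQ_const_iff)
qed

lemma test_functions_mult_smooth:
  assumes "\<phi> \<in> test_functions D" "smooth \<psi>" shows "(\<lambda>x. \<phi> x * \<psi> x) \<in> test_functions D"
proof (rule test_functionsI)
  show "compact (closure {x. \<phi> x \<noteq> 0})" "closure {x. \<phi> x \<noteq> 0} \<subseteq> D"
    using test_functionsD(2,3)[OF assms(1)] by auto
  show "\<phi> x * \<psi> x = 0" if "x \<notin> closure {x. \<phi> x \<noteq> 0}" for x
    using not_in_support[OF that] by simp
qed (intro smooth_mult test_functionsD(1)[OF assms(1)] assms(2))

lemma integral_by_parts:
  assumes "\<phi> \<in> test_functions UNIV" "\<psi> \<in> test_functions UNIV"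
  shows "(\<integral>x. \<phi> x * partial i \<psi> x \<partial>lborel) = - (\<integral>x. partial i \<phi> x * \<psi> x \<partial>lborel)"
proof -
  note s = assms[THEN test_functionsD(1)]
  have t: "partial i \<phi> \<in> test_functions UNIV"
    using test_functions_foldr[OF assms(1), of "[i]"] by simp
  have "0 = (\<integral>x. \<phi> x * partial i \<psi> x + partial i \<phi> x * \<psi> x \<partial>lborel)"
    using integral_partial_zero[OF test_functions_mult_smooth[OF assms(1) s(2)], of i] s
    by (simp add: partial_mult smooth_differentiable)
  also have "\<dots> = (\<integral>x. \<phi> x * partial i \<psi> x \<partial>lborel) + (\<integral>x. partial i \<phi> x * \<psi> x \<partial>lborel)"
    by (intro Bochner_Integration.integral_add test_functions_integrable[of _ UNIV] test_functions_mult_smooth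
        assms(1) t smooth_partial s)
  finally show ?thesis by simp
qed

text \<open>The derivatives leave \<open>\<psi>\<close> from the outermost inwards and therefore
  arrive at \<open>\<phi>\<close> in reverse order; only their number affects the sign.\<close>

lemma integral_by_parts_foldr:
  assumes "\<phi> \<in> test_functions UNIV" "\<psi> \<in> test_functions UNIV"
  shows "(\<integral>x. \<phi> x * foldr partial xs \<psi> x \<partial>lborel) =
    (-1) ^ length xs * (\<integral>x. foldr partial (rev xs) \<phi> x * \<psi> x \<partial>lborel)"
  using assms
proof (induction xs arbitrary: \<phi>)
  case (Cons i xs)
  have t: "partial i \<phi> \<in> test_functions UNIV"
    using test_functions_foldr[OF Cons.prems(1), of "[i]"] by simp
  show ?case
    using integral_by_parts[OF Cons.prems(1) test_functions_foldr[OF Cons.prems(2)], of i xs]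
      Cons.IH[OF t Cons.prems(2)]
    by simp
qed simp

lemma integral_by_parts_mderiv:
  assumes "\<phi> \<in> test_functions UNIV" "\<psi> \<in> test_functions UNIV"
  shows "(\<integral>x. \<phi> x * mderiv \<sigma> \<psi> x \<partial>lborel) = (-1) ^ msize \<sigma> * (\<integral>x. mderiv \<sigma> \<phi> x * \<psi> x \<partial>lborel)"
proof -
  obtain xs where xs: "\<And>f. smooth f \<Longrightarrow> mderiv \<sigma> f = foldr partial xs f" "length xs = msize \<sigma>"
    "\<And>i. count_list xs i = \<sigma> i"
    using obtain_mderiv[of \<sigma>] by blast
  have "mderiv \<sigma> \<phi> = foldr partial (rev xs) \<phi>"
    by (rule mderiv_eq[OF test_functionsD(1)[OF assms(1)]]) (simp add: xs(3))
  moreover have "mderiv \<sigma> \<psi> = foldr partial xs \<psi>"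
    by (rule xs(1)[OF test_functionsD(1)[OF assms(2)]])
  ultimately show ?thesis
    using integral_by_parts_foldr[OF assms, of xs] xs(2) by simp
qed

section \<open>The spaces \<open>L2\<close>\<close>

lemma L2D:
  assumes "f \<in> L2 S"
  shows "f \<in> borel_measurable (lebesgue_on S)" "integrable (lebesgue_on S) (\<lambda>x. (f x)\<^sup>2)"
  using assms by (auto simp: L2_def)

lemma L2_norm_nonneg: "0 \<le> L2_norm S f"
  by (simp add: L2_norm_def)

lemma L2_norm_sq: "(L2_norm S f)\<^sup>2 = (\<integral>x. (f x)\<^sup>2 \<partial>lebesgue_on S)"
  by (simp add: L2_norm_def)

lemma L2_mult_integrable:
  assumes "f \<in> L2 S" "g \<in> L2 S"
  shows "integrable (lebesgue_on S) (\<lambda>x. f x * g x)"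
proof (rule Bochner_Integration.integrable_bound)
  show "integrable (lebesgue_on S) (\<lambda>x. (f x)\<^sup>2 + (g x)\<^sup>2)"
    by (intro Bochner_Integration.integrable_add L2D assms)
  have "\<bar>a * b\<bar> \<le> a\<^sup>2 + b\<^sup>2" for a b :: real
  proof -
    have "0 \<le> \<bar>a\<bar> * \<bar>b\<bar>" by simp
    then show ?thesis
      using sum_squares_bound[of "\<bar>a\<bar>" "\<bar>b\<bar>"] unfolding abs_mult power2_abs by linarith
  qed
  then show "AE x in lebesgue_on S. norm (f x * g x) \<le> norm ((f x)\<^sup>2 + (g x)\<^sup>2)"
    by (intro AE_I2) simp
  show "(\<lambda>x. f x * g x) \<in> borel_measurable (lebesgue_on S)"
    by (intro borel_measurable_times L2D assms)
qed

lemma L2_cmult: "f \<in> L2 S \<Longrightarrow> (\<lambda>x. c * f x) \<in> L2 S"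
  by (auto simp: L2_def power_mult_distrib)

lemma L2_add:
  assumes "f \<in> L2 S" "g \<in> L2 S" shows "(\<lambda>x. f x + g x) \<in> L2 S"
proof -
  have "integrable (lebesgue_on S) (\<lambda>x. (f x)\<^sup>2 + (g x)\<^sup>2 + 2 * (f x * g x))"
    by (intro Bochner_Integration.integrable_add integrable_mult_right L2D L2_mult_integrable assms)
  then show ?thesis
    using L2D(1)[OF assms(1)] L2D(1)[OF assms(2)]
    by (auto simp: L2_def power2_sum algebra_simps)
qed

lemma L2_lincomb: "f \<in> L2 S \<Longrightarrow> g \<in> L2 S \<Longrightarrow> (\<lambda>x. f x + c * g x) \<in> L2 S"
  by (intro L2_add L2_cmult)

lemma L2_diff: "f \<in> L2 S \<Longrightarrow> g \<in> L2 S \<Longrightarrow> (\<lambda>x. f x - g x) \<in> L2 S"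
  using L2_lincomb[of f S g "-1"] by simp

text \<open>The source of the Cauchy--Schwarz inequalities for L2 and for the energy, and of the
  near-minimality estimate for the Riesz sequence. For \<open>c > 0\<close> the minimiser -b/c gives
  the claim. For \<open>c = 0\<close> and \<open>b \<noteq> 0\<close> the chosen \<open>s\<close>
  gives the value -1; for \<open>c < 0\<close> the values at \<open>s\<close> and \<open>-s\<close>
  add up to -2.\<close>

lemma nonneg_quadratic_discriminant:
  fixes a b c :: real
  assumes "\<And>s. 0 \<le> a + 2 * s * b + s\<^sup>2 * c"
  shows "b\<^sup>2 \<le> a * c"
proof (cases "c = 0")
  case True
  have "b = 0"
  proof (rule ccontr)
    assume "b \<noteq> 0"
    then show False
      using assms[of "- (a + 1) / (2 * b)"] True by (simp add: field_simps)
  qed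
  then show ?thesis using True by simp
next
  case False
  have "c > 0"
  proof (rule ccontr)
    assume "\<not> c > 0"
    then have c: "c < 0" using False by simp
    define s where "s = sqrt ((a + 1) / (- c))"
    have "a \<ge> 0" using assms[of 0] by simp
    then have "s\<^sup>2 = (a + 1) / (- c)"
      using c unfolding s_def by (intro real_sqrt_pow2 divide_nonneg_pos) auto
    then have "s\<^sup>2 * c = - (a + 1)"
      using c by (simp add: field_simps)
    with assms[of s] assms[of "- s"] show False by simp
  qed
  then show ?thesis
    using assms[of "- b / c"] by (simp add: field_simps power2_eq_square)
qed

lemma L2_Cauchy_Schwarz:
  assumes "f \<in> L2 S" "g \<in> L2 S"
  shows "\<bar>\<integral>x. f x * g x \<partial>lebesgue_on S\<bar> \<le> L2_norm S f * L2_norm S g"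
proof -
  have "0 \<le> (\<integral>x. (f x)\<^sup>2 \<partial>lebesgue_on S) + 2 * s * (\<integral>x. f x * g x \<partial>lebesgue_on S)
      + s\<^sup>2 * (\<integral>x. (g x)\<^sup>2 \<partial>lebesgue_on S)" for s
  proof -
    have "0 \<le> (\<integral>x. (f x + s * g x)\<^sup>2 \<partial>lebesgue_on S)" by simp
    also have "\<dots> = (\<integral>x. (f x)\<^sup>2 + 2 * s * (f x * g x) + s\<^sup>2 * (g x)\<^sup>2 \<partial>lebesgue_on S)"
      by (intro Bochner_Integration.integral_cong) (auto simp: power2_eq_square algebra_simps)
    also have "\<dots> = (\<integral>x. (f x)\<^sup>2 \<partial>lebesgue_on S) + 2 * s * (\<integral>x. f x * g x \<partial>lebesgue_on S)
        + s\<^sup>2 * (\<integral>x. (g x)\<^sup>2 \<partial>lebesgue_on S)"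
      using L2D(2)[OF assms(1)] L2D(2)[OF assms(2)] L2_mult_integrable[OF assms] by simp
    finally show ?thesis .
  qed
  from nonneg_quadratic_discriminant[OF this]
  have "(\<integral>x. f x * g x \<partial>lebesgue_on S)\<^sup>2 \<le> (L2_norm S f * L2_norm S g)\<^sup>2"
    by (simp add: power_mult_distrib L2_norm_sq)
  then show ?thesis
    using abs_le_square_iff[of "\<integral>x. f x * g x \<partial>lebesgue_on S" "L2_norm S f * L2_norm S g"]
    by (simp add: L2_norm_nonneg abs_mult)
qed

lemma L2_norm_triangle:
  assumes "f \<in> L2 S" "g \<in> L2 S"
  shows "L2_norm S (\<lambda>x. f x + g x) \<le> L2_norm S f + L2_norm S g"
proof (rule power2_le_imp_le)
  have "(L2_norm S (\<lambda>x. f x + g x))\<^sup>2 = (\<integral>x. (f x)\<^sup>2 + 2 * (f x * g x) + (g x)\<^sup>2 \<partial>lebesgue_on S)"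
    by (auto simp: L2_norm_sq power2_sum algebra_simps intro!: Bochner_Integration.integral_cong)
  also have "\<dots> = (L2_norm S f)\<^sup>2 + 2 * (\<integral>x. f x * g x \<partial>lebesgue_on S) + (L2_norm S g)\<^sup>2"
    using L2D(2)[OF assms(1)] L2D(2)[OF assms(2)] L2_mult_integrable[OF assms] by (simp add: L2_norm_sq)
  also have "\<dots> \<le> (L2_norm S f + L2_norm S g)\<^sup>2"
    using L2_Cauchy_Schwarz[OF assms] by (simp add: power2_sum)
  finally show "(L2_norm S (\<lambda>x. f x + g x))\<^sup>2 \<le> (L2_norm S f + L2_norm S g)\<^sup>2" .
qed (simp add: L2_norm_nonneg)

lemma L2_norm_diff_commute: "L2_norm S (\<lambda>x. f x - g x) = L2_norm S (\<lambda>x. g x - f x)"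
  by (simp add: L2_norm_def power2_commute)

lemma L2_norm_cong_AE:
  assumes "f \<in> L2 S" "g \<in> L2 S" "AE x in lebesgue_on S. f x = g x"
  shows "L2_norm S f = L2_norm S g"
  unfolding L2_norm_def using assms(3) L2D[OF assms(1)] L2D[OF assms(2)]
  by (intro arg_cong[where f = sqrt] integral_cong_AE) auto

lemma L2_norm_limit:
  assumes "\<And>n. f n \<in> L2 S" "w \<in> L2 S" "(\<lambda>n. L2_norm S (\<lambda>x. w x - f n x)) \<longlonglongrightarrow> 0"
  shows "(\<lambda>n. L2_norm S (f n)) \<longlonglongrightarrow> L2_norm S w"
proof -
  have "\<bar>L2_norm S (f n) - L2_norm S w\<bar> \<le> L2_norm S (\<lambda>x. w x - f n x)" for n
    using L2_norm_triangle[OF L2_diff[OF assms(2) assms(1)[of n]] assms(1)[of n]]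
      L2_norm_triangle[OF L2_diff[OF assms(1)[of n] assms(2)] assms(2)]
    by (simp add: L2_norm_diff_commute[of S "f n" w])
  then have "(\<lambda>n. L2_norm S (f n) - L2_norm S w) \<longlonglongrightarrow> 0"
    by (intro Lim_null_comparison[OF _ assms(3)]) simp
  then show ?thesis
    by (simp add: LIM_zero_iff)
qed

lemma L2_inner_limit:
  assumes "\<And>n. f n \<in> L2 S" "w \<in> L2 S" "(\<lambda>n. L2_norm S (\<lambda>x. w x - f n x)) \<longlonglongrightarrow> 0" "g \<in> L2 S"
  shows "(\<lambda>n. \<integral>x. f n x * g x \<partial>lebesgue_on S) \<longlonglongrightarrow> (\<integral>x. w x * g x \<partial>lebesgue_on S)"
proof -
  have "\<bar>(\<integral>x. w x * g x \<partial>lebesgue_on S) - (\<integral>x. f n x * g x \<partial>lebesgue_on S)\<bar>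
      \<le> L2_norm S (\<lambda>x. w x - f n x) * L2_norm S g" for n
  proof -
    have "(\<integral>x. w x * g x \<partial>lebesgue_on S) - (\<integral>x. f n x * g x \<partial>lebesgue_on S)
        = (\<integral>x. (w x - f n x) * g x \<partial>lebesgue_on S)"
      using L2_mult_integrable[OF assms(2,4)] L2_mult_integrable[OF assms(1)[of n] assms(4)]
      by (simp add: left_diff_distrib)
    then show ?thesis
      using L2_Cauchy_Schwarz[OF L2_diff[OF assms(2) assms(1)[of n]] assms(4)] by simp
  qed
  then have "\<forall>\<^sub>F n in sequentially. norm ((\<integral>x. w x * g x \<partial>lebesgue_on S) - (\<integral>x. f n x * g x \<partial>lebesgue_on S))
      \<le> L2_norm S (\<lambda>x. w x - f n x) * L2_norm S g"
    by simp
  moreover have "(\<lambda>n. L2_norm S (\<lambda>x. w x - f n x) * L2_norm S g) \<longlonglongrightarrow> 0"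
    by (intro tendsto_mult_left_zero assms)
  ultimately have "(\<lambda>n. (\<integral>x. w x * g x \<partial>lebesgue_on S) - (\<integral>x. f n x * g x \<partial>lebesgue_on S)) \<longlonglongrightarrow> 0"
    by (rule Lim_null_comparison)
  from tendsto_diff[OF tendsto_const[of "\<integral>x. w x * g x \<partial>lebesgue_on S"] this] show ?thesis
    by simp
qed

lemma bounded_in_L2:
  assumes "S \<in> lmeasurable" "f \<in> borel_measurable (lebesgue_on S)" "\<And>x. x \<in> S \<Longrightarrow> \<bar>f x\<bar> \<le> B"
  shows "f \<in> L2 S"
proof -
  have "integrable (lebesgue_on S) (\<lambda>x. (f x)\<^sup>2)"
  proof (rule Bochner_Integration.integrable_bound)
    show "integrable (lebesgue_on S) (\<lambda>x. B\<^sup>2)"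
      using finite_measure_lebesgue_on[OF assms(1)] by (simp add: finite_measure.integrable_const)
    have "\<bar>f x\<bar> \<le> \<bar>B\<bar>" if "x \<in> S" for x
      using assms(3)[OF that] by simp
    then show "AE x in lebesgue_on S. norm ((f x)\<^sup>2) \<le> norm (B\<^sup>2)"
      by (intro AE_I2) (auto simp: abs_le_square_iff)
  qed (use assms in simp)
  then show ?thesis
    using assms by (simp add: L2_def)
qed

lemma borel_measurable_lebesgue_onI:
  assumes "f \<in> borel_measurable borel" shows "f \<in> borel_measurable (lebesgue_on S)"
  using assms by (intro measurable_restrict_space1 measurable_completion) simp

lemma L2_one:
  assumes "S \<in> lmeasurable" shows "(\<lambda>x. 1) \<in> L2 S"
  by (rule bounded_in_L2[OF assms, where B = 1]) auto

lemma L2_integrable: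
  assumes "S \<in> lmeasurable" "f \<in> L2 S" shows "integrable (lebesgue_on S) f"
  using L2_mult_integrable[OF assms(2) L2_one[OF assms(1)]] by simp

text \<open>On a set of finite measure an L2 Cauchy sequence is Cauchy in L1, so a subsequence
  converges almost everywhere. Fatou's lemma along it, with \<open>f m\<close> fixed, shows that the
  pointwise limit is also the L2 limit of the whole sequence.\<close>

lemma L2_complete:
  assumes S: "S \<in> lmeasurable" and f: "\<And>n. f n \<in> L2 S"
    and Cauchy: "\<And>e. e > 0 \<Longrightarrow> \<exists>N. \<forall>m\<ge>N. \<forall>n\<ge>N. L2_norm S (\<lambda>x. f m x - f n x) < e"
  shows "\<exists>w\<in>L2 S. (\<lambda>n. L2_norm S (\<lambda>x. w x - f n x)) \<longlonglongrightarrow> 0"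
proof -
  let ?M = "lebesgue_on S"
  have [measurable]: "f n \<in> borel_measurable ?M" for n
    using L2D(1)[OF f] .
  define K where "K = L2_norm S (\<lambda>x. 1)"
  have K: "K \<ge> 0" by (simp add: K_def L2_norm_nonneg)
  have L1: "\<exists>N. \<forall>i\<ge>N. \<forall>j\<ge>N. (LINT x|?M. norm (f i x - f j x)) < e" if "e > 0" for e
  proof -
    \<comment> \<open>\<open>K\<close> vanishes when \<open>S\<close> is a null set, hence the
      divisor \<open>K + 1\<close>.\<close>
    from that K have "e / (K + 1) > 0" by simp
    from Cauchy[OF this] obtain N where
      N: "\<And>i j. i \<ge> N \<Longrightarrow> j \<ge> N \<Longrightarrow> L2_norm S (\<lambda>x. f i x - f j x) < e / (K + 1)"
      by blast
    have "(LINT x|?M. norm (f i x - f j x)) < e" if "i \<ge> N" "j \<ge> N" for i j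
    proof -
      have d: "(\<lambda>x. \<bar>f i x - f j x\<bar>) \<in> L2 S"
        using L2_diff[OF f f, of i j] by (auto simp: L2_def)
      have "(LINT x|?M. norm (f i x - f j x)) \<le> L2_norm S (\<lambda>x. \<bar>f i x - f j x\<bar>) * K"
        using L2_Cauchy_Schwarz[OF d L2_one[OF S]] by (simp add: K_def)
      also have "\<dots> = L2_norm S (\<lambda>x. f i x - f j x) * K"
        by (simp add: L2_norm_def)
      also have "\<dots> \<le> L2_norm S (\<lambda>x. f i x - f j x) * (K + 1)"
        by (simp add: algebra_simps L2_norm_nonneg)
      also have "\<dots> < e"
        using N[OF that] K by (simp add: field_simps)
      finally show ?thesis .
    qed
    then show ?thesis by blast
  qed
  obtain r where r: "strict_mono r" "AE x in ?M. Cauchy (\<lambda>i. f (r i) x)"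
    using cauchy_L1_AE_cauchy_subseq[OF L2_integrable[OF S f] L1] by blast
  define w where "w x = lim (\<lambda>i. f (r i) x)" for x
  have [measurable]: "w \<in> borel_measurable ?M"
    unfolding w_def[abs_def] by measurable
  have lim: "AE x in ?M. (\<lambda>i. f (r i) x) \<longlonglongrightarrow> w x"
    using r(2) by eventually_elim (simp add: w_def Cauchy_convergent convergent_LIMSEQ_iff[symmetric])
  have bound: "(\<integral>\<^sup>+x. ennreal ((w x - f m x)\<^sup>2) \<partial>?M) \<le> ennreal (e\<^sup>2)"
    if e: "e > 0" and N: "\<And>i j. i \<ge> N \<Longrightarrow> j \<ge> N \<Longrightarrow> L2_norm S (\<lambda>x. f i x - f j x) < e" and m: "m \<ge> N"
    for e N m
  proof -
    have "(\<integral>\<^sup>+x. ennreal ((w x - f m x)\<^sup>2) \<partial>?M)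
        = (\<integral>\<^sup>+x. liminf (\<lambda>i. ennreal ((f (r i) x - f m x)\<^sup>2)) \<partial>?M)"
    proof (rule nn_integral_cong_AE)
      show "AE x in ?M. ennreal ((w x - f m x)\<^sup>2) = liminf (\<lambda>i. ennreal ((f (r i) x - f m x)\<^sup>2))"
        using lim
      proof eventually_elim
        case (elim x)
        have "(\<lambda>i. ennreal ((f (r i) x - f m x)\<^sup>2)) \<longlonglongrightarrow> ennreal ((w x - f m x)\<^sup>2)"
          by (intro tendsto_intros elim)
        then show ?case
          by (rule lim_imp_Liminf[OF sequentially_bot, symmetric])
      qed
    qed
    also have "\<dots> \<le> liminf (\<lambda>i. \<integral>\<^sup>+x. ennreal ((f (r i) x - f m x)\<^sup>2) \<partial>?M)"
      by (intro nn_integral_liminf) measurable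
    also have "\<dots> \<le> liminf (\<lambda>i. ennreal (e\<^sup>2))"
    proof (rule Liminf_mono)
      have "(\<integral>\<^sup>+x. ennreal ((f (r i) x - f m x)\<^sup>2) \<partial>?M) \<le> ennreal (e\<^sup>2)" if "i \<ge> N" for i
      proof -
        have "r i \<ge> N"
          using that seq_suble[OF r(1), of i] by simp
        from N[OF this m] have "(L2_norm S (\<lambda>x. f (r i) x - f m x))\<^sup>2 \<le> e\<^sup>2"
          by (intro power_mono) (auto simp: L2_norm_nonneg)
        moreover have "(\<integral>\<^sup>+x. ennreal ((f (r i) x - f m x)\<^sup>2) \<partial>?M) = ennreal ((L2_norm S (\<lambda>x. f (r i) x - f m x))\<^sup>2)"
          unfolding L2_norm_sq by (intro nn_integral_eq_integral L2D L2_diff f) auto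
        ultimately show ?thesis
          by (simp add: ennreal_leI)
      qed
      then show "\<forall>\<^sub>F i in sequentially. (\<integral>\<^sup>+x. ennreal ((f (r i) x - f m x)\<^sup>2) \<partial>?M) \<le> ennreal (e\<^sup>2)"
        by (auto simp: eventually_sequentially)
    qed
    finally show ?thesis
      by (simp add: Liminf_const)
  qed
  have wf: "(\<lambda>x. w x - f m x) \<in> L2 S \<and> L2_norm S (\<lambda>x. w x - f m x) \<le> e"
    if e: "e > 0" and N: "\<And>i j. i \<ge> N \<Longrightarrow> j \<ge> N \<Longrightarrow> L2_norm S (\<lambda>x. f i x - f j x) < e" and m: "m \<ge> N"
    for e N m
  proof -
    note b = bound[OF that]
    have int: "integrable ?M (\<lambda>x. (w x - f m x)\<^sup>2)"
      by (rule integrableI_bounded) (use le_less_trans[OF b] in auto)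
    have "ennreal (\<integral>x. (w x - f m x)\<^sup>2 \<partial>?M) \<le> ennreal (e\<^sup>2)"
      using b nn_integral_eq_integral[OF int] by simp
    then have "(L2_norm S (\<lambda>x. w x - f m x))\<^sup>2 \<le> e\<^sup>2"
      unfolding L2_norm_sq by (simp add: ennreal_le_iff)
    then have "L2_norm S (\<lambda>x. w x - f m x) \<le> e"
      using e by (auto intro: power2_le_imp_le)
    with int show ?thesis
      by (simp add: L2_def)
  qed
  obtain N1 where N1: "\<And>i j. i \<ge> N1 \<Longrightarrow> j \<ge> N1 \<Longrightarrow> L2_norm S (\<lambda>x. f i x - f j x) < 1"
    using Cauchy[of 1] by auto
  have "(\<lambda>x. w x - f N1 x) \<in> L2 S"
    using wf[of 1 N1 N1] N1 by auto
  from L2_add[OF this f[of N1]] have "w \<in> L2 S" by simp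
  moreover have "(\<lambda>n. L2_norm S (\<lambda>x. w x - f n x)) \<longlonglongrightarrow> 0"
  proof (rule LIMSEQ_I)
    fix e :: real assume "0 < e"
    then have e: "e / 2 > 0" by simp
    from Cauchy[OF this] obtain N where
      N: "\<And>i j. i \<ge> N \<Longrightarrow> j \<ge> N \<Longrightarrow> L2_norm S (\<lambda>x. f i x - f j x) < e / 2"
      by blast
    show "\<exists>N. \<forall>n\<ge>N. norm (L2_norm S (\<lambda>x. w x - f n x) - 0) < e"
    proof (intro exI allI impI)
      fix n assume "n \<ge> N"
      from wf[OF e N this] show "norm (L2_norm S (\<lambda>x. w x - f n x) - 0) < e"
        using \<open>0 < e\<close> by (simp add: L2_norm_nonneg)
    qed
  qed
  ultimately show ?thesis by blast
qed

section \<open>Restriction to subsets and multiplication by bounded coefficients\<close>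

lemma integrable_lebesgue_on_subset:
  fixes f :: "_ \<Rightarrow> real"
  assumes "integrable (lebesgue_on D) f" "S \<subseteq> D" "S \<in> sets lebesgue" "D \<in> sets lebesgue"
  shows "integrable (lebesgue_on S) f"
  using set_integrable_subset[of lebesgue D f S] assms
  by (simp add: set_integrable_def integrable_restrict_space)

lemma L2_subset:
  assumes "f \<in> L2 D" "S \<subseteq> D" "S \<in> sets lebesgue" "D \<in> sets lebesgue"
  shows "f \<in> L2 S"
proof -
  have "f \<in> borel_measurable (lebesgue_on S)"
    using measurable_restrict_mono[OF L2D(1)[OF assms(1)] assms(2)] .
  moreover have "integrable (lebesgue_on S) (\<lambda>x. (f x)\<^sup>2)"
    using L2D(2)[OF assms(1)] assms(2-4) by (rule integrable_lebesgue_on_subset)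
  ultimately show ?thesis by (simp add: L2_def)
qed

lemma Linfty_mult_L2:
  assumes "a \<in> Linfty S" "f \<in> L2 S" shows "(\<lambda>x. a x * f x) \<in> L2 S"
proof -
  obtain M where M: "AE x in lebesgue_on S. \<bar>a x\<bar> \<le> M" and [measurable]: "a \<in> borel_measurable (lebesgue_on S)"
    using assms(1) by (auto simp: Linfty_def)
  have [measurable]: "f \<in> borel_measurable (lebesgue_on S)"
    using L2D[OF assms(2)] by simp
  have "integrable (lebesgue_on S) (\<lambda>x. (a x * f x)\<^sup>2)"
  proof (rule Bochner_Integration.integrable_bound)
    show "integrable (lebesgue_on S) (\<lambda>x. M\<^sup>2 * (f x)\<^sup>2)"
      by (intro integrable_mult_right L2D assms)
    show "AE x in lebesgue_on S. norm ((a x * f x)\<^sup>2) \<le> norm (M\<^sup>2 * (f x)\<^sup>2)"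
      using M
    proof eventually_elim
      case (elim x)
      then have "(a x)\<^sup>2 \<le> M\<^sup>2"
        by (simp add: abs_le_square_iff[symmetric])
      then show ?case
        by (simp add: power_mult_distrib mult_right_mono)
    qed
  qed measurable
  then show ?thesis
    by (simp add: L2_def)
qed

lemma Linfty_subset:
  assumes "a \<in> Linfty D" "S \<subseteq> D" "S \<in> sets lebesgue" "D \<in> sets lebesgue"
  shows "a \<in> Linfty S"
proof -
  obtain M where M: "AE x in lebesgue_on D. \<bar>a x\<bar> \<le> M" and a: "a \<in> borel_measurable (lebesgue_on D)"
    using assms(1) by (auto simp: Linfty_def)
  have "AE x in lebesgue_on S. \<bar>a x\<bar> \<le> M"
    using M assms(2) by (auto simp: AE_restrict_space_iff assms(3,4) elim!: eventually_mono)
  then show ?thesis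
    using measurable_restrict_mono[OF a assms(2)] by (auto simp: Linfty_def)
qed

lemma test_functions_L2:
  assumes "\<phi> \<in> test_functions D" "S \<in> lmeasurable" shows "\<phi> \<in> L2 S"
proof -
  obtain B where "\<And>x. \<bar>\<phi> x\<bar> \<le> B" "0 \<le> B"
    using test_functions_bounded[OF assms(1)] by blast
  then show ?thesis
    using assms(2) smooth_measurable[OF test_functionsD(1)[OF assms(1)]]
    by (intro bounded_in_L2 borel_measurable_lebesgue_onI) auto
qed

section \<open>The fundamental lemma and weak derivatives\<close>

lemma tendsto_flat_step:
  assumes "t > 0" shows "(\<lambda>n. flat_step (real (Suc n) * t)) \<longlonglongrightarrow> 1"
proof -
  have "(\<lambda>n. exp (- (inverse (real (Suc n)) * inverse t))) \<longlonglongrightarrow> exp (- (0 * inverse t))"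
    by (intro tendsto_intros LIMSEQ_inverse_real_of_nat)
  moreover have "flat_step (real (Suc n) * t) = exp (- (inverse (real (Suc n)) * inverse t))" for n
  proof -
    have "\<not> real (Suc n) * t \<le> 0"
      using assms by (simp add: not_le zero_less_mult_iff)
    then show ?thesis
      by (simp add: flat_step_def divide_inverse del: of_nat_Suc)
  qed
  ultimately show ?thesis by simp
qed

text \<open>As \<open>n\<close> grows the flanks steepen while the support stays in the closed box,
  so the bumps converge pointwise to the indicator of the open box. \<open>Suc n\<close> keeps the
  slope positive from the start.\<close>

definition box_bump :: "real^'n::finite \<Rightarrow> real^'n \<Rightarrow> nat \<Rightarrow> real^'n \<Rightarrow> real" where
  "box_bump a b n x =
    (\<Prod>i\<in>UNIV. flat_step (real (Suc n) * (x $ i - a $ i)) * flat_step (real (Suc n) * (b $ i - x $ i)))"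

lemma box_bump_outside:
  assumes "x \<notin> box a b" shows "box_bump a b n x = 0"
proof -
  obtain i where "x $ i \<le> a $ i \<or> b $ i \<le> x $ i"
    using assms unfolding mem_box_cart by (meson not_le_imp_less)
  then have "flat_step (real (Suc n) * (x $ i - a $ i)) * flat_step (real (Suc n) * (b $ i - x $ i)) = 0"
    by (auto simp: flat_step_bounds(3) mult_nonneg_nonpos simp del: of_nat_Suc)
  then show ?thesis
    unfolding box_bump_def by (intro prod_zero) auto
qed

lemma box_bump_test_function:
  assumes "cbox a b \<subseteq> D" shows "box_bump a b n \<in> test_functions D"
proof (rule test_functionsI)
  show "smooth (box_bump a b n)"
    unfolding box_bump_def[abs_def]
    by (intro smooth_prod smooth_mult smooth_flat_step smooth_cmult smooth_diff smooth_coord smooth_const)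
  show "box_bump a b n x = 0" if "x \<notin> cbox a b" for x
    using that box_subset_cbox box_bump_outside by blast
qed (use assms compact_cbox in auto)

lemma box_bump_bound: "0 \<le> box_bump a b n x" "box_bump a b n x \<le> 1"
  unfolding box_bump_def
  by (auto intro!: prod_nonneg prod_le_1 mult_le_one simp: flat_step_bounds)

lemma box_bump_tendsto: "(\<lambda>n. box_bump a b n x) \<longlonglongrightarrow> indicator (box a b) x"
proof (cases "x \<in> box a b")
  case True
  then have "(\<lambda>n. box_bump a b n x) \<longlonglongrightarrow> (\<Prod>i::'a\<in>UNIV. 1 * 1)"
    unfolding box_bump_def by (intro tendsto_prod tendsto_mult tendsto_flat_step) (auto simp: mem_box_cart)
  with True show ?thesis by simp
qed (simp add: box_bump_outside)

lemma box_integral_zero: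
  assumes D: "D \<in> sets lebesgue" and w: "integrable (lebesgue_on D) w"
    and zero: "\<And>\<phi>. \<phi> \<in> test_functions D \<Longrightarrow> (\<integral>x. w x * \<phi> x \<partial>lebesgue_on D) = 0"
    and ab: "cbox a b \<subseteq> D"
  shows "(\<integral>x. w x * indicator (box a b) x \<partial>lebesgue_on D) = 0"
proof -
  have [measurable]: "w \<in> borel_measurable (lebesgue_on D)"
    using w by simp
  have [measurable]: "box_bump a b n \<in> borel_measurable (lebesgue_on D)" for n
    by (intro borel_measurable_lebesgue_onI smooth_measurable test_functionsD(1)[OF box_bump_test_function[OF ab]])
  have [measurable]: "indicator (box a b) \<in> borel_measurable (lebesgue_on D)"
    by (intro borel_measurable_lebesgue_onI) simp
  have "(\<lambda>n. \<integral>x. w x * box_bump a b n x \<partial>lebesgue_on D) \<longlonglongrightarrow> (\<integral>x. w x * indicator (box a b) x \<partial>lebesgue_on D)"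
  proof (rule integral_dominated_convergence[where w = "\<lambda>x. \<bar>w x\<bar>"])
    show "AE x in lebesgue_on D. (\<lambda>n. w x * box_bump a b n x) \<longlonglongrightarrow> w x * indicator (box a b) x"
      by (intro AE_I2 tendsto_mult tendsto_const box_bump_tendsto)
    show "AE x in lebesgue_on D. norm (w x * box_bump a b n x) \<le> \<bar>w x\<bar>" for n
      by (intro AE_I2) (simp add: abs_mult box_bump_bound mult_left_le)
  qed (use w in \<open>measurable, auto\<close>)
  then show ?thesis
    by (simp add: zero[OF box_bump_test_function[OF ab]] LIMSEQ_const_iff)
qed

text \<open>Dynkin's argument: open boxes form an intersection-stable generator of the Borel sets.
  The complement step uses \<open>supp\<close>, which makes the total integral an integral over a
  single box.\<close>

lemma AE_zero_if_box_integrals_zero: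
  fixes f :: "real^'n::finite \<Rightarrow> real"
  assumes f: "integrable lborel f"
    and supp: "\<And>x. x \<notin> box a b \<Longrightarrow> f x = 0"
    and zero: "\<And>c d. (\<integral>x. f x * indicator (box c d) x \<partial>lborel) = 0"
  shows "AE x in lborel. f x = 0"
proof -
  let ?G = "range (\<lambda>(a, b). box a b) :: (real^'n) set set"
  have int: "integrable lborel (\<lambda>x. indicator A x *\<^sub>R f x)" if "A \<in> sets borel" for A
    using integrable_mult_indicator[OF _ f] that by simp
  have stable: "Int_stable ?G"
    by (auto simp: Int_stable_def box_Int_box)
  have "?G \<subseteq> Pow UNIV" by simp
  with stable have "(\<integral>x\<in>A. f x \<partial>lborel) = 0" if "A \<in> sigma_sets UNIV ?G" for A
    using that
  proof (induction rule: sigma_sets_induct_disjoint)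
    case (basic A)
    then show ?case
      using zero by (auto simp: set_lebesgue_integral_def mult.commute)
  next
    case empty
    then show ?case by (simp add: set_lebesgue_integral_def)
  next
    case (compl A)
    have A: "A \<in> sets borel"
      using compl(1) by (simp add: borel_eq_box)
    have "(\<lambda>x. f x * indicator (box a b) x) = f"
      using supp by (force simp: indicator_def)
    then have "(\<integral>x. f x \<partial>lborel) = 0"
      using zero[of a b] by simp
    moreover have "(\<lambda>x. indicator (UNIV - A) x *\<^sub>R f x) = (\<lambda>x. f x - indicator A x *\<^sub>R f x)"
      by (auto simp: indicator_def)
    ultimately show ?case
      using compl(2) f int[OF A] by (simp add: set_lebesgue_integral_def)
  next
    case (union A)
    have A: "A i \<in> sets borel" for i
      using union(2) by (auto simp: borel_eq_box)
    have "(\<integral>x\<in>(\<Union>i. A i). f x \<partial>lborel) = (\<Sum>i. \<integral>x\<in>A i. f x \<partial>lborel)"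
      by (rule lebesgue_integral_countable_add)
        (use A union(1) int[of "\<Union>i. A i"] in \<open>auto simp: disjoint_family_on_def set_integrable_def\<close>)
    then show ?case
      by (simp add: union(3))
  qed
  then have "(\<integral>x\<in>A. f x \<partial>lborel) = (\<integral>x\<in>A. 0 \<partial>lborel)" if "A \<in> sets lborel" for A
    using that by (simp add: borel_eq_box set_lebesgue_integral_def)
  then show ?thesis
    by (intro density_unique_real f) auto
qed

lemma AE_zero_on_box:
  fixes w :: "real^'n::finite \<Rightarrow> real"
  assumes D: "D \<in> sets lebesgue" and w: "integrable (lebesgue_on D) w"
    and zero: "\<And>\<phi>. \<phi> \<in> test_functions D \<Longrightarrow> (\<integral>x. w x * \<phi> x \<partial>lebesgue_on D) = 0"
    and ab: "cbox a b \<subseteq> D"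
  shows "AE x in lebesgue. x \<in> cbox a b \<longrightarrow> w x = 0"
proof -
  define f where "f x = (if x \<in> box a b then w x else 0)" for x
  have sub: "box a b \<subseteq> D" using ab box_subset_cbox by blast
  have f: "integrable lebesgue f"
    unfolding f_def[abs_def]
    by (intro Lebesgue_Measure.integrable_restrict_UNIV[THEN iffD2] integrable_lebesgue_on_subset[OF w sub _ D]) auto
  obtain g where g: "g \<in> borel_measurable lborel" "AE x in lborel. f x = g x"
    using completion_ex_borel_measurable_real[OF borel_measurable_integrable[OF f]] by auto
  \<comment> \<open>The Borel version \<open>g\<close> agrees with \<open>f\<close> only almost
    everywhere. Cutting it off again makes \<open>h\<close> vanish at every point outside the box,
    as the Borel lemma asks.\<close>
  define h where "h x = (if x \<in> box a b then g x else 0)" for x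
  have h: "h \<in> borel_measurable lborel"
    unfolding h_def[abs_def] using g(1) by measurable
  have hf: "AE x in lborel. f x = h x"
    using g(2) by eventually_elim (auto simp: h_def f_def)
  have hfc: "AE x in lebesgue. f x = h x"
    by (rule AE_completion[OF hf])
  have "integrable lebesgue h"
    using f hfc h by (subst integrable_cong_AE[where g = f])
      (auto intro: measurable_completion borel_measurable_integrable elim!: eventually_mono)
  then have hint: "integrable lborel h"
    using h by (simp add: integrable_completion)
  have "(\<integral>x. h x * indicator (box c d) x \<partial>lborel) = 0" for c d
  proof -
    have ind: "indicator (box c d) \<in> borel_measurable lborel"
      by simp
    have "(\<integral>x. h x * indicator (box c d) x \<partial>lborel) = (\<integral>x. h x * indicator (box c d) x \<partial>lebesgue)"
      using h ind by (intro integral_completion[symmetric]) auto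
    also have "\<dots> = (\<integral>x. f x * indicator (box c d) x \<partial>lebesgue)"
    proof (intro integral_cong_AE borel_measurable_times)
      show "AE x in lebesgue. h x * indicator (box c d) x = f x * indicator (box c d) x"
        using hfc by eventually_elim simp
    qed (use h ind f in \<open>auto intro: measurable_completion borel_measurable_integrable\<close>)
    \<comment> \<open>The same corners describe the intersection of the closed boxes, so
      \<open>cbox e g\<close> still lies in \<open>D\<close> and the bump functions on it are
      admissible.\<close>
    also obtain e g where eg: "box a b \<inter> box c d = box e g" "cbox a b \<inter> cbox c d = cbox e g"
      using box_Int_box Int_interval by blast
    have "(\<integral>x. f x * indicator (box c d) x \<partial>lebesgue)
        = (\<integral>x. (if x \<in> D then w x * indicator (box e g) x else 0) \<partial>lebesgue)"
      using sub by (intro Bochner_Integration.integral_cong) (auto simp: f_def eg(1)[symmetric] indicator_def)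
    also have "\<dots> = (\<integral>x. w x * indicator (box e g) x \<partial>lebesgue_on D)"
      by (rule Lebesgue_Measure.integral_restrict_UNIV[OF D])
    also have "\<dots> = 0"
      using ab eg(2) by (intro box_integral_zero D w zero) auto
    finally show ?thesis .
  qed
  then have "AE x in lborel. h x = 0"
    by (intro AE_zero_if_box_integrals_zero[OF hint, of a b]) (auto simp: h_def)
  then have "AE x in lebesgue. h x = 0"
    by (rule AE_completion)
  with hfc have "AE x in lebesgue. f x = 0"
    by eventually_elim simp
  moreover have "AE x in lebesgue. x \<notin> cbox a b - box a b"
    using negligible_frontier_interval[of a b] by (intro AE_not_in) (simp add: negligible_iff_null_sets)
  ultimately show ?thesis
    by eventually_elim (auto simp: f_def split: if_splits)
qed

text \<open>An open set is a countable union of closed boxes, and on each of them \<open>w\<close>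
  vanishes almost everywhere.\<close>

lemma fundamental_lemma:
  fixes w :: "real^'n::finite \<Rightarrow> real"
  assumes D: "open D" and w: "integrable (lebesgue_on D) w"
    and zero: "\<And>\<phi>. \<phi> \<in> test_functions D \<Longrightarrow> (\<integral>x. w x * \<phi> x \<partial>lebesgue_on D) = 0"
  shows "AE x in lebesgue_on D. w x = 0"
proof -
  have D': "D \<in> sets lebesgue" using D by simp
  obtain \<D> where \<D>: "countable \<D>" "\<D> \<subseteq> Pow D" "\<And>X. X \<in> \<D> \<Longrightarrow> \<exists>a b. X = cbox a b" "\<Union>\<D> = D"
    using open_countable_Union_open_cbox[OF D] by blast
  have "AE x in lebesgue. x \<in> X \<longrightarrow> w x = 0" if "X \<in> \<D>" for X
    using \<D>(2,3) that AE_zero_on_box[OF D' w zero] by (metis PowD subsetD)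
  then have "AE x in lebesgue. \<forall>X\<in>\<D>. x \<in> X \<longrightarrow> w x = 0"
    by (intro AE_ball_countable[OF \<D>(1), THEN iffD2] ballI)
  then have "AE x in lebesgue. x \<in> D \<longrightarrow> w x = 0"
    by eventually_elim (use \<D>(4) in auto)
  then show ?thesis
    using D' by (simp add: AE_restrict_space_iff)
qed

lemma bounded_open_lmeasurable: "open D \<Longrightarrow> bounded D \<Longrightarrow> D \<in> lmeasurable"
  by (rule lmeasurable_open)

text \<open>Makes both choices by \<open>SOME\<close> harmless: the weak derivative in
  \<open>wderiv\<close> and the right-hand side in \<open>L_op\<close>.\<close>

lemma AE_eq_if_tested_equal:
  fixes w1 w2 :: "real^'n::finite \<Rightarrow> real"
  assumes D: "open D" "bounded D" and w: "w1 \<in> L2 D" "w2 \<in> L2 D"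
    and eq: "\<And>\<phi>. \<phi> \<in> test_functions D \<Longrightarrow>
      (\<integral>x. w1 x * \<phi> x \<partial>lebesgue_on D) = (\<integral>x. w2 x * \<phi> x \<partial>lebesgue_on D)"
  shows "AE x in lebesgue_on D. w1 x = w2 x"
proof -
  note D' = bounded_open_lmeasurable[OF D]
  have "AE x in lebesgue_on D. w1 x - w2 x = 0"
  proof (rule fundamental_lemma[OF D(1)])
    show "integrable (lebesgue_on D) (\<lambda>x. w1 x - w2 x)"
      by (intro L2_integrable D' L2_diff w)
    fix \<phi> assume \<phi>: "\<phi> \<in> test_functions D"
    note t = test_functions_L2[OF \<phi> D']
    show "(\<integral>x. (w1 x - w2 x) * \<phi> x \<partial>lebesgue_on D) = 0"
      using L2_mult_integrable[OF w(1) t] L2_mult_integrable[OF w(2) t] eq[OF \<phi>]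
      by (simp add: left_diff_distrib)
  qed
  then show ?thesis by eventually_elim simp
qed

lemma weak_deriv_unique:
  assumes "open D" "bounded D" "is_weak_deriv D \<sigma> u w1" "is_weak_deriv D \<sigma> u w2"
  shows "AE x in lebesgue_on D. w1 x = w2 x"
proof (rule AE_eq_if_tested_equal[OF assms(1,2)])
  note w = assms(3,4)[unfolded is_weak_deriv_def]
  show "w1 \<in> L2 D" "w2 \<in> L2 D"
    using w by blast+
  fix \<phi> assume \<phi>: "\<phi> \<in> test_functions D"
  have "(-1) ^ msize \<sigma> * (\<integral>x. w1 x * \<phi> x \<partial>lebesgue_on D) = (-1) ^ msize \<sigma> * (\<integral>x. w2 x * \<phi> x \<partial>lebesgue_on D)"
    using w(1)[THEN conjunct2, THEN conjunct2, THEN bspec, OF \<phi>]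
      w(2)[THEN conjunct2, THEN conjunct2, THEN bspec, OF \<phi>] by (rule trans[OF sym])
  then show "(\<integral>x. w1 x * \<phi> x \<partial>lebesgue_on D) = (\<integral>x. w2 x * \<phi> x \<partial>lebesgue_on D)"
    by simp
qed

section \<open>Weak derivatives and the space H_0^k\<close>

lemma is_weak_deriv_wderiv: "is_weak_deriv D \<sigma> u w \<Longrightarrow> is_weak_deriv D \<sigma> u (wderiv D \<sigma> u)"
  unfolding wderiv_def by (rule someI[of "is_weak_deriv D \<sigma> u"])

lemma wderiv_eq_AE:
  assumes "open D" "bounded D" "is_weak_deriv D \<sigma> u w"
  shows "AE x in lebesgue_on D. wderiv D \<sigma> u x = w x"
  using weak_deriv_unique[OF assms(1,2) is_weak_deriv_wderiv[OF assms(3)] assms(3)] .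

lemma wderiv_L2: "is_weak_deriv D \<sigma> u w \<Longrightarrow> wderiv D \<sigma> u \<in> L2 D"
  using is_weak_deriv_wderiv[of D \<sigma> u w] by (auto simp: is_weak_deriv_def)

lemma is_weak_deriv_lincomb:
  assumes D: "open D" "bounded D" and u: "is_weak_deriv D \<sigma> u w" and v: "is_weak_deriv D \<sigma> v z"
  shows "is_weak_deriv D \<sigma> (\<lambda>x. u x + c * v x) (\<lambda>x. w x + c * z x)"
  unfolding is_weak_deriv_def
proof (intro conjI ballI)
  fix \<phi> assume \<phi>: "\<phi> \<in> test_functions D"
  note L = bounded_open_lmeasurable[OF D]
  have int: "(\<integral>x. (f x + c * g x) * \<psi> x \<partial>lebesgue_on D)
      = (\<integral>x. f x * \<psi> x \<partial>lebesgue_on D) + c * (\<integral>x. g x * \<psi> x \<partial>lebesgue_on D)"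
    if "f \<in> L2 D" "g \<in> L2 D" "\<psi> \<in> test_functions D" for f g \<psi>
    using L2_mult_integrable[OF that(1) test_functions_L2[OF that(3) L]]
      L2_mult_integrable[OF that(2) test_functions_L2[OF that(3) L]]
    by (simp add: distrib_right mult.assoc)
  show "(\<integral>x. (u x + c * v x) * mderiv \<sigma> \<phi> x \<partial>lebesgue_on D) =
      (-1) ^ msize \<sigma> * (\<integral>x. (w x + c * z x) * \<phi> x \<partial>lebesgue_on D)"
  proof -
    have uv: "u \<in> L2 D" "w \<in> L2 D" "v \<in> L2 D" "z \<in> L2 D"
      using u v by (auto simp: is_weak_deriv_def)
    have "(\<integral>x. u x * mderiv \<sigma> \<phi> x \<partial>lebesgue_on D) = (-1) ^ msize \<sigma> * (\<integral>x. w x * \<phi> x \<partial>lebesgue_on D)"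
      "(\<integral>x. v x * mderiv \<sigma> \<phi> x \<partial>lebesgue_on D) = (-1) ^ msize \<sigma> * (\<integral>x. z x * \<phi> x \<partial>lebesgue_on D)"
      using u v \<phi> by (simp_all add: is_weak_deriv_def)
    then show ?thesis
      unfolding int[OF uv(1,3) test_functions_mderiv[OF \<phi>]] int[OF uv(2,4) \<phi>]
      by (simp add: distrib_left)
  qed
qed (use u v in \<open>auto simp: is_weak_deriv_def intro: L2_lincomb\<close>)

lemma integral_test_functions:
  assumes "\<phi> \<in> test_functions D" "\<psi> \<in> test_functions D" "open D"
  shows "(\<integral>x. \<phi> x * \<psi> x \<partial>lebesgue_on D) = (\<integral>x. \<phi> x * \<psi> x \<partial>lborel)"
proof -
  have "(\<integral>x. \<phi> x * \<psi> x \<partial>lebesgue_on D) = (\<integral>x. \<phi> x * \<psi> x \<partial>lebesgue)"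
    using assms(3) test_functionsD(4)[OF assms(1)] by (intro integral_lebesgue_on_vanishing) auto
  also have "\<dots> = (\<integral>x. \<phi> x * \<psi> x \<partial>lborel)"
    using smooth_measurable[OF test_functionsD(1)[OF assms(1)]] smooth_measurable[OF test_functionsD(1)[OF assms(2)]]
    by (intro integral_completion) auto
  finally show ?thesis .
qed

lemma is_weak_deriv_test_function:
  assumes D: "open D" "bounded D" and \<phi>: "\<phi> \<in> test_functions D"
  shows "is_weak_deriv D \<sigma> \<phi> (mderiv \<sigma> \<phi>)"
  unfolding is_weak_deriv_def
proof (intro conjI ballI)
  fix \<psi> assume \<psi>: "\<psi> \<in> test_functions D"
  show "(\<integral>x. \<phi> x * mderiv \<sigma> \<psi> x \<partial>lebesgue_on D) =
      (-1) ^ msize \<sigma> * (\<integral>x. mderiv \<sigma> \<phi> x * \<psi> x \<partial>lebesgue_on D)"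
    using integral_by_parts_mderiv[of \<phi> \<psi> \<sigma>] \<phi> \<psi> test_functions_mono[of D UNIV]
    by (auto simp: integral_test_functions D test_functions_mderiv)
qed (intro test_functions_L2[of _ D] bounded_open_lmeasurable D test_functions_mderiv \<phi>)+

lemma sobolev0D:
  assumes "u \<in> sobolev0 k D" "msize \<sigma> \<le> k"
  shows "is_weak_deriv D \<sigma> u (wderiv D \<sigma> u)"
proof -
  obtain w where "is_weak_deriv D \<sigma> u w"
    using assms unfolding sobolev0_def sobolev_def by blast
  then show ?thesis
    by (rule is_weak_deriv_wderiv)
qed

text \<open>\<open>wderiv\<close> returns some weak derivative, so even for the zero function its
  norm is known only through uniqueness almost everywhere.\<close>

lemma sobolev_norm_zero:
  assumes D: "open D" "bounded D" shows "sobolev_norm k D (\<lambda>x. 0) = 0"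
proof -
  have "is_weak_deriv D \<sigma> (\<lambda>x. 0) (\<lambda>x. 0)" for \<sigma>
    using bounded_in_L2[OF bounded_open_lmeasurable[OF D], of "\<lambda>x. 0" 0]
    by (simp add: is_weak_deriv_def)
  then have "(L2_norm D (wderiv D \<sigma> (\<lambda>x. 0)))\<^sup>2 = 0" for \<sigma>
    using L2_norm_cong_AE[OF wderiv_L2 _ wderiv_eq_AE[OF D], of \<sigma> "\<lambda>x. 0" "\<lambda>x. 0" "\<lambda>x. 0"]
    by (simp add: L2_norm_def is_weak_deriv_def)
  then show ?thesis
    by (simp add: sobolev_norm_def)
qed

lemma test_functions_sobolev0:
  assumes D: "open D" "bounded D" and \<phi>: "\<phi> \<in> test_functions D"
  shows "\<phi> \<in> sobolev0 k D"
proof -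
  have "sobolev_norm k D (\<lambda>x. \<phi> x - \<phi> x) = 0"
    using sobolev_norm_zero[OF D] by simp
  then have "\<exists>\<psi>\<in>test_functions D. sobolev_norm k D (\<lambda>x. \<phi> x - \<psi> x) < e" if "e > 0" for e
    using that \<phi> by (intro bexI[of _ \<phi>]) simp_all
  then show ?thesis
    using is_weak_deriv_test_function[OF D \<phi>] unfolding sobolev0_def sobolev_def by blast
qed

text \<open>Adding the same multiple of \<open>\<phi>\<close> to the approximant leaves the
  difference unchanged. The energy estimate perturbs \<open>v\<close> by test functions
  only.\<close>

lemma sobolev0_add_test_function:
  assumes D: "open D" "bounded D" and u: "u \<in> sobolev0 k D" and \<phi>: "\<phi> \<in> test_functions D"
  shows "(\<lambda>x. u x + c * \<phi> x) \<in> sobolev0 k D"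
  unfolding sobolev0_def sobolev_def
proof (intro CollectI conjI allI impI)
  fix \<sigma> :: "'a mindex" assume "msize \<sigma> \<le> k"
  then show "\<exists>w. is_weak_deriv D \<sigma> (\<lambda>x. u x + c * \<phi> x) w"
    using is_weak_deriv_lincomb[OF D sobolev0D[OF u] is_weak_deriv_test_function[OF D \<phi>]] by blast
next
  fix e :: real assume "e > 0"
  then obtain \<psi> where \<psi>: "\<psi> \<in> test_functions D" "sobolev_norm k D (\<lambda>x. u x - \<psi> x) < e"
    using u by (auto simp: sobolev0_def)
  then show "\<exists>\<psi>\<in>test_functions D. sobolev_norm k D (\<lambda>x. u x + c * \<phi> x - \<psi> x) < e"
    by (intro bexI[of _ "\<lambda>x. \<psi> x + c * \<phi> x"] test_functions_lincomb \<phi>) simp_all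
qed

lemma finite_msize_eq: "finite {\<sigma> :: 'n::finite mindex. msize \<sigma> = k}"
  by (rule finite_subset[OF _ finite_msize_le[of k]]) auto

lemma sobolev_seminorm_nonneg: "0 \<le> sobolev_seminorm k D u"
  by (simp add: sobolev_seminorm_def sum_nonneg)

lemma sobolev_seminorm_sq:
  "(sobolev_seminorm k D u)\<^sup>2 = (\<Sum>\<sigma>\<in>{\<sigma>. msize \<sigma> = k}. \<integral>x. (wderiv D \<sigma> u x)\<^sup>2 \<partial>lebesgue_on D)"
  by (simp add: sobolev_seminorm_def sum_nonneg)

lemma sobolev_seminorm_sq_weak:
  assumes D: "open D" "bounded D" and w: "\<And>\<sigma>. msize \<sigma> = k \<Longrightarrow> is_weak_deriv D \<sigma> u (w \<sigma>)"
  shows "(sobolev_seminorm k D u)\<^sup>2 = (\<Sum>\<sigma>\<in>{\<sigma>. msize \<sigma> = k}. (L2_norm D (w \<sigma>))\<^sup>2)"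
  unfolding sobolev_seminorm_sq L2_norm_sq[symmetric]
proof (intro sum.cong refl)
  fix \<sigma> :: "'a mindex" assume "\<sigma> \<in> {\<sigma>. msize \<sigma> = k}"
  then have w: "is_weak_deriv D \<sigma> u (w \<sigma>)" using w by simp
  show "(L2_norm D (wderiv D \<sigma> u))\<^sup>2 = (L2_norm D (w \<sigma>))\<^sup>2"
    using L2_norm_cong_AE[OF wderiv_L2[OF w] _ wderiv_eq_AE[OF D w]] w
    by (simp add: is_weak_deriv_def)
qed

section \<open>The polyharmonic Dirichlet problem\<close>

text \<open>
  A minimising sequence of \<open>ip f f - 2 * l f\<close>. The space \<open>V\<close> need not be complete, so the sequence
  stands in for the Riesz representative of \<open>l\<close>.
\<close>
lemma Riesz_sequence:
  fixes V :: "('x \<Rightarrow> real) set" and ip :: "('x \<Rightarrow> real) \<Rightarrow> ('x \<Rightarrow> real) \<Rightarrow> real"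
  assumes zero: "(\<lambda>x. 0) \<in> V"
    and closed: "\<And>f g c. f \<in> V \<Longrightarrow> g \<in> V \<Longrightarrow> (\<lambda>x. f x + c * g x) \<in> V"
    and ip_lin: "\<And>f g h c. f \<in> V \<Longrightarrow> g \<in> V \<Longrightarrow> h \<in> V \<Longrightarrow> ip (\<lambda>x. f x + c * g x) h = ip f h + c * ip g h"
    and ip_sym: "\<And>f g. ip f g = ip g f"
    and ip_pos: "\<And>f. 0 \<le> ip f f"
    and l_lin: "\<And>f g c. f \<in> V \<Longrightarrow> g \<in> V \<Longrightarrow> l (\<lambda>x. f x + c * g x) = l f + c * l g"
    and l_bound: "\<And>f. f \<in> V \<Longrightarrow> \<bar>l f\<bar> \<le> M * sqrt (ip f f)"
    and M: "0 \<le> M"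
  obtains \<phi> where "\<And>n. \<phi> n \<in> V"
    "\<And>n. sqrt (ip (\<phi> n) (\<phi> n)) \<le> M + inverse (real (Suc n))"
    "\<And>m n. sqrt (ip (\<lambda>x. \<phi> m x - \<phi> n x) (\<lambda>x. \<phi> m x - \<phi> n x)) \<le> inverse (real (Suc m)) + inverse (real (Suc n))"
    "\<And>\<psi>. \<psi> \<in> V \<Longrightarrow> (\<lambda>n. ip (\<phi> n) \<psi>) \<longlonglongrightarrow> l \<psi>"
proof -
  define N where "N f = sqrt (ip f f)" for f
  have N: "0 \<le> N f" "(N f)\<^sup>2 = ip f f" for f
    using ip_pos[of f] by (simp_all add: N_def)
  define J where "J f = ip f f - 2 * l f" for f
  define e where "e n = inverse (real (Suc n))" for n
  have e: "e n > 0" for n by (simp add: e_def)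
  \<comment> \<open>Completing the square: \<open>J f\<close> is at least N^2 - 2 M N = (N - M)^2 -
    M^2 with N = \<open>N f\<close>.\<close>
  have J_below: "- (M\<^sup>2) \<le> J f" if "f \<in> V" for f
  proof -
    have "0 \<le> (N f - M)\<^sup>2" by simp
    then show ?thesis
      using l_bound[OF that] N(2)[of f] by (simp add: J_def N_def[symmetric] power2_diff mult.commute[of M])
  qed
  have ip_lin2: "ip h (\<lambda>x. f x + c * g x) = ip h f + c * ip h g" if "f \<in> V" "g \<in> V" "h \<in> V" for f g h c
    using ip_lin[OF that] by (simp add: ip_sym)
  have J_exp: "J (\<lambda>x. f x + s * g x) = J f + 2 * s * (ip f g - l g) + s\<^sup>2 * ip g g"
    if "f \<in> V" "g \<in> V" for f g s
    using that by (simp add: J_def ip_lin ip_lin2 closed l_lin ip_sym[of g f] algebra_simps power2_eq_square)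
  define I where "I = Inf (J ` V)"
  have bdd: "bdd_below (J ` V)"
    using J_below by (auto intro!: bdd_belowI2[of _ "- (M\<^sup>2)"])
  have I: "I \<le> J f" if "f \<in> V" for f
    unfolding I_def using that bdd by (auto intro: cInf_lower)
  \<comment> \<open>The tolerance is squared because the discriminant inequality returns its square
    root, which then acts as the error \<open>e n\<close> against \<open>N \<psi>\<close>.\<close>
  have "\<exists>f\<in>V. J f < I + (e n)\<^sup>2" for n
    using cInf_lessD[of "J ` V" "I + (e n)\<^sup>2"] zero e[of n] by (auto simp: I_def)
  then obtain \<phi> where \<phi>: "\<And>n. \<phi> n \<in> V" "\<And>n. J (\<phi> n) < I + (e n)\<^sup>2"
    by metis
  \<comment> \<open>Near-minimality along the line through \<open>\<phi> n\<close> in direction \<open>\<psi>\<close>; all four claims follow from this.\<close>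
  have key: "\<bar>ip (\<phi> n) \<psi> - l \<psi>\<bar> \<le> e n * N \<psi>" if \<psi>: "\<psi> \<in> V" for n \<psi>
  proof -
    have "0 \<le> (e n)\<^sup>2 + 2 * s * (ip (\<phi> n) \<psi> - l \<psi>) + s\<^sup>2 * ip \<psi> \<psi>" for s
      using I[OF closed[OF \<phi>(1)[of n] \<psi>, of s]] \<phi>(2)[of n] J_exp[OF \<phi>(1)[of n] \<psi>, of s] by simp
    from nonneg_quadratic_discriminant[OF this]
    have "(ip (\<phi> n) \<psi> - l \<psi>)\<^sup>2 \<le> (e n * N \<psi>)\<^sup>2"
      by (simp add: power_mult_distrib N)
    then show ?thesis
      using abs_le_square_iff[of "ip (\<phi> n) \<psi> - l \<psi>" "e n * N \<psi>"] e[of n] N(1)[of \<psi>] by simp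
  qed
  have cancel: "N f \<le> b" if "(N f)\<^sup>2 \<le> b * N f" "0 \<le> b" for f b
    using that N(1)[of f] by (cases "N f = 0") (auto simp: power2_eq_square)
  show ?thesis
  proof (rule that[of \<phi>])
    show "\<phi> n \<in> V" for n by (rule \<phi>)
    show "sqrt (ip (\<phi> n) (\<phi> n)) \<le> M + inverse (real (Suc n))" for n
    proof -
      have "(N (\<phi> n))\<^sup>2 \<le> (M + e n) * N (\<phi> n)"
        using key[OF \<phi>(1)[of n], of n] l_bound[OF \<phi>(1)[of n]]
        unfolding N(2) by (simp add: N_def[symmetric] distrib_right)
      then show ?thesis
        using cancel[of "\<phi> n" "M + e n"] M e[of n] by (simp add: N_def e_def)
    qed
    show "sqrt (ip (\<lambda>x. \<phi> m x - \<phi> n x) (\<lambda>x. \<phi> m x - \<phi> n x)) \<le> inverse (real (Suc m)) + inverse (real (Suc n))" for m n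
    proof -
      define d where "d = (\<lambda>x. \<phi> m x + (-1) * \<phi> n x)"
      have d: "d \<in> V" unfolding d_def by (intro closed \<phi>)
      have "ip d d = ip (\<phi> m) d + (-1) * ip (\<phi> n) d"
        by (subst (1) d_def) (rule ip_lin[OF \<phi>(1) \<phi>(1) d])
      then have "(N d)\<^sup>2 \<le> (e m + e n) * N d"
        using key[OF d, of m] key[OF d, of n] unfolding N(2) by (simp add: distrib_right)
      then have "N d \<le> e m + e n"
        using e[of m] e[of n] by (intro cancel) auto
      then show ?thesis
        by (simp add: N_def e_def d_def)
    qed
    show "(\<lambda>n. ip (\<phi> n) \<psi>) \<longlonglongrightarrow> l \<psi>" if "\<psi> \<in> V" for \<psi>
    proof -
      have "(\<lambda>n. ip (\<phi> n) \<psi> - l \<psi>) \<longlonglongrightarrow> 0"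
      proof (rule Lim_null_comparison)
        show "\<forall>\<^sub>F n in sequentially. norm (ip (\<phi> n) \<psi> - l \<psi>) \<le> e n * N \<psi>"
          using key[OF that] by simp
        show "(\<lambda>n. e n * N \<psi>) \<longlonglongrightarrow> 0"
          unfolding e_def by (intro tendsto_mult_left_zero LIMSEQ_inverse_real_of_nat)
      qed
      then show ?thesis by (simp add: LIM_zero_iff)
    qed
  qed
qed

lemma sobolev_norm_sq_weak:
  assumes D: "open D" "bounded D" and w: "\<And>\<sigma>. msize \<sigma> \<le> k \<Longrightarrow> is_weak_deriv D \<sigma> u (w \<sigma>)"
  shows "(sobolev_norm k D u)\<^sup>2 = (\<Sum>\<sigma>\<in>{\<sigma>. msize \<sigma> \<le> k}. (L2_norm D (w \<sigma>))\<^sup>2)"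
proof -
  have "L2_norm D (wderiv D \<sigma> u) = L2_norm D (w \<sigma>)" if "msize \<sigma> \<le> k" for \<sigma>
    using L2_norm_cong_AE[OF wderiv_L2[OF w[OF that]] _ wderiv_eq_AE[OF D w[OF that]]] w[OF that]
    by (simp add: is_weak_deriv_def)
  then show ?thesis
    by (simp add: sobolev_norm_def sum_nonneg)
qed

text \<open>The Riesz sequence for the functional is Cauchy in the \<open>k\<close>-th seminorm
  only; the Friedrichs hypothesis passes this on to all lower derivatives. Completeness of L2 gives
  limits \<open>w \<sigma>\<close>, which are the weak derivatives of the limit \<open>u\<close> of
  the sequence itself, and norm bound and equation survive the limit.\<close>

lemma polyharmonic_solution:
  fixes \<Omega> :: "(real^'n::finite) set"
  assumes D: "open \<Omega>" "bounded \<Omega>" and f: "f \<in> L2 \<Omega>" and M: "0 \<le> M"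
    and bound: "\<And>\<phi>. \<phi> \<in> test_functions \<Omega> \<Longrightarrow>
      \<bar>\<integral>x. f x * \<phi> x \<partial>lebesgue_on \<Omega>\<bar> \<le> M * sobolev_seminorm k \<Omega> \<phi>"
    and friedrichs: "\<And>p \<phi>. \<phi> \<in> test_functions \<Omega> \<Longrightarrow> p \<le> k \<Longrightarrow>
      sobolev_seminorm p \<Omega> \<phi> \<le> K p * sobolev_seminorm k \<Omega> \<phi>"
  shows "\<exists>u\<in>sobolev0 k \<Omega>. polyharmonic_eq k \<Omega> u f \<and> sobolev_seminorm k \<Omega> u \<le> M"
proof -
  note L = bounded_open_lmeasurable[OF D]
  define ip where "ip \<phi> \<psi> = (\<Sum>\<sigma>\<in>{\<sigma>. msize \<sigma> = k}. \<integral>x. mderiv \<sigma> \<phi> x * mderiv \<sigma> \<psi> x \<partial>lebesgue_on \<Omega>)"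
    for \<phi> \<psi> :: "real^'n \<Rightarrow> real"
  define l where "l \<phi> = (\<integral>x. f x * \<phi> x \<partial>lebesgue_on \<Omega>)" for \<phi>
  have tL2: "mderiv \<sigma> \<phi> \<in> L2 \<Omega>" if "\<phi> \<in> test_functions \<Omega>" for \<phi> \<sigma>
    by (rule test_functions_L2[OF test_functions_mderiv[OF that] L])
  have semi: "(sobolev_seminorm p \<Omega> \<phi>)\<^sup>2 = (\<Sum>\<sigma>\<in>{\<sigma>. msize \<sigma> = p}. (L2_norm \<Omega> (mderiv \<sigma> \<phi>))\<^sup>2)"
    if "\<phi> \<in> test_functions \<Omega>" for \<phi> p
    by (rule sobolev_seminorm_sq_weak[OF D is_weak_deriv_test_function[OF D that]])
  have ip_eq: "ip \<phi> \<phi> = (\<Sum>\<sigma>\<in>{\<sigma>. msize \<sigma> = k}. (L2_norm \<Omega> (mderiv \<sigma> \<phi>))\<^sup>2)" for \<phi>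
    by (simp add: ip_def L2_norm_sq power2_eq_square[symmetric])
  have ip_semi: "sqrt (ip \<phi> \<phi>) = sobolev_seminorm k \<Omega> \<phi>" if "\<phi> \<in> test_functions \<Omega>" for \<phi>
    using semi[OF that, of k] by (simp add: ip_eq[symmetric] sobolev_seminorm_nonneg real_sqrt_unique)
  have ip_lin: "ip (\<lambda>x. \<phi> x + c * \<psi> x) \<eta> = ip \<phi> \<eta> + c * ip \<psi> \<eta>"
    if "\<phi> \<in> test_functions \<Omega>" "\<psi> \<in> test_functions \<Omega>" "\<eta> \<in> test_functions \<Omega>" for \<phi> \<psi> \<eta> c
  proof -
    have "(\<integral>x. mderiv \<sigma> (\<lambda>x. \<phi> x + c * \<psi> x) x * mderiv \<sigma> \<eta> x \<partial>lebesgue_on \<Omega>)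
        = (\<integral>x. mderiv \<sigma> \<phi> x * mderiv \<sigma> \<eta> x \<partial>lebesgue_on \<Omega>) + c * (\<integral>x. mderiv \<sigma> \<psi> x * mderiv \<sigma> \<eta> x \<partial>lebesgue_on \<Omega>)"
      for \<sigma>
      using L2_mult_integrable[OF tL2[OF that(1)] tL2[OF that(3)], of \<sigma> \<sigma>]
        L2_mult_integrable[OF tL2[OF that(2)] tL2[OF that(3)], of \<sigma> \<sigma>]
      by (simp add: mderiv_add mderiv_cmult smooth_cmult test_functionsD(1)[OF that(1)]
          test_functionsD(1)[OF that(2)] distrib_right mult.assoc)
    then show ?thesis
      by (simp add: ip_def sum.distrib sum_distrib_left)
  qed
  have l_lin: "l (\<lambda>x. \<phi> x + c * \<psi> x) = l \<phi> + c * l \<psi>"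
    if "\<phi> \<in> test_functions \<Omega>" "\<psi> \<in> test_functions \<Omega>" for \<phi> \<psi> c
    using L2_mult_integrable[OF f test_functions_L2[OF that(1) L]]
      L2_mult_integrable[OF f test_functions_L2[OF that(2) L]]
    by (simp add: l_def distrib_left mult.left_commute)
  obtain \<phi> where \<phi>: "\<And>n. \<phi> n \<in> test_functions \<Omega>"
    and norm: "\<And>n. sqrt (ip (\<phi> n) (\<phi> n)) \<le> M + inverse (real (Suc n))"
    and Cauchy: "\<And>m n. sqrt (ip (\<lambda>x. \<phi> m x - \<phi> n x) (\<lambda>x. \<phi> m x - \<phi> n x))
      \<le> inverse (real (Suc m)) + inverse (real (Suc n))"
    and lim: "\<And>\<psi>. \<psi> \<in> test_functions \<Omega> \<Longrightarrow> (\<lambda>n. ip (\<phi> n) \<psi>) \<longlonglongrightarrow> l \<psi>"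
  proof (rule Riesz_sequence[of "test_functions \<Omega>" ip l M])
    show "ip \<phi> \<psi> = ip \<psi> \<phi>" for \<phi> \<psi>
      by (simp add: ip_def mult.commute)
    show "0 \<le> ip \<phi> \<phi>" for \<phi>
      by (simp add: ip_eq sum_nonneg)
    show "\<bar>l \<phi>\<bar> \<le> M * sqrt (ip \<phi> \<phi>)" if "\<phi> \<in> test_functions \<Omega>" for \<phi>
      using bound[OF that] by (simp add: ip_semi that l_def)
  qed (auto intro: test_functions_zero test_functions_lincomb ip_lin l_lin M)
  have ex: "\<exists>w\<in>L2 \<Omega>. (\<lambda>n. L2_norm \<Omega> (\<lambda>x. w x - mderiv \<sigma> (\<phi> n) x)) \<longlonglongrightarrow> 0" if \<sigma>: "msize \<sigma> \<le> k" for \<sigma>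
  proof (rule L2_complete[OF L tL2[OF \<phi>]])
    fix e :: real assume "e > 0"
    \<comment> \<open>\<open>K\<close> carries no sign information; absolute value plus one gives a
      positive factor by which to divide.\<close>
    define K' where "K' = \<bar>K (msize \<sigma>)\<bar> + 1"
    have K': "K' > 0" by (simp add: K'_def add_nonneg_pos)
    obtain n0 where n0: "inverse (real (Suc n0)) < e / (2 * K')"
      using reals_Archimedean[of "e / (2 * K')"] \<open>e > 0\<close> K' by auto
    show "\<exists>N. \<forall>m\<ge>N. \<forall>n\<ge>N. L2_norm \<Omega> (\<lambda>x. mderiv \<sigma> (\<phi> m) x - mderiv \<sigma> (\<phi> n) x) < e"
    proof (intro exI allI impI)
      fix m n assume mn: "n0 \<le> m" "n0 \<le> n"
      let ?d = "\<lambda>x. \<phi> m x - \<phi> n x"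
      have d: "?d \<in> test_functions \<Omega>"
        using test_functions_lincomb[OF \<phi>[of m] \<phi>[of n], of "-1"] by simp
      have "mderiv \<sigma> (\<lambda>x. \<phi> m x + (-1) * \<phi> n x) = (\<lambda>x. mderiv \<sigma> (\<phi> m) x + (-1) * mderiv \<sigma> (\<phi> n) x)"
        by (simp only: mderiv_add[OF test_functionsD(1)[OF \<phi>] smooth_cmult[OF test_functionsD(1)[OF \<phi>]]]
            mderiv_cmult[OF test_functionsD(1)[OF \<phi>]])
      then have md: "mderiv \<sigma> ?d = (\<lambda>x. mderiv \<sigma> (\<phi> m) x - mderiv \<sigma> (\<phi> n) x)" by simp
      have "(L2_norm \<Omega> (mderiv \<sigma> ?d))\<^sup>2 \<le> (sobolev_seminorm (msize \<sigma>) \<Omega> ?d)\<^sup>2"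
        unfolding semi[OF d] by (rule member_le_sum) (auto simp: finite_msize_eq)
      then have "L2_norm \<Omega> (mderiv \<sigma> ?d) \<le> sobolev_seminorm (msize \<sigma>) \<Omega> ?d"
        by (rule power2_le_imp_le) (rule sobolev_seminorm_nonneg)
      also have "\<dots> \<le> K (msize \<sigma>) * sobolev_seminorm k \<Omega> ?d"
        by (rule friedrichs[OF d \<sigma>])
      also have "\<dots> \<le> K' * sobolev_seminorm k \<Omega> ?d"
        by (intro mult_right_mono sobolev_seminorm_nonneg) (simp add: K'_def)
      also have "\<dots> \<le> K' * (inverse (real (Suc m)) + inverse (real (Suc n)))"
        using Cauchy[of m n] K' by (intro mult_left_mono) (simp_all add: ip_semi[OF d])
      also have "\<dots> \<le> K' * (2 * inverse (real (Suc n0)))"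
      proof -
        have "inverse (real (Suc i)) \<le> inverse (real (Suc n0))" if "n0 \<le> i" for i
          using that by (intro le_imp_inverse_le) auto
        from this[OF mn(1)] this[OF mn(2)]
        have "inverse (real (Suc m)) + inverse (real (Suc n)) \<le> 2 * inverse (real (Suc n0))"
          by linarith
        then show ?thesis
          by (rule mult_left_mono) (rule less_imp_le[OF K'])
      qed
      also have "\<dots> < e"
        using n0 K' by (simp add: field_simps)
      finally show "L2_norm \<Omega> (\<lambda>x. mderiv \<sigma> (\<phi> m) x - mderiv \<sigma> (\<phi> n) x) < e"
        by (simp add: md)
    qed
  qed
  then have "\<forall>\<sigma>. \<exists>w. msize \<sigma> \<le> k \<longrightarrow> w \<in> L2 \<Omega> \<and> (\<lambda>n. L2_norm \<Omega> (\<lambda>x. w x - mderiv \<sigma> (\<phi> n) x)) \<longlonglongrightarrow> 0"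
    by blast
  then obtain w where w: "\<And>\<sigma>. msize \<sigma> \<le> k \<Longrightarrow> w \<sigma> \<in> L2 \<Omega>"
    "\<And>\<sigma>. msize \<sigma> \<le> k \<Longrightarrow> (\<lambda>n. L2_norm \<Omega> (\<lambda>x. w \<sigma> x - mderiv \<sigma> (\<phi> n) x)) \<longlonglongrightarrow> 0"
    using choice[of "\<lambda>\<sigma> w. msize \<sigma> \<le> k \<longrightarrow> w \<in> L2 \<Omega> \<and> (\<lambda>n. L2_norm \<Omega> (\<lambda>x. w x - mderiv \<sigma> (\<phi> n) x)) \<longlonglongrightarrow> 0"]
    by blast
  \<comment> \<open>The multi-index zero: \<open>w z\<close> is the L2 limit of the functions
    \<open>\<phi> n\<close> themselves and hence the solution.\<close>
  define z :: "'n mindex" where "z = (\<lambda>_. 0)"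
  have z: "msize z = 0" by (simp add: z_def msize_def)
  define u where "u = w z"
  have u: "u \<in> L2 \<Omega>" "(\<lambda>n. L2_norm \<Omega> (\<lambda>x. u x - \<phi> n x)) \<longlonglongrightarrow> 0"
    using w[of z] by (simp_all add: u_def z mderiv_zero[OF test_functionsD(1)[OF \<phi>] z])
  have wlim: "(\<lambda>n. \<integral>x. mderiv \<sigma> (\<phi> n) x * g x \<partial>lebesgue_on \<Omega>) \<longlonglongrightarrow> (\<integral>x. w \<sigma> x * g x \<partial>lebesgue_on \<Omega>)"
    if "msize \<sigma> \<le> k" "g \<in> L2 \<Omega>" for \<sigma> g
    by (rule L2_inner_limit[OF tL2[OF \<phi>] w(1)[OF that(1)] w(2)[OF that(1)] that(2)])
  have weak: "is_weak_deriv \<Omega> \<sigma> u (w \<sigma>)" if \<sigma>: "msize \<sigma> \<le> k" for \<sigma>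
    unfolding is_weak_deriv_def
  proof (intro conjI ballI)
    fix \<psi> assume \<psi>: "\<psi> \<in> test_functions \<Omega>"
    have "(\<lambda>n. \<integral>x. \<phi> n x * mderiv \<sigma> \<psi> x \<partial>lebesgue_on \<Omega>) \<longlonglongrightarrow> (\<integral>x. u x * mderiv \<sigma> \<psi> x \<partial>lebesgue_on \<Omega>)"
      by (rule L2_inner_limit[OF test_functions_L2[OF \<phi> L] u tL2[OF \<psi>]])
    moreover have "(\<integral>x. \<phi> n x * mderiv \<sigma> \<psi> x \<partial>lebesgue_on \<Omega>)
        = (-1) ^ msize \<sigma> * (\<integral>x. mderiv \<sigma> (\<phi> n) x * \<psi> x \<partial>lebesgue_on \<Omega>)" for n
      using is_weak_deriv_test_function[OF D \<phi>[of n], of \<sigma>] \<psi> by (simp add: is_weak_deriv_def)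
    ultimately have "(\<lambda>n. (-1) ^ msize \<sigma> * (\<integral>x. mderiv \<sigma> (\<phi> n) x * \<psi> x \<partial>lebesgue_on \<Omega>))
        \<longlonglongrightarrow> (\<integral>x. u x * mderiv \<sigma> \<psi> x \<partial>lebesgue_on \<Omega>)"
      by simp
    moreover have "(\<lambda>n. (-1) ^ msize \<sigma> * (\<integral>x. mderiv \<sigma> (\<phi> n) x * \<psi> x \<partial>lebesgue_on \<Omega>))
        \<longlonglongrightarrow> (-1) ^ msize \<sigma> * (\<integral>x. w \<sigma> x * \<psi> x \<partial>lebesgue_on \<Omega>)"
      by (intro tendsto_mult tendsto_const wlim \<sigma> test_functions_L2[OF \<psi> L])
    ultimately show "(\<integral>x. u x * mderiv \<sigma> \<psi> x \<partial>lebesgue_on \<Omega>) =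
        (-1) ^ msize \<sigma> * (\<integral>x. w \<sigma> x * \<psi> x \<partial>lebesgue_on \<Omega>)"
      by (rule LIMSEQ_unique)
  qed (use u w(1)[OF \<sigma>] in auto)
  have "u \<in> sobolev0 k \<Omega>"
    unfolding sobolev0_def
  proof (intro CollectI conjI allI impI)
    show "u \<in> sobolev k \<Omega>"
      using weak unfolding sobolev_def by blast
    fix e :: real assume "e > 0"
    have eq: "(sobolev_norm k \<Omega> (\<lambda>x. u x - \<phi> n x))\<^sup>2
        = (\<Sum>\<sigma>\<in>{\<sigma>. msize \<sigma> \<le> k}. (L2_norm \<Omega> (\<lambda>x. w \<sigma> x - mderiv \<sigma> (\<phi> n) x))\<^sup>2)" for n
    proof (rule sobolev_norm_sq_weak[OF D])
      fix \<sigma> :: "'n mindex" assume "msize \<sigma> \<le> k"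
      from is_weak_deriv_lincomb[OF D weak[OF this] is_weak_deriv_test_function[OF D \<phi>[of n]], of "-1"]
      show "is_weak_deriv \<Omega> \<sigma> (\<lambda>x. u x - \<phi> n x) (\<lambda>x. w \<sigma> x - mderiv \<sigma> (\<phi> n) x)"
        by simp
    qed
    have "(\<lambda>n. (\<Sum>\<sigma>\<in>{\<sigma>. msize \<sigma> \<le> k}. (L2_norm \<Omega> (\<lambda>x. w \<sigma> x - mderiv \<sigma> (\<phi> n) x))\<^sup>2)) \<longlonglongrightarrow>
        (\<Sum>\<sigma>\<in>{\<sigma> :: 'n mindex. msize \<sigma> \<le> k}. 0\<^sup>2)"
      by (intro tendsto_sum tendsto_power w) auto
    then have "(\<lambda>n. (sobolev_norm k \<Omega> (\<lambda>x. u x - \<phi> n x))\<^sup>2) \<longlonglongrightarrow> 0"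
      by (simp add: eq)
    then have "\<forall>\<^sub>F n in sequentially. (sobolev_norm k \<Omega> (\<lambda>x. u x - \<phi> n x))\<^sup>2 < e\<^sup>2"
      by (rule order_tendstoD) (use \<open>e > 0\<close> in simp)
    then obtain n where "(sobolev_norm k \<Omega> (\<lambda>x. u x - \<phi> n x))\<^sup>2 < e\<^sup>2"
      by (meson eventually_happens sequentially_bot)
    then have "sobolev_norm k \<Omega> (\<lambda>x. u x - \<phi> n x) < e"
      by (rule power_less_imp_less_base) (use \<open>e > 0\<close> in simp)
    then show "\<exists>\<psi>\<in>test_functions \<Omega>. sobolev_norm k \<Omega> (\<lambda>x. u x - \<psi> x) < e"
      using \<phi> by blast
  qed
  moreover have "polyharmonic_eq k \<Omega> u f"
    unfolding polyharmonic_eq_def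
  proof
    fix \<psi> assume \<psi>: "\<psi> \<in> test_functions \<Omega>"
    have ip_lim: "(\<lambda>n. ip (\<phi> n) \<psi>) \<longlonglongrightarrow> (\<Sum>\<sigma>\<in>{\<sigma>. msize \<sigma> = k}. \<integral>x. w \<sigma> x * mderiv \<sigma> \<psi> x \<partial>lebesgue_on \<Omega>)"
      unfolding ip_def by (intro tendsto_sum wlim tL2 \<psi>) auto
    have lw: "l \<psi> = (\<Sum>\<sigma>\<in>{\<sigma>. msize \<sigma> = k}. \<integral>x. w \<sigma> x * mderiv \<sigma> \<psi> x \<partial>lebesgue_on \<Omega>)"
      by (rule LIMSEQ_unique[OF lim[OF \<psi>] ip_lim])
    \<comment> \<open>Half of the 2k derivatives return to \<open>u\<close>, with
      \<open>mderiv \<sigma> \<psi>\<close> as the test function. The resulting sign (-1)^k cancels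
      the one in the equation.\<close>
    have "(\<integral>x. u x * mderiv (\<lambda>i. 2 * \<sigma> i) \<psi> x \<partial>lebesgue_on \<Omega>)
        = (-1) ^ k * (\<integral>x. w \<sigma> x * mderiv \<sigma> \<psi> x \<partial>lebesgue_on \<Omega>)" if "msize \<sigma> = k" for \<sigma>
    proof -
      have "mderiv (\<lambda>i. 2 * \<sigma> i) \<psi> = mderiv \<sigma> (mderiv \<sigma> \<psi>)"
        by (simp add: mderiv_mderiv[OF test_functionsD(1)[OF \<psi>]] mult_2)
      then show ?thesis
        using weak[of \<sigma>] that test_functions_mderiv[OF \<psi>, of \<sigma>] by (simp add: is_weak_deriv_def)
    qed
    then have "(-1) ^ k * (\<Sum>\<sigma>\<in>{\<sigma>. msize \<sigma> = k}. \<integral>x. u x * mderiv (\<lambda>i. 2 * \<sigma> i) \<psi> x \<partial>lebesgue_on \<Omega>)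
        = (-1) ^ k * ((-1) ^ k * l \<psi>)"
      unfolding lw by (simp add: sum_distrib_left)
    also have "\<dots> = l \<psi>"
      by (simp add: mult.assoc[symmetric] power_mult_distrib[symmetric])
    finally show "(-1) ^ k * (\<Sum>\<sigma>\<in>{\<sigma>. msize \<sigma> = k}. \<integral>x. u x * mderiv (\<lambda>i. 2 * \<sigma> i) \<psi> x \<partial>lebesgue_on \<Omega>)
        = (\<integral>x. f x * \<psi> x \<partial>lebesgue_on \<Omega>)"
      by (simp add: l_def)
  qed
  moreover have "sobolev_seminorm k \<Omega> u \<le> M"
  proof (rule power2_le_imp_le[OF _ M], rule LIMSEQ_le)
    have "(sobolev_seminorm k \<Omega> u)\<^sup>2 = (\<Sum>\<sigma>\<in>{\<sigma>. msize \<sigma> = k}. (L2_norm \<Omega> (w \<sigma>))\<^sup>2)"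
      by (rule sobolev_seminorm_sq_weak[OF D weak]) simp
    moreover have "(\<lambda>n. ip (\<phi> n) (\<phi> n)) \<longlonglongrightarrow> (\<Sum>\<sigma>\<in>{\<sigma>. msize \<sigma> = k}. (L2_norm \<Omega> (w \<sigma>))\<^sup>2)"
      unfolding ip_eq
      by (intro tendsto_sum tendsto_power L2_norm_limit tL2 \<phi> w) auto
    ultimately show "(\<lambda>n. ip (\<phi> n) (\<phi> n)) \<longlonglongrightarrow> (sobolev_seminorm k \<Omega> u)\<^sup>2" by simp
    have "(\<lambda>n. (M + inverse (real (Suc n)))\<^sup>2) \<longlonglongrightarrow> (M + 0)\<^sup>2"
      by (intro tendsto_intros LIMSEQ_inverse_real_of_nat)
    then show "(\<lambda>n. (M + inverse (real (Suc n)))\<^sup>2) \<longlonglongrightarrow> M\<^sup>2" by simp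
    have "ip (\<phi> n) (\<phi> n) \<le> (M + inverse (real (Suc n)))\<^sup>2" for n
      using power_mono[OF norm[of n], of 2] by (simp add: ip_eq sum_nonneg)
    then show "\<exists>N. \<forall>n\<ge>N. ip (\<phi> n) (\<phi> n) \<le> (M + inverse (real (Suc n)))\<^sup>2"
      by blast
  qed
  ultimately show ?thesis by blast
qed

section \<open>Polynomials and unions of balls\<close>

lemma poly_functionsI: "(\<lambda>x. \<Sum>\<sigma>\<in>{\<sigma>. msize \<sigma> \<le> n}. c \<sigma> * (\<Prod>i\<in>UNIV. (x $ i) ^ \<sigma> i)) \<in> poly_functions n"
  by (auto simp: poly_functions_def)

lemma poly_functions_add:
  assumes "p \<in> poly_functions n" "q \<in> poly_functions n"
  shows "(\<lambda>x. p x + q x) \<in> poly_functions n"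
proof -
  obtain c d where "p = (\<lambda>x. \<Sum>\<sigma>\<in>{\<sigma>. msize \<sigma> \<le> n}. c \<sigma> * (\<Prod>i\<in>UNIV. (x $ i) ^ \<sigma> i))"
    "q = (\<lambda>x. \<Sum>\<sigma>\<in>{\<sigma>. msize \<sigma> \<le> n}. d \<sigma> * (\<Prod>i\<in>UNIV. (x $ i) ^ \<sigma> i))"
    using assms by (auto simp: poly_functions_def)
  then have "(\<lambda>x. p x + q x) = (\<lambda>x. \<Sum>\<sigma>\<in>{\<sigma>. msize \<sigma> \<le> n}. (c \<sigma> + d \<sigma>) * (\<Prod>i\<in>UNIV. (x $ i) ^ \<sigma> i))"
    by (simp add: sum.distrib distrib_right)
  then show ?thesis
    using poly_functionsI[where n = n and c = "\<lambda>\<sigma>. c \<sigma> + d \<sigma>"] by simp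
qed

lemma poly_functions_cmult:
  assumes "p \<in> poly_functions n" shows "(\<lambda>x. a * p x) \<in> poly_functions n"
proof -
  obtain c where "p = (\<lambda>x. \<Sum>\<sigma>\<in>{\<sigma>. msize \<sigma> \<le> n}. c \<sigma> * (\<Prod>i\<in>UNIV. (x $ i) ^ \<sigma> i))"
    using assms by (auto simp: poly_functions_def)
  then have "(\<lambda>x. a * p x) = (\<lambda>x. \<Sum>\<sigma>\<in>{\<sigma>. msize \<sigma> \<le> n}. (a * c \<sigma>) * (\<Prod>i\<in>UNIV. (x $ i) ^ \<sigma> i))"
    by (simp add: sum_distrib_left mult.assoc)
  then show ?thesis
    using poly_functionsI[where n = n and c = "\<lambda>\<sigma>. a * c \<sigma>"] by simp
qed

lemma poly_functions_monomial:
  fixes \<sigma> :: "'n::finite mindex"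
  assumes "msize \<sigma> \<le> n" shows "(\<lambda>x. \<Prod>i\<in>UNIV. (x $ i) ^ \<sigma> i) \<in> poly_functions n"
proof -
  have "(\<Sum>\<gamma>\<in>{\<gamma>. msize \<gamma> \<le> n}. (if \<gamma> = \<sigma> then 1 else 0) * (\<Prod>i\<in>UNIV. (x $ i) ^ \<gamma> i))
      = (\<Prod>i\<in>UNIV. (x $ i) ^ \<sigma> i)" for x :: "real^'n"
  proof -
    have "(\<Sum>\<gamma>\<in>{\<gamma>. msize \<gamma> \<le> n}. (if \<gamma> = \<sigma> then 1 else 0) * (\<Prod>i\<in>UNIV. (x $ i) ^ \<gamma> i))
        = (\<Sum>\<gamma>\<in>{\<gamma>. msize \<gamma> \<le> n}. if \<gamma> = \<sigma> then \<Prod>i\<in>UNIV. (x $ i) ^ \<gamma> i else 0)"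
      by (intro sum.cong) auto
    also have "\<dots> = (\<Prod>i\<in>UNIV. (x $ i) ^ \<sigma> i)"
      using assms by (simp add: finite_msize_le)
    finally show ?thesis .
  qed
  then show ?thesis
    using poly_functionsI[where n = n and c = "\<lambda>\<gamma>. if \<gamma> = \<sigma> then 1 else 0"] by simp
qed

lemma poly_functions_const: "(\<lambda>x. c) \<in> poly_functions n"
  using poly_functions_cmult[OF poly_functions_monomial[of "\<lambda>_. 0" n], of c]
  by (simp add: msize_def)

lemma poly_functions_sum:
  "(\<And>i. i \<in> A \<Longrightarrow> p i \<in> poly_functions n) \<Longrightarrow> (\<lambda>x. \<Sum>i\<in>A. p i x) \<in> poly_functions n"
  by (induction A rule: infinite_finite_induct) (simp_all add: poly_functions_const poly_functions_add)

lemma msize_upd_Suc: "msize (\<sigma>(i := Suc (\<sigma> i))) = Suc (msize (\<sigma> :: 'n::finite mindex))"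
proof -
  have "msize (\<sigma>(i := Suc (\<sigma> i))) = (\<Sum>j\<in>UNIV. \<sigma> j + (if j = i then 1 else 0))"
    unfolding msize_def by (intro sum.cong) auto
  then show ?thesis
    by (simp add: sum.distrib msize_def)
qed

lemma monomial_upd_Suc:
  fixes y :: "'n::finite \<Rightarrow> real"
  shows "(\<Prod>j\<in>UNIV. y j ^ (\<sigma>(i := Suc (\<sigma> i))) j) = y i * (\<Prod>j\<in>UNIV. y j ^ \<sigma> j)"
proof -
  have "(\<Prod>j\<in>UNIV. y j ^ (\<sigma>(i := Suc (\<sigma> i))) j) = (\<Prod>j\<in>UNIV. (if j = i then y j else 1) * y j ^ \<sigma> j)"
    by (intro prod.cong) auto
  then show ?thesis
    by (simp add: prod.distrib)
qed

lemma poly_functions_coord_mult: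
  assumes "p \<in> poly_functions n" shows "(\<lambda>x. x $ i * p x) \<in> poly_functions (Suc n)"
proof -
  obtain c where "p = (\<lambda>x. \<Sum>\<sigma>\<in>{\<sigma>. msize \<sigma> \<le> n}. c \<sigma> * (\<Prod>i\<in>UNIV. (x $ i) ^ \<sigma> i))"
    using assms by (auto simp: poly_functions_def)
  then have "(\<lambda>x. x $ i * p x) =
      (\<lambda>x. \<Sum>\<sigma>\<in>{\<sigma>. msize \<sigma> \<le> n}. c \<sigma> * (\<Prod>j\<in>UNIV. (x $ j) ^ (\<sigma>(i := Suc (\<sigma> i))) j))"
    by (simp only: monomial_upd_Suc sum_distrib_left mult.left_commute)
  also have "\<dots> \<in> poly_functions (Suc n)"
  proof (intro poly_functions_sum poly_functions_cmult poly_functions_monomial)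
    fix \<sigma> :: "'a mindex" assume "\<sigma> \<in> {\<sigma>. msize \<sigma> \<le> n}"
    then show "msize (\<sigma>(i := Suc (\<sigma> i))) \<le> Suc n"
      unfolding msize_upd_Suc by simp
  qed
  finally show ?thesis .
qed

lemma poly_functions_mono:
  assumes "p \<in> poly_functions m" "m \<le> n" shows "p \<in> poly_functions n"
proof -
  obtain c where "p = (\<lambda>x. \<Sum>\<sigma>\<in>{\<sigma>. msize \<sigma> \<le> m}. c \<sigma> * (\<Prod>i\<in>UNIV. (x $ i) ^ \<sigma> i))"
    using assms by (auto simp: poly_functions_def)
  then show ?thesis
    using assms(2) by (auto intro!: poly_functions_sum poly_functions_cmult poly_functions_monomial)
qed

text \<open>Splitting off one factor \<open>x $ i + c $ i\<close> reduces the degree by one: its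
  first summand raises the degree back, its second does not. Translation thus respects the degree
  bound in the inverse constant.\<close>

lemma poly_functions_translated_monomial:
  fixes \<sigma> :: "'n::finite mindex"
  shows "(\<lambda>x. \<Prod>i\<in>UNIV. (x $ i + c $ i) ^ \<sigma> i) \<in> poly_functions (msize \<sigma>)"
proof (induction "msize \<sigma>" arbitrary: \<sigma>)
  case 0
  then have "\<sigma> i = 0" for i
    by (simp add: msize_def)
  then show ?case
    by (simp add: poly_functions_const)
next
  case (Suc n)
  then obtain i where "\<sigma> i \<noteq> 0"
    by (metis Zero_not_Suc msize_def sum.neutral)
  define \<gamma> where "\<gamma> = \<sigma>(i := \<sigma> i - 1)"
  have \<sigma>: "\<sigma> = \<gamma>(i := Suc (\<gamma> i))"
    using \<open>\<sigma> i \<noteq> 0\<close> by (simp add: \<gamma>_def)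
  have "n = msize \<gamma>"
    using Suc(2) msize_upd_Suc[of \<gamma> i] \<sigma> by simp
  note IH = Suc(1)[OF this]
  have "(\<lambda>x. x $ i * (\<Prod>i\<in>UNIV. (x $ i + c $ i) ^ \<gamma> i) + c $ i * (\<Prod>i\<in>UNIV. (x $ i + c $ i) ^ \<gamma> i))
      \<in> poly_functions (Suc (msize \<gamma>))"
    by (intro poly_functions_add poly_functions_coord_mult poly_functions_cmult IH
        poly_functions_mono[OF IH]) simp
  moreover have "(\<lambda>x. \<Prod>j\<in>UNIV. (x $ j + c $ j) ^ \<sigma> j) =
      (\<lambda>x. x $ i * (\<Prod>i\<in>UNIV. (x $ i + c $ i) ^ \<gamma> i) + c $ i * (\<Prod>i\<in>UNIV. (x $ i + c $ i) ^ \<gamma> i))"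
  proof
    fix x
    show "(\<Prod>j\<in>UNIV. (x $ j + c $ j) ^ \<sigma> j) =
        x $ i * (\<Prod>i\<in>UNIV. (x $ i + c $ i) ^ \<gamma> i) + c $ i * (\<Prod>i\<in>UNIV. (x $ i + c $ i) ^ \<gamma> i)"
      using monomial_upd_Suc[of "\<lambda>j. x $ j + c $ j" \<gamma> i] unfolding \<sigma>[symmetric]
      by (simp add: distrib_right)
  qed
  ultimately show ?case
    using Suc(2) \<open>n = msize \<gamma>\<close> by simp
qed

lemma poly_functions_translate:
  assumes "p \<in> poly_functions n" shows "(\<lambda>x. p (x + c)) \<in> poly_functions n"
proof -
  obtain b where "p = (\<lambda>x. \<Sum>\<sigma>\<in>{\<sigma>. msize \<sigma> \<le> n}. b \<sigma> * (\<Prod>i\<in>UNIV. (x $ i) ^ \<sigma> i))"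
    using assms by (auto simp: poly_functions_def)
  then show ?thesis
    by (auto intro!: poly_functions_sum poly_functions_cmult
        poly_functions_mono[OF poly_functions_translated_monomial])
qed

lemma poly_functions_smooth:
  assumes "p \<in> poly_functions n" shows "smooth p"
  using assms unfolding poly_functions_def
  by (auto intro!: smooth_sum smooth_cmult smooth_prod smooth_power smooth_coord)

lemma smooth_L2:
  assumes "smooth f" "open \<Omega>" "bounded \<Omega>" shows "f \<in> L2 \<Omega>"
proof -
  have "compact (f ` closure \<Omega>)"
    using assms by (intro compact_continuous_image smooth_continuous) simp_all
  then obtain B where "\<And>y. y \<in> f ` closure \<Omega> \<Longrightarrow> norm y \<le> B"
    by (meson bounded_iff compact_imp_bounded)
  then have "\<bar>f x\<bar> \<le> B" if "x \<in> \<Omega>" for x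
    using that closure_subset[of \<Omega>] by auto
  then show ?thesis
    using assms by (intro bounded_in_L2 bounded_open_lmeasurable borel_measurable_lebesgue_onI smooth_measurable)
qed

lemma integral_translate:
  fixes f :: "real^'n::finite \<Rightarrow> real"
  assumes f: "f \<in> borel_measurable borel" and \<Omega>: "open \<Omega>"
  shows "(\<integral>x. f (x + c) \<partial>lebesgue_on ((\<lambda>x. x - c) ` \<Omega>)) = (\<integral>x. f x \<partial>lebesgue_on \<Omega>)"
proof -
  have int: "(\<integral>x. g x \<partial>lebesgue_on S) = (\<integral>x. indicator S x * g x \<partial>lborel)"
    if "g \<in> borel_measurable borel" "open S" for g :: "real^'n \<Rightarrow> real" and S
  proof -
    have "(\<integral>x. g x \<partial>lebesgue_on S) = (\<integral>x. indicator S x * g x \<partial>lebesgue)"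
      using that(2) by (subst integral_restrict_space) auto
    also have "\<dots> = (\<integral>x. indicator S x * g x \<partial>lborel)"
      using that by (intro integral_completion) auto
    finally show ?thesis .
  qed
  have "open ((\<lambda>x. x - c) ` \<Omega>)"
    using open_translation_subtract[OF \<Omega>] .
  moreover have "(\<lambda>x. f (x + c)) \<in> borel_measurable borel"
    using f by (rule measurable_compose[rotated]) simp
  ultimately have "(\<integral>x. f (x + c) \<partial>lebesgue_on ((\<lambda>x. x - c) ` \<Omega>))
      = (\<integral>x. indicator ((\<lambda>x. x - c) ` \<Omega>) x * f (x + c) \<partial>lborel)"
    by (intro int)
  also have "\<dots> = (\<integral>x. indicator \<Omega> (c + x) * f (c + x) \<partial>lborel)"
    by (intro Bochner_Integration.integral_cong) (auto simp: indicator_def add.commute image_iff algebra_simps)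
  also have "\<dots> = (\<integral>x. indicator \<Omega> x * f x \<partial>distr lborel borel ((+) c))"
    using f \<Omega> by (subst integral_distr) auto
  also have "\<dots> = (\<integral>x. f x \<partial>lebesgue_on \<Omega>)"
    using int[OF f \<Omega>] by (simp add: lborel_distr_plus)
  finally show ?thesis .
qed

section \<open>Smooth domains and the exhaustion of an element by balls\<close>

lemma smooth_open_translate:
  assumes "smooth_open \<Omega>" shows "smooth_open ((\<lambda>x. x - c) ` \<Omega>)"
  unfolding smooth_open_def
proof (intro conjI ballI)
  show "open ((\<lambda>x. x - c) ` \<Omega>)"
    using assms by (intro open_translation_subtract) (simp add: smooth_open_def)
  fix x assume "x \<in> frontier ((\<lambda>x. x - c) ` \<Omega>)"
  moreover have "frontier ((\<lambda>x. x - c) ` \<Omega>) = (\<lambda>x. x - c) ` frontier \<Omega>"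
    using frontier_translation[of "- c" \<Omega>] by simp
  ultimately have "x + c \<in> frontier \<Omega>" by auto
  then obtain U \<phi> i where U: "open U" "x + c \<in> U" "smooth \<phi>" "partial i \<phi> (x + c) \<noteq> 0"
    "\<Omega> \<inter> U = {y \<in> U. \<phi> y < 0}"
    using assms unfolding smooth_open_def by blast
  show "\<exists>U \<phi>. open U \<and> x \<in> U \<and> smooth \<phi> \<and> (\<exists>i. partial i \<phi> x \<noteq> 0) \<and>
      (\<lambda>x. x - c) ` \<Omega> \<inter> U = {y \<in> U. \<phi> y < 0}"
  proof (intro exI conjI)
    show "open ((\<lambda>x. x - c) ` U)"
      by (rule open_translation_subtract[OF U(1)])
    show "x \<in> (\<lambda>x. x - c) ` U"
      using U(2) by (metis add_diff_cancel_right' imageI)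
    show "smooth (\<lambda>x. \<phi> (x + c))"
      by (rule smooth_translate[OF U(3)])
    show "partial i (\<lambda>x. \<phi> (x + c)) x \<noteq> 0"
      using U(4) by (simp add: partial_translate)
    have mem: "y \<in> (\<lambda>x. x - c) ` S \<longleftrightarrow> y + c \<in> S" for y S
    proof
      assume "y + c \<in> S"
      then have "(y + c) - c \<in> (\<lambda>x. x - c) ` S" by (rule imageI)
      then show "y \<in> (\<lambda>x. x - c) ` S" by simp
    qed auto
    have "y + c \<in> \<Omega> \<and> y + c \<in> U \<longleftrightarrow> y + c \<in> U \<and> \<phi> (y + c) < 0" for y
      using U(5) by blast
    then show "(\<lambda>x. x - c) ` \<Omega> \<inter> (\<lambda>x. x - c) ` U = {y \<in> (\<lambda>x. x - c) ` U. \<phi> (y + c) < 0}"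
      by (simp add: set_eq_iff mem)
  qed
qed

text \<open>Since the closed balls are disjoint and finitely many, a boundary point of the union has
  a neighbourhood \<open>U\<close> that meets only one of them. There |y - a|^2 - r^2 is a defining
  function, and its gradient 2 (x - a) is nonzero on the sphere.\<close>

lemma smooth_open_disjoint_balls:
  fixes a :: "'i \<Rightarrow> real^'n::finite"
  assumes I: "finite I" and r: "\<And>i. i \<in> I \<Longrightarrow> 0 < r i"
    and disj: "pairwise (\<lambda>i j. disjnt (cball (a i) (r i)) (cball (a j) (r j))) I"
  shows "smooth_open (\<Union>i\<in>I. ball (a i) (r i))"
  unfolding smooth_open_def
proof (intro conjI ballI)
  let ?\<Omega> = "\<Union>i\<in>I. ball (a i) (r i)"
  show op: "open ?\<Omega>" by auto
  fix x assume x: "x \<in> frontier ?\<Omega>"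
  have "x \<in> closure ?\<Omega>" "x \<notin> ?\<Omega>"
    using x op by (auto simp: frontier_def interior_open)
  moreover have "closure ?\<Omega> \<subseteq> (\<Union>i\<in>I. cball (a i) (r i))"
    using I by (intro closure_minimal closed_UN) (auto dest: less_imp_le)
  ultimately obtain i where i: "i \<in> I" "x \<in> cball (a i) (r i)" "x \<notin> ball (a i) (r i)"
    by blast
  then have xi: "dist (a i) x = r i"
    by simp
  define U where "U = - (\<Union>j\<in>I - {i}. cball (a j) (r j))"
  define \<phi> where "\<phi> y = (y - a i) \<bullet> (y - a i) - (r i)\<^sup>2" for y
  have \<phi>: "\<phi> y < 0 \<longleftrightarrow> y \<in> ball (a i) (r i)" for y
  proof -
    have "\<phi> y = (dist (a i) y)\<^sup>2 - (r i)\<^sup>2"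
      by (simp add: \<phi>_def dist_norm power2_norm_eq_inner norm_minus_commute[of "a i"])
    then show ?thesis
      using r[OF i(1)] by (auto simp: abs_square_le_1 power_mono_iff not_less[symmetric] power2_less_imp_less
          intro: power_strict_mono power2_less_imp_less)
  qed
  show "\<exists>U \<phi>. open U \<and> x \<in> U \<and> smooth \<phi> \<and> (\<exists>i. partial i \<phi> x \<noteq> 0) \<and> ?\<Omega> \<inter> U = {y \<in> U. \<phi> y < 0}"
  proof (rule exI[of _ U], rule exI[of _ \<phi>], intro conjI)
    show "open U"
      unfolding U_def using I by (intro open_Compl closed_UN) auto
    show "x \<in> U"
      using disj i(1) xi unfolding U_def pairwise_def disjnt_def by force
    have "\<phi> = (\<lambda>y. (\<Sum>l\<in>UNIV. (y $ l - a i $ l) * (y $ l - a i $ l)) - (r i)\<^sup>2)"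
      by (simp add: \<phi>_def fun_eq_iff inner_vec_def)
    then show "smooth \<phi>"
      by (simp only:) (intro smooth_diff smooth_sum smooth_mult smooth_coord smooth_const)
    show "?\<Omega> \<inter> U = {y \<in> U. \<phi> y < 0}"
      using i(1) unfolding \<phi> U_def by (auto, metis Diff_iff less_imp_le singletonD)
    have "x \<noteq> a i"
      using xi r[OF i(1)] by auto
    then obtain l where l: "x $ l \<noteq> a i $ l"
      by (auto simp: vec_eq_iff)
    have "(\<phi> has_derivative (\<lambda>v. (x - a i) \<bullet> v + v \<bullet> (x - a i))) (at x)"
      unfolding \<phi>_def[abs_def] by (auto intro!: derivative_eq_intros)
    from partial_eqI[OF this, of l] l have "partial l \<phi> x \<noteq> 0"
      by (simp add: inner_axis inner_axis' algebra_simps)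
    then show "\<exists>l. partial l \<phi> x \<noteq> 0" by blast
  qed
qed

text \<open>\<open>inscribed_diameter\<close> is a supremum, which gives only balls of radius below
  d/2. Their centres lie in the bounded set \<open>T\<close>, and an accumulation point of them is
  the centre of a full ball.\<close>

lemma inscribed_ball_attained:
  fixes T :: "(real^'n::finite) set"
  assumes T: "bounded T" and d: "0 < d" "d \<le> inscribed_diameter T"
  obtains x where "ball x (d / 2) \<subseteq> T"
proof -
  let ?S = "{2 * r | r. 0 \<le> r \<and> (\<exists>x. ball x r \<subseteq> T)}"
  \<comment> \<open>Radii increasing to d/2. The double successor makes the first one d/4, so that
    every ball is nonempty and its centre lies in \<open>T\<close>.\<close>
  define e where "e n = d / 2 * (1 - inverse (real (Suc (Suc n))))" for n
  have e: "0 < e n" "2 * e n < d" for n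
    using d(1) by (auto simp: e_def field_simps intro: add_pos_nonneg)
  have ne: "?S \<noteq> {}"
    by (auto intro!: exI[of _ 0])
  have "\<exists>x. ball x (e n) \<subseteq> T" for n
  proof -
    have "2 * e n < Sup ?S"
      using e(2)[of n] d(2) by (simp add: inscribed_diameter_def)
    from less_cSupD[OF ne this] obtain r x where "2 * e n < 2 * r" "ball x r \<subseteq> T"
      by auto
    then show ?thesis
      using subset_ball[of "e n" r x] by auto
  qed
  then obtain y where y: "\<And>n. ball (y n) (e n) \<subseteq> T"
    by metis
  have "y n \<in> T" for n
    using y[of n] e(1)[of n] by (meson centre_in_ball subsetD)
  then have "range y \<subseteq> T" by blast
  then have "bounded (range y)"
    using T bounded_subset by blast
  then obtain x s where s: "strict_mono s" "(y \<circ> s) \<longlonglongrightarrow> x"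
    using bounded_imp_convergent_subsequence by metis
  have "ball x (d / 2) \<subseteq> T"
  proof
    fix z assume "z \<in> ball x (d / 2)"
    then have z: "dist x z < d / 2" by simp
    have "(\<lambda>n. d / 2 * (1 - inverse (real (Suc (Suc n))))) \<longlonglongrightarrow> d / 2 * (1 - 0)"
      by (intro tendsto_intros LIMSEQ_Suc[OF LIMSEQ_inverse_real_of_nat])
    then have "e \<longlonglongrightarrow> d / 2"
      by (simp add: e_def[abs_def])
    then have "(\<lambda>n. e (s n) - dist (y (s n)) z) \<longlonglongrightarrow> d / 2 - dist x z"
      using s LIMSEQ_subseq_LIMSEQ[of e "d / 2" s] by (intro tendsto_intros) (auto simp: o_def)
    then have "\<forall>\<^sub>F n in sequentially. 0 < e (s n) - dist (y (s n)) z"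
      by (rule order_tendstoD) (use z in simp)
    then obtain n where "dist (y (s n)) z < e (s n)"
      by (auto simp: eventually_sequentially)
    then show "z \<in> T"
      using y[of "s n"] by auto
  qed
  then show thesis by (rule that)
qed

text \<open>The sets \<open>\<Omega> n\<close> contain almost every point of \<open>T\<close> from
  some index on, so dominated convergence carries the bound over to \<open>T\<close>.\<close>

lemma L2_norm_le_by_balls:
  fixes T :: "(real^'n::finite) set"
  assumes T: "open T" and r: "0 < r" "ball x0 r \<subseteq> T" and f: "f \<in> L2 T" and B: "0 \<le> B"
    and bound: "\<And>\<Omega>. smooth_open \<Omega> \<Longrightarrow> ball x0 r \<subseteq> \<Omega> \<Longrightarrow> \<Omega> \<subseteq> T \<Longrightarrow> L2_norm \<Omega> f \<le> B"
  shows "L2_norm T f \<le> B"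
proof -
  \<comment> \<open>Taking out the closed ball keeps the closed balls of the covering disjoint from
    it, as smoothness of the union demands.\<close>
  define S where "S = T - cball x0 r"
  have S: "open S" unfolding S_def using T by (intro open_Diff) auto
  define K where "K = {i :: (real^'n) \<times> real. 0 < snd i \<and> cball (fst i) (snd i) \<subseteq> S}"
  have fine: "\<exists>i. i \<in> K \<and> x \<in> cball (fst i) (snd i) \<and> snd i < d" if x: "x \<in> S" and d: "0 < d" for x d
  proof -
    obtain e where e: "e > 0" "cball x e \<subseteq> S"
      using S x open_contains_cball by blast
    have "cball x (min e (d / 2)) \<subseteq> cball x e"
      by (rule subset_cball) simp
    with e d have "(x, min e (d / 2)) \<in> K \<and> x \<in> cball (fst (x, min e (d / 2))) (snd (x, min e (d / 2)))
        \<and> snd (x, min e (d / 2)) < d"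
      by (auto simp: K_def subset_iff)
    then show ?thesis by (rule exI)
  qed
  have "0 < snd i" if "i \<in> K" for i
    using that by (simp add: K_def)
  from this fine obtain C where C: "countable C" "C \<subseteq> K"
    "pairwise (\<lambda>i j. disjnt (cball (fst i) (snd i)) (cball (fst j) (snd j))) C"
    "negligible (S - (\<Union>i\<in>C. cball (fst i) (snd i)))"
    by (rule Vitali_covering_theorem_cballs[of K snd S fst])
  \<comment> \<open>The inscribed ball together with the Vitali balls numbered below
    \<open>n\<close>; finitely many at each stage, as \<open>smooth_open_disjoint_balls\<close>
    requires.\<close>
  define I where "I n = insert (x0, r) {i \<in> C. to_nat_on C i < n}" for n
  define \<Omega> where "\<Omega> n = (\<Union>i\<in>I n. ball (fst i) (snd i))" for n
  have fin: "finite (I n)" for n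
  proof -
    have "finite ({i \<in> C. to_nat_on C i < n})"
      by (rule inj_on_finite[of "to_nat_on C" _ "{..<n}"])
        (use C(1) inj_on_to_nat_on in \<open>auto intro: inj_on_subset\<close>)
    then show ?thesis by (simp add: I_def)
  qed
  have CK: "0 < snd i" "cball (fst i) (snd i) \<subseteq> S" if "i \<in> C" for i
    using C(2) that by (auto simp: K_def)
  have pos: "0 < snd i" if "i \<in> I n" for i n
    using that CK(1)[of i] r by (auto simp: I_def)
  have "pairwise (\<lambda>i j. disjnt (cball (fst i) (snd i)) (cball (fst j) (snd j))) (I n)" for n
  proof -
    have "pairwise (\<lambda>i j. disjnt (cball (fst i) (snd i)) (cball (fst j) (snd j))) {i \<in> C. to_nat_on C i < n}"
      by (rule pairwise_subset[OF C(3)]) auto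
    moreover have "disjnt (cball x0 r) (cball (fst i) (snd i))" if "i \<in> C" for i
      using CK(2)[OF that] by (auto simp: S_def disjnt_def)
    ultimately show ?thesis
      by (auto simp: I_def pairwise_insert disjnt_sym)
  qed
  then have smooth: "smooth_open (\<Omega> n)" for n
    unfolding \<Omega>_def by (intro smooth_open_disjoint_balls fin pos)
  have sub: "ball x0 r \<subseteq> \<Omega> n" "\<Omega> n \<subseteq> T" for n
  proof -
    show "ball x0 r \<subseteq> \<Omega> n" by (auto simp: \<Omega>_def I_def)
    have "ball (fst i) (snd i) \<subseteq> T" if "i \<in> C" for i
      using CK(2)[OF that] ball_subset_cball[of "fst i" "snd i"] unfolding S_def by blast
    then show "\<Omega> n \<subseteq> T"
      using r(2) by (auto simp: \<Omega>_def I_def)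
  qed
  have meas: "\<Omega> n \<in> sets lebesgue" for n
    using smooth[of n] by (simp add: smooth_open_def)
  \<comment> \<open>The covering is by closed balls, but \<open>\<Omega> n\<close> consists of open
    ones: besides the uncovered rest, all the spheres have to be discarded.\<close>
  define Z where "Z = (S - (\<Union>i\<in>C. cball (fst i) (snd i))) \<union> (sphere x0 r \<union> (\<Union>i\<in>C. sphere (fst i) (snd i)))"
  have "negligible Z"
    unfolding Z_def using C(1,4)
    by (intro negligible_Un negligible_countable_Union) (auto simp: negligible_sphere)
  then have AEZ: "AE x in lebesgue. x \<notin> Z"
    by (intro AE_not_in) (simp add: negligible_iff_null_sets)
  have ev: "\<forall>\<^sub>F n in sequentially. x \<in> \<Omega> n" if xT: "x \<in> T" and xZ: "x \<notin> Z" for x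
  proof (cases "x \<in> cball x0 r")
    case True
    then have "x \<in> ball x0 r"
      using xZ by (auto simp: Z_def)
    then show ?thesis
      using sub(1) by (intro always_eventually allI) (rule subsetD)
  next
    case False
    then have "x \<in> S" using xT by (simp add: S_def)
    then obtain i where i: "i \<in> C" "x \<in> cball (fst i) (snd i)"
      using xZ by (auto simp: Z_def)
    then have "x \<in> ball (fst i) (snd i)"
      using xZ by (force simp: Z_def)
    then have "x \<in> \<Omega> n" if "to_nat_on C i < n" for n
      using i(1) that by (auto simp: \<Omega>_def I_def)
    then show ?thesis
      by (auto simp: eventually_sequentially intro!: exI[of _ "Suc (to_nat_on C i)"])
  qed
  have T': "T \<in> sets lebesgue" using T by simp
  have "(\<lambda>n. \<integral>x. (if x \<in> \<Omega> n then (f x)\<^sup>2 else 0) \<partial>lebesgue_on T) \<longlonglongrightarrow> (\<integral>x. (f x)\<^sup>2 \<partial>lebesgue_on T)"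
  proof (rule integral_dominated_convergence[where w = "\<lambda>x. (f x)\<^sup>2"])
    have [measurable]: "f \<in> borel_measurable (lebesgue_on T)"
      using f by (rule L2D)
    have mem: "{x \<in> space (lebesgue_on T). x \<in> \<Omega> n} \<in> sets (lebesgue_on T)" for n
    proof -
      have "{x \<in> space (lebesgue_on T). x \<in> \<Omega> n} = \<Omega> n"
        using sub(2)[of n] by (auto simp: space_restrict_space)
      then show ?thesis
        using meas[of n] sub(2)[of n] T' by (simp add: sets_restrict_space_iff)
    qed
    show "(\<lambda>x. if x \<in> \<Omega> n then (f x)\<^sup>2 else 0) \<in> borel_measurable (lebesgue_on T)" for n
      by (intro measurable_If mem) measurable
    show "AE x in lebesgue_on T. (\<lambda>n. if x \<in> \<Omega> n then (f x)\<^sup>2 else 0) \<longlonglongrightarrow> (f x)\<^sup>2"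
    proof -
      have "AE x in lebesgue. x \<in> T \<longrightarrow> (\<lambda>n. if x \<in> \<Omega> n then (f x)\<^sup>2 else 0) \<longlonglongrightarrow> (f x)\<^sup>2"
        using AEZ
      proof eventually_elim
        case (elim x)
        show ?case
        proof
          assume "x \<in> T"
          from ev[OF this elim] show "(\<lambda>n. if x \<in> \<Omega> n then (f x)\<^sup>2 else 0) \<longlonglongrightarrow> (f x)\<^sup>2"
            by (intro tendsto_eventually) (rule eventually_mono, assumption, simp)
        qed
      qed
      then show ?thesis
        using T' by (simp add: AE_restrict_space_iff)
    qed
  qed (use L2D[OF f] in auto)
  moreover have "(\<integral>x. (if x \<in> \<Omega> n then (f x)\<^sup>2 else 0) \<partial>lebesgue_on T) \<le> B\<^sup>2" for n
  proof -
    have "(\<integral>x. (if x \<in> \<Omega> n then (f x)\<^sup>2 else 0) \<partial>lebesgue_on T) = (L2_norm (\<Omega> n) f)\<^sup>2"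
      unfolding L2_norm_sq by (rule Lebesgue_Measure.integral_restrict[OF sub(2) meas T'])
    also have "\<dots> \<le> B\<^sup>2"
      by (intro power_mono bound smooth sub L2_norm_nonneg)
    finally show ?thesis .
  qed
  ultimately have "(L2_norm T f)\<^sup>2 \<le> B\<^sup>2"
    unfolding L2_norm_sq by (intro LIMSEQ_le_const2) auto
  then show ?thesis
    using B by (rule power2_le_imp_le)
qed

section \<open>Estimates on smooth subdomains\<close>

lemma L2_norm_translate:
  fixes f :: "real^'n::finite \<Rightarrow> real"
  assumes "f \<in> borel_measurable borel" "open \<Omega>"
  shows "L2_norm ((\<lambda>x. x - c) ` \<Omega>) (\<lambda>x. f (x + c)) = L2_norm \<Omega> f"
  unfolding L2_norm_def using integral_translate[of "\<lambda>x. (f x)\<^sup>2" \<Omega> c] assms by simp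

lemma sobolev_seminorm_test_function:
  assumes "open \<Omega>" "bounded \<Omega>" "\<phi> \<in> test_functions \<Omega>"
  shows "(sobolev_seminorm p \<Omega> \<phi>)\<^sup>2 = (\<Sum>\<sigma>\<in>{\<sigma>. msize \<sigma> = p}. (L2_norm \<Omega> (mderiv \<sigma> \<phi>))\<^sup>2)"
  by (rule sobolev_seminorm_sq_weak[OF assms(1,2) is_weak_deriv_test_function[OF assms]])

lemma sobolev_seminorm_translate:
  fixes \<Omega> :: "(real^'n::finite) set"
  assumes \<Omega>: "open \<Omega>" "bounded \<Omega>" and \<phi>: "\<phi> \<in> test_functions \<Omega>"
    and \<phi>': "(\<lambda>x. \<phi> (x + c)) \<in> test_functions ((\<lambda>x. x - c) ` \<Omega>)"
  shows "sobolev_seminorm p ((\<lambda>x. x - c) ` \<Omega>) (\<lambda>x. \<phi> (x + c)) = sobolev_seminorm p \<Omega> \<phi>"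
proof -
  have "open ((\<lambda>x. x - c) ` \<Omega>)" "bounded ((\<lambda>x. x - c) ` \<Omega>)"
    using open_translation_subtract[OF \<Omega>(1)] bounded_translation_minus[OF \<Omega>(2)] by auto
  from sobolev_seminorm_test_function[OF this \<phi>', of p]
  have "(sobolev_seminorm p ((\<lambda>x. x - c) ` \<Omega>) (\<lambda>x. \<phi> (x + c)))\<^sup>2 = (sobolev_seminorm p \<Omega> \<phi>)\<^sup>2"
    using L2_norm_translate[OF smooth_measurable[OF smooth_mderiv[OF test_functionsD(1)[OF \<phi>]]] \<Omega>(1)]
    by (simp add: sobolev_seminorm_test_function[OF \<Omega> \<phi>] mderiv_translate)
  then show ?thesis
    by (simp add: sobolev_seminorm_nonneg power2_eq_iff_nonneg)
qed

text \<open>After moving \<open>x0\<close> to the origin, the dual bound yields a solution of the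
  polyharmonic equation whose seminorm \<open>s\<close> is at most \<open>M\<close>. The conclusion
  keeps \<open>s\<close> instead of \<open>M\<close>, because replacing it needs the sign of
  \<open>C\<close>, which is itself deduced from this lemma.\<close>

lemma inverse_estimate:
  fixes \<Omega> :: "(real^'n::finite) set"
  assumes friedrichs: "friedrichs_constant TYPE('n) k Cf" and inverse: "inverse_constant TYPE('n) k \<delta> C"
    and \<Omega>: "smooth_open \<Omega>" "bounded \<Omega>" and t: "0 < t" "diameter \<Omega> \<le> t" "ball x0 (\<delta> * t / 2) \<subseteq> \<Omega>"
    and p: "p \<in> poly_functions (k - 1)" and M: "0 \<le> M"
    and bound: "\<And>\<phi>. \<phi> \<in> test_functions \<Omega> \<Longrightarrow>
      \<bar>\<integral>x. p x * \<phi> x \<partial>lebesgue_on \<Omega>\<bar> \<le> M * sobolev_seminorm k \<Omega> \<phi>"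
  shows "\<exists>s. 0 \<le> s \<and> s \<le> M \<and> L2_norm \<Omega> p \<le> C / t ^ k * s"
proof -
  have op: "open \<Omega>" using \<Omega>(1) by (simp add: smooth_open_def)
  define \<Omega>' where "\<Omega>' = (\<lambda>x. x - x0) ` \<Omega>"
  define q where "q x = p (x + x0)" for x
  have op': "open \<Omega>'" and bd': "bounded \<Omega>'"
    unfolding \<Omega>'_def using open_translation_subtract[OF op] bounded_translation_minus[OF \<Omega>(2)] by auto
  have so': "smooth_open \<Omega>'"
    unfolding \<Omega>'_def by (rule smooth_open_translate[OF \<Omega>(1)])
  have diam': "diameter \<Omega>' \<le> t"
  proof (rule diameter_le)
    show "norm (x - y) \<le> t" if xy: "x \<in> \<Omega>'" "y \<in> \<Omega>'" for x y
    proof -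
      obtain x1 y1 where "x1 \<in> \<Omega>" "y1 \<in> \<Omega>" "x = x1 - x0" "y = y1 - x0"
        using xy by (auto simp: \<Omega>'_def)
      then show ?thesis
        using diameter_bounded_bound[OF \<Omega>(2), of x1 y1] t(2) by (simp add: dist_norm)
    qed
  qed (use t(1) in simp)
  have ball': "ball 0 (\<delta> * t / 2) \<subseteq> \<Omega>'"
  proof
    fix x :: "real^'n" assume "x \<in> ball 0 (\<delta> * t / 2)"
    then have "x + x0 \<in> \<Omega>"
      using t(3) by (auto simp: dist_norm)
    then have "(x + x0) - x0 \<in> \<Omega>'"
      unfolding \<Omega>'_def by (rule imageI)
    then show "x \<in> \<Omega>'" by simp
  qed
  have q: "q \<in> poly_functions (k - 1)"
    unfolding q_def[abs_def] by (rule poly_functions_translate[OF p])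
  have ps: "p \<in> borel_measurable borel"
    by (rule smooth_measurable[OF poly_functions_smooth[OF p]])
  have bound': "\<bar>\<integral>x. q x * \<psi> x \<partial>lebesgue_on \<Omega>'\<bar> \<le> M * sobolev_seminorm k \<Omega>' \<psi>"
    if \<psi>: "\<psi> \<in> test_functions \<Omega>'" for \<psi>
  proof -
    define \<phi> where "\<phi> x = \<psi> (x + - x0)" for x
    have \<phi>: "\<phi> \<in> test_functions \<Omega>"
      unfolding \<phi>_def[abs_def] by (rule test_functions_translate) (use \<psi> in \<open>simp add: \<Omega>'_def\<close>)
    have \<psi>_eq: "\<psi> = (\<lambda>x. \<phi> (x + x0))"
      by (simp add: \<phi>_def)
    have "(\<integral>x. q x * \<psi> x \<partial>lebesgue_on \<Omega>') = (\<integral>x. p x * \<phi> x \<partial>lebesgue_on \<Omega>)"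
      unfolding \<Omega>'_def \<psi>_eq q_def
      by (rule integral_translate[of "\<lambda>x. p x * \<phi> x", OF _ op])
        (intro borel_measurable_times ps smooth_measurable test_functionsD(1)[OF \<phi>])
    moreover have "sobolev_seminorm k \<Omega>' \<psi> = sobolev_seminorm k \<Omega> \<phi>"
      unfolding \<Omega>'_def \<psi>_eq
      by (rule sobolev_seminorm_translate[OF op \<Omega>(2) \<phi>]) (use \<psi> in \<open>simp add: \<psi>_eq \<Omega>'_def\<close>)
    ultimately show ?thesis
      using bound[OF \<phi>] by simp
  qed
  have "\<exists>u\<in>sobolev0 k \<Omega>'. polyharmonic_eq k \<Omega>' u q \<and> sobolev_seminorm k \<Omega>' u \<le> M"
  proof (rule polyharmonic_solution[OF op' bd' _ M bound'])
    show "q \<in> L2 \<Omega>'"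
      by (rule smooth_L2[OF poly_functions_smooth[OF q] op' bd'])
    show "sobolev_seminorm j \<Omega>' \<phi> \<le> Cf * t ^ (k - j) * sobolev_seminorm k \<Omega>' \<phi>"
      if "\<phi> \<in> test_functions \<Omega>'" "j \<le> k" for j \<phi>
      using friedrichs so' bd' diam' test_functions_sobolev0[OF op' bd' that(1)] that(2)
      unfolding friedrichs_constant_def by blast
  qed
  then obtain u where u: "u \<in> sobolev0 k \<Omega>'" "polyharmonic_eq k \<Omega>' u q" "sobolev_seminorm k \<Omega>' u \<le> M"
    by blast
  have "L2_norm \<Omega>' q \<le> C / t ^ k * sobolev_seminorm k \<Omega>' u"
    using inverse q t(1) so' bd' diam' ball' u(1,2) unfolding inverse_constant_def by blast
  moreover have "L2_norm \<Omega>' q = L2_norm \<Omega> p"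
    unfolding \<Omega>'_def q_def by (rule L2_norm_translate[OF ps op])
  ultimately show ?thesis
    using u(3) sobolev_seminorm_nonneg[of k \<Omega>' u] by auto
qed

text \<open>Apply the inverse estimate to the polynomial 1 on the unit ball with t = 2: a positive
  norm is bounded by C / 2^k times a nonnegative number. The assumption
  \<open>\<delta> \<le> 1\<close> puts the prescribed ball of radius \<open>\<delta>\<close> inside
  the unit ball. The dual bound \<open>M\<close> combines Cauchy--Schwarz with Friedrichs'
  inequality of order 0.\<close>

lemma inverse_constant_pos:
  assumes friedrichs: "friedrichs_constant TYPE('n::finite) k Cf" and inverse: "inverse_constant TYPE('n) k \<delta> C"
    and \<delta>: "0 < \<delta>" "\<delta> \<le> 1"
  shows "0 < C"
proof -
  let ?B = "ball 0 1 :: (real^'n) set"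
  have so: "smooth_open ?B"
    using smooth_open_disjoint_balls[of "{()}" "\<lambda>_. 1" "\<lambda>_. 0 :: real^'n"] by simp
  note L = bounded_open_lmeasurable[OF open_ball bounded_ball, of "0 :: real^'n" 1]
  have diam: "diameter ?B \<le> 2" by simp
  define N where "N = L2_norm ?B (\<lambda>x. 1)"
  have "N\<^sup>2 = measure lebesgue ?B"
    using L by (simp add: N_def L2_norm_sq measure_restrict_space fmeasurableD)
  then have "N\<^sup>2 > 0"
    using content_ball_pos[of 1 "0 :: real^'n"] by simp
  moreover have "N \<ge> 0"
    by (simp add: N_def L2_norm_nonneg)
  ultimately have N: "N > 0"
    by (simp add: zero_less_power2)
  define M where "M = N * (\<bar>Cf\<bar> * 2 ^ k)"
  have bound: "\<bar>\<integral>x. 1 * \<phi> x \<partial>lebesgue_on ?B\<bar> \<le> M * sobolev_seminorm k ?B \<phi>"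
    if \<phi>: "\<phi> \<in> test_functions ?B" for \<phi>
  proof -
    define z :: "'n mindex" where "z = (\<lambda>_. 0)"
    have z: "msize z = 0" by (simp add: z_def msize_def)
    have "(L2_norm ?B \<phi>)\<^sup>2 \<le> (sobolev_seminorm 0 ?B \<phi>)\<^sup>2"
    proof -
      have "(L2_norm ?B (mderiv z \<phi>))\<^sup>2 \<le> (\<Sum>\<sigma>\<in>{\<sigma>. msize \<sigma> = 0}. (L2_norm ?B (mderiv \<sigma> \<phi>))\<^sup>2)"
        by (rule member_le_sum) (auto simp: finite_msize_eq z)
      then show ?thesis
        using sobolev_seminorm_test_function[OF open_ball bounded_ball \<phi>, of 0]
        by (simp add: mderiv_zero[OF test_functionsD(1)[OF \<phi>] z])
    qed
    then have "L2_norm ?B \<phi> \<le> sobolev_seminorm 0 ?B \<phi>"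
      by (rule power2_le_imp_le) (rule sobolev_seminorm_nonneg)
    also have "\<dots> \<le> Cf * 2 ^ (k - 0) * sobolev_seminorm k ?B \<phi>"
      using friedrichs so bounded_ball diam test_functions_sobolev0[OF open_ball bounded_ball \<phi>]
      unfolding friedrichs_constant_def by blast
    also have "\<dots> \<le> \<bar>Cf\<bar> * 2 ^ k * sobolev_seminorm k ?B \<phi>"
      by (intro mult_right_mono sobolev_seminorm_nonneg) simp_all
    finally have "L2_norm ?B \<phi> \<le> \<bar>Cf\<bar> * 2 ^ k * sobolev_seminorm k ?B \<phi>" .
    then have "N * L2_norm ?B \<phi> \<le> N * (\<bar>Cf\<bar> * 2 ^ k * sobolev_seminorm k ?B \<phi>)"
      using N by (intro mult_left_mono) auto
    then show ?thesis
      using L2_Cauchy_Schwarz[OF L2_one[OF L] test_functions_L2[OF \<phi> L]]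
      by (simp add: M_def N_def mult.assoc)
  qed
  have "ball 0 (\<delta> * 2 / 2) \<subseteq> ?B"
    using \<delta> by (intro subset_ball) simp
  from inverse_estimate[OF friedrichs inverse so bounded_ball zero_less_numeral diam this poly_functions_const _ bound]
  obtain s where s: "0 \<le> s" "N \<le> C / 2 ^ k * s"
    using N by (auto simp: M_def N_def)
  then have "0 < C / 2 ^ k * s"
    using N by linarith
  then show ?thesis
    using s(1) by (auto simp: zero_less_mult_iff zero_less_divide_iff)
qed

section \<open>The energy estimate\<close>

text \<open>
  The form evaluated at given representatives of the weak derivatives, which, unlike the choice made
  by \<open>wderiv\<close>, are pointwise linear in the function.
\<close>
definition form_fam ::
  "('n::finite mindex \<Rightarrow> 'n mindex \<Rightarrow> real^'n \<Rightarrow> real) \<Rightarrow> nat \<Rightarrow> (real^'n) set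
    \<Rightarrow> ('n mindex \<Rightarrow> real^'n \<Rightarrow> real) \<Rightarrow> ('n mindex \<Rightarrow> real^'n \<Rightarrow> real) \<Rightarrow> real" where
  "form_fam a k S X Y = (\<Sum>\<sigma>\<in>{\<sigma>. msize \<sigma> \<le> k}. \<Sum>\<gamma>\<in>{\<gamma>. msize \<gamma> \<le> k}.
    \<integral>x. a \<sigma> \<gamma> x * X \<sigma> x * Y \<gamma> x \<partial>lebesgue_on S)"

lemma form_fam_integrable:
  assumes "a \<sigma> \<gamma> \<in> Linfty S" "X \<sigma> \<in> L2 S" "Y \<gamma> \<in> L2 S"
  shows "integrable (lebesgue_on S) (\<lambda>x. a \<sigma> \<gamma> x * X \<sigma> x * Y \<gamma> x)"
  by (rule L2_mult_integrable[OF Linfty_mult_L2[OF assms(1,2)] assms(3)])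

lemma form_on_eq_form_fam:
  assumes D: "open D" "bounded D" and S: "S \<subseteq> D" "S \<in> sets lebesgue"
    and a: "\<And>\<sigma> \<gamma>. msize \<sigma> \<le> k \<Longrightarrow> msize \<gamma> \<le> k \<Longrightarrow> a \<sigma> \<gamma> \<in> Linfty D"
    and X: "\<And>\<sigma>. msize \<sigma> \<le> k \<Longrightarrow> is_weak_deriv D \<sigma> u (X \<sigma>)"
    and Y: "\<And>\<sigma>. msize \<sigma> \<le> k \<Longrightarrow> is_weak_deriv D \<sigma> v (Y \<sigma>)"
  shows "form_on a k D S u v = form_fam a k S X Y"
  unfolding form_on_def form_fam_def
proof (intro sum.cong refl)
  have D': "D \<in> sets lebesgue" using D by simp
  fix \<sigma> \<gamma> :: "'a mindex" assume "\<sigma> \<in> {\<sigma>. msize \<sigma> \<le> k}" "\<gamma> \<in> {\<gamma>. msize \<gamma> \<le> k}"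
  then have \<sigma>: "msize \<sigma> \<le> k" and \<gamma>: "msize \<gamma> \<le> k" by auto
  have sub: "f \<in> L2 S" if "f \<in> L2 D" for f
    by (rule L2_subset[OF that S D'])
  have aS: "a \<sigma> \<gamma> \<in> Linfty S"
    by (rule Linfty_subset[OF a[OF \<sigma> \<gamma>] S D'])
  have L2: "X \<sigma> \<in> L2 S" "Y \<gamma> \<in> L2 S" "wderiv D \<sigma> u \<in> L2 S" "wderiv D \<gamma> v \<in> L2 S"
    using X[OF \<sigma>] Y[OF \<gamma>] wderiv_L2[OF X[OF \<sigma>]] wderiv_L2[OF Y[OF \<gamma>]]
    by (auto simp: is_weak_deriv_def intro: sub)
  have restrict: "AE x in lebesgue_on S. P x" if "AE x in lebesgue_on D. P x" for P
    using that S D' by (auto simp: AE_restrict_space_iff elim!: eventually_mono)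
  show "(\<integral>x. a \<sigma> \<gamma> x * wderiv D \<sigma> u x * wderiv D \<gamma> v x \<partial>lebesgue_on S)
      = (\<integral>x. a \<sigma> \<gamma> x * X \<sigma> x * Y \<gamma> x \<partial>lebesgue_on S)"
  proof (rule integral_cong_AE)
    show "(\<lambda>x. a \<sigma> \<gamma> x * wderiv D \<sigma> u x * wderiv D \<gamma> v x) \<in> borel_measurable (lebesgue_on S)"
      "(\<lambda>x. a \<sigma> \<gamma> x * X \<sigma> x * Y \<gamma> x) \<in> borel_measurable (lebesgue_on S)"
      using aS L2[THEN L2D(1)] by (auto simp: Linfty_def)
    show "AE x in lebesgue_on S. a \<sigma> \<gamma> x * wderiv D \<sigma> u x * wderiv D \<gamma> v x = a \<sigma> \<gamma> x * X \<sigma> x * Y \<gamma> x"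
      using restrict[OF wderiv_eq_AE[OF D X[OF \<sigma>]]] restrict[OF wderiv_eq_AE[OF D Y[OF \<gamma>]]]
      by eventually_elim simp
  qed
qed

lemma form_fam_expand:
  assumes a: "\<And>\<sigma> \<gamma>. msize \<sigma> \<le> k \<Longrightarrow> msize \<gamma> \<le> k \<Longrightarrow> a \<sigma> \<gamma> \<in> Linfty S"
    and X: "\<And>\<sigma>. msize \<sigma> \<le> k \<Longrightarrow> X \<sigma> \<in> L2 S" and Y: "\<And>\<sigma>. msize \<sigma> \<le> k \<Longrightarrow> Y \<sigma> \<in> L2 S"
  shows "form_fam a k S (\<lambda>\<sigma> x. X \<sigma> x + s * Y \<sigma> x) (\<lambda>\<sigma> x. X \<sigma> x + s * Y \<sigma> x) =
    form_fam a k S X X + s * (form_fam a k S X Y + form_fam a k S Y X) + s\<^sup>2 * form_fam a k S Y Y"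
proof -
  have "(\<integral>x. a \<sigma> \<gamma> x * (X \<sigma> x + s * Y \<sigma> x) * (X \<gamma> x + s * Y \<gamma> x) \<partial>lebesgue_on S) =
      (\<integral>x. a \<sigma> \<gamma> x * X \<sigma> x * X \<gamma> x \<partial>lebesgue_on S)
      + s * ((\<integral>x. a \<sigma> \<gamma> x * X \<sigma> x * Y \<gamma> x \<partial>lebesgue_on S) + (\<integral>x. a \<sigma> \<gamma> x * Y \<sigma> x * X \<gamma> x \<partial>lebesgue_on S))
      + s\<^sup>2 * (\<integral>x. a \<sigma> \<gamma> x * Y \<sigma> x * Y \<gamma> x \<partial>lebesgue_on S)"
    if "msize \<sigma> \<le> k" "msize \<gamma> \<le> k" for \<sigma> \<gamma>
  proof -
    note int = form_fam_integrable[of a \<sigma> \<gamma> S, OF a[OF that]]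
    have "(\<integral>x. a \<sigma> \<gamma> x * (X \<sigma> x + s * Y \<sigma> x) * (X \<gamma> x + s * Y \<gamma> x) \<partial>lebesgue_on S) =
        (\<integral>x. a \<sigma> \<gamma> x * X \<sigma> x * X \<gamma> x + s * (a \<sigma> \<gamma> x * X \<sigma> x * Y \<gamma> x + a \<sigma> \<gamma> x * Y \<sigma> x * X \<gamma> x)
          + s\<^sup>2 * (a \<sigma> \<gamma> x * Y \<sigma> x * Y \<gamma> x) \<partial>lebesgue_on S)"
      by (intro Bochner_Integration.integral_cong refl) (simp add: algebra_simps power2_eq_square)
    also have "\<dots> = (\<integral>x. a \<sigma> \<gamma> x * X \<sigma> x * X \<gamma> x \<partial>lebesgue_on S)
      + s * ((\<integral>x. a \<sigma> \<gamma> x * X \<sigma> x * Y \<gamma> x \<partial>lebesgue_on S) + (\<integral>x. a \<sigma> \<gamma> x * Y \<sigma> x * X \<gamma> x \<partial>lebesgue_on S))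
      + s\<^sup>2 * (\<integral>x. a \<sigma> \<gamma> x * Y \<sigma> x * Y \<gamma> x \<partial>lebesgue_on S)"
      using int[of X X, OF X[OF that(1)] X[OF that(2)]] int[of X Y, OF X[OF that(1)] Y[OF that(2)]]
        int[of Y X, OF Y[OF that(1)] X[OF that(2)]] int[of Y Y, OF Y[OF that(1)] Y[OF that(2)]]
      by simp
    finally show ?thesis .
  qed
  then show ?thesis
    unfolding form_fam_def sum.distrib[symmetric] sum_distrib_left by (intro sum.cong refl) simp
qed

lemma integral_lebesgue_on_shrink:
  fixes f :: "real^'n::finite \<Rightarrow> real"
  assumes "T \<subseteq> D" "T \<in> sets lebesgue" "D \<in> sets lebesgue" "\<And>x. x \<notin> T \<Longrightarrow> f x = 0"
  shows "(\<integral>x. f x \<partial>lebesgue_on D) = (\<integral>x. f x \<partial>lebesgue_on T)"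
proof -
  have "f x = 0" if "x \<notin> D" for x
    using assms(1,4) that by blast
  then show ?thesis
    using integral_lebesgue_on_vanishing(1)[OF assms(3), of f]
      integral_lebesgue_on_vanishing(1)[OF assms(2), of f] assms(4) by simp
qed

lemma form_fam_vanishing:
  assumes T: "T \<subseteq> D" "T \<in> sets lebesgue" "D \<in> sets lebesgue"
    and X: "\<And>\<sigma> \<gamma> x. x \<notin> T \<Longrightarrow> X \<sigma> x = 0 \<or> Y \<gamma> x = 0"
  shows "form_fam a k D X Y = form_fam a k T X Y"
  unfolding form_fam_def
proof (intro sum.cong refl)
  fix \<sigma> \<gamma>
  have "a \<sigma> \<gamma> x * X \<sigma> x * Y \<gamma> x = 0" if "x \<notin> T" for x
    using X[OF that, of \<sigma> \<gamma>] by auto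
  then show "(\<integral>x. a \<sigma> \<gamma> x * X \<sigma> x * Y \<gamma> x \<partial>lebesgue_on D) = (\<integral>x. a \<sigma> \<gamma> x * X \<sigma> x * Y \<gamma> x \<partial>lebesgue_on T)"
    by (rule integral_lebesgue_on_shrink[OF T])
qed

text \<open>The discriminant of \<open>s \<mapsto>\<close> local energy of
  \<open>v + s * \<phi>\<close>. Symmetry is given only for the form over \<open>D\<close>; it
  suffices, because both cross terms are supported in \<open>T\<close> and thus coincide with
  integrals over \<open>D\<close>.\<close>

lemma energy_Cauchy_Schwarz:
  fixes D :: "(real^'n::finite) set"
  assumes D: "open D" "bounded D" and T: "open T" "T \<subseteq> D"
    and a: "\<And>\<sigma> \<gamma>. msize \<sigma> \<le> k \<Longrightarrow> msize \<gamma> \<le> k \<Longrightarrow> a \<sigma> \<gamma> \<in> Linfty D"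
    and sym: "\<And>u v. u \<in> sobolev0 k D \<Longrightarrow> v \<in> sobolev0 k D \<Longrightarrow>
          bilinear_form a k D u v = bilinear_form a k D v u"
    and nonneg: "\<And>\<psi>. \<psi> \<in> sobolev0 k D \<Longrightarrow> 0 \<le> form_on a k D T \<psi> \<psi>"
    and v: "v \<in> sobolev0 k D" and \<phi>: "\<phi> \<in> test_functions T"
  shows "\<bar>bilinear_form a k D v \<phi>\<bar> \<le> energy_norm a k D T v * sqrt (form_on a k D T \<phi> \<phi>)"
proof -
  have T': "T \<in> sets lebesgue" and D': "D \<in> sets lebesgue"
    using T D by simp_all
  have \<phi>D: "\<phi> \<in> test_functions D"
    using \<phi> test_functions_mono[OF T(2)] by blast
  define W where "W \<sigma> = wderiv D \<sigma> v" for \<sigma>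
  define P where "P \<sigma> = mderiv \<sigma> \<phi>" for \<sigma>
  have W: "is_weak_deriv D \<sigma> v (W \<sigma>)" if "msize \<sigma> \<le> k" for \<sigma>
    unfolding W_def by (rule sobolev0D[OF v that])
  have P: "is_weak_deriv D \<sigma> \<phi> (P \<sigma>)" for \<sigma>
    unfolding P_def by (rule is_weak_deriv_test_function[OF D \<phi>D])
  have PT: "P \<sigma> x = 0" if "x \<notin> T" for \<sigma> x
    using test_functionsD(4)[OF test_functions_mderiv[OF \<phi>] that] by (simp add: P_def)
  have aT: "a \<sigma> \<gamma> \<in> Linfty T" if "msize \<sigma> \<le> k" "msize \<gamma> \<le> k" for \<sigma> \<gamma>
    by (rule Linfty_subset[OF a[OF that] T(2) T' D'])
  have WT: "W \<sigma> \<in> L2 T" if "msize \<sigma> \<le> k" for \<sigma>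
    using W[OF that] by (auto simp: is_weak_deriv_def intro: L2_subset[OF _ T(2) T' D'])
  have PL: "P \<sigma> \<in> L2 T" for \<sigma>
    using P[of \<sigma>] by (auto simp: is_weak_deriv_def intro: L2_subset[OF _ T(2) T' D'])
  have 1: "bilinear_form a k D v \<phi> = form_fam a k T W P"
    using form_on_eq_form_fam[where a = a and S = D and X = W and Y = P, OF D subset_refl D' a W P]
      form_fam_vanishing[OF T(2) T' D', of W P] PT by simp
  have 2: "bilinear_form a k D \<phi> v = form_fam a k T P W"
    using form_on_eq_form_fam[where a = a and S = D and X = P and Y = W, OF D subset_refl D' a P W]
      form_fam_vanishing[OF T(2) T' D', of P W] PT by simp
  have 3: "form_on a k D T v v = form_fam a k T W W"
    by (rule form_on_eq_form_fam[OF D T(2) T' a W W])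
  have 4: "form_on a k D T \<phi> \<phi> = form_fam a k T P P"
    by (rule form_on_eq_form_fam[OF D T(2) T' a P P])
  have "0 \<le> form_on a k D T v v + 2 * s * bilinear_form a k D v \<phi> + s\<^sup>2 * form_on a k D T \<phi> \<phi>" for s
  proof -
    have "0 \<le> form_on a k D T (\<lambda>x. v x + s * \<phi> x) (\<lambda>x. v x + s * \<phi> x)"
      by (rule nonneg[OF sobolev0_add_test_function[OF D v \<phi>D]])
    also have "\<dots> = form_fam a k T (\<lambda>\<sigma> x. W \<sigma> x + s * P \<sigma> x) (\<lambda>\<sigma> x. W \<sigma> x + s * P \<sigma> x)"
      by (intro form_on_eq_form_fam[OF D T(2) T' a] is_weak_deriv_lincomb[OF D] W P)
    also have "\<dots> = form_fam a k T W W + s * (form_fam a k T W P + form_fam a k T P W) + s\<^sup>2 * form_fam a k T P P"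
      by (rule form_fam_expand[OF aT WT PL])
    also have "\<dots> = form_on a k D T v v + 2 * s * bilinear_form a k D v \<phi> + s\<^sup>2 * form_on a k D T \<phi> \<phi>"
      using sym[OF v test_functions_sobolev0[OF D \<phi>D]] 1 2 3 4 by simp
    finally show ?thesis .
  qed
  from nonneg_quadratic_discriminant[OF this]
  have "sqrt ((bilinear_form a k D v \<phi>)\<^sup>2) \<le> sqrt (form_on a k D T v v * form_on a k D T \<phi> \<phi>)"
    by (rule real_sqrt_le_mono)
  then show ?thesis
    by (simp add: energy_norm_def real_sqrt_mult)
qed

lemma test_function_L2_norm_subset:
  assumes "\<phi> \<in> test_functions \<Omega>" "\<Omega> \<subseteq> T" "open \<Omega>" "open T"
  shows "L2_norm T \<phi> = L2_norm \<Omega> \<phi>"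
proof -
  have "(\<phi> x)\<^sup>2 = 0" if "x \<notin> \<Omega>" for x
    using test_functionsD(4)[OF assms(1) that] by simp
  then show ?thesis
    using assms(2-4) integral_lebesgue_on_shrink[of \<Omega> T "\<lambda>x. (\<phi> x)\<^sup>2"]
    by (simp add: L2_norm_def)
qed

text \<open>The pointwise hypothesis is used at \<open>\<zeta>\<close> consisting of the derivatives
  of \<open>\<phi>\<close> at \<open>x\<close> and then integrated. As \<open>\<phi>\<close> lives
  in \<open>\<Omega>\<close>, the integrals over \<open>T\<close> become seminorms on the smooth
  set, the only place where Friedrichs' inequality is available.\<close>

lemma form_upper_bound:
  fixes D :: "(real^'n::finite) set"
  assumes D: "open D" "bounded D" and T: "open T" "T \<subseteq> D" and \<Omega>: "open \<Omega>" "\<Omega> \<subseteq> T"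
    and a: "\<And>\<sigma> \<gamma>. msize \<sigma> \<le> k \<Longrightarrow> msize \<gamma> \<le> k \<Longrightarrow> a \<sigma> \<gamma> \<in> Linfty D"
    and upper: "\<And>x \<zeta>. x \<in> D \<Longrightarrow>
          (\<Sum>\<sigma>\<in>{\<sigma>. msize \<sigma> \<le> k}. \<Sum>\<gamma>\<in>{\<gamma>. msize \<gamma> \<le> k}. a \<sigma> \<gamma> x * \<zeta> \<sigma> * \<zeta> \<gamma>)
            \<le> \<theta>k * (\<Sum>\<sigma>\<in>{\<sigma>. msize \<sigma> = k}. (\<zeta> \<sigma>)\<^sup>2) + \<theta>0 * (\<Sum>\<sigma>\<in>{\<sigma>. msize \<sigma> < k}. (\<zeta> \<sigma>)\<^sup>2)"
    and \<phi>: "\<phi> \<in> test_functions \<Omega>"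
  shows "form_on a k D T \<phi> \<phi> \<le>
    \<theta>k * (sobolev_seminorm k \<Omega> \<phi>)\<^sup>2 + \<theta>0 * (\<Sum>p<k. (sobolev_seminorm p \<Omega> \<phi>)\<^sup>2)"
proof -
  have T': "T \<in> sets lebesgue" and D': "D \<in> sets lebesgue"
    using T D by simp_all
  have bT: "bounded T" using D(2) T(2) bounded_subset by blast
  have b\<Omega>: "bounded \<Omega>" using bT \<Omega>(2) bounded_subset by blast
  have \<phi>T: "\<phi> \<in> test_functions T"
    using \<phi> test_functions_mono[OF \<Omega>(2)] by blast
  have \<phi>D: "\<phi> \<in> test_functions D"
    using \<phi>T test_functions_mono[OF T(2)] by blast
  define P where "P \<sigma> = mderiv \<sigma> \<phi>" for \<sigma>
  have P: "is_weak_deriv D \<sigma> \<phi> (P \<sigma>)" for \<sigma>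
    unfolding P_def by (rule is_weak_deriv_test_function[OF D \<phi>D])
  have PL: "P \<sigma> \<in> L2 T" for \<sigma>
    unfolding P_def by (rule test_functions_L2[OF test_functions_mderiv[OF \<phi>T] bounded_open_lmeasurable[OF T(1) bT]])
  have aT: "a \<sigma> \<gamma> \<in> Linfty T" if "msize \<sigma> \<le> k" "msize \<gamma> \<le> k" for \<sigma> \<gamma>
    by (rule Linfty_subset[OF a[OF that] T(2) T' D'])
  have int: "integrable (lebesgue_on T) (\<lambda>x. a \<sigma> \<gamma> x * P \<sigma> x * P \<gamma> x)"
    if "\<sigma> \<in> {\<sigma>. msize \<sigma> \<le> k}" "\<gamma> \<in> {\<sigma>. msize \<sigma> \<le> k}" for \<sigma> \<gamma>
    using that by (intro form_fam_integrable aT PL) auto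
  have fin: "finite {\<sigma> :: 'n mindex. msize \<sigma> < k}"
    by (rule finite_subset[OF _ finite_msize_le[of k]]) auto
  have sq: "(\<integral>x. (P \<sigma> x)\<^sup>2 \<partial>lebesgue_on T) = (L2_norm \<Omega> (mderiv \<sigma> \<phi>))\<^sup>2" for \<sigma>
    using test_function_L2_norm_subset[OF test_functions_mderiv[OF \<phi>] \<Omega>(2,1) T(1), of \<sigma>]
    by (simp add: L2_norm_sq[symmetric] P_def)
  have "form_on a k D T \<phi> \<phi> = form_fam a k T P P"
    by (rule form_on_eq_form_fam[OF D T(2) T' a P P])
  also have "\<dots> = (\<integral>x. (\<Sum>\<sigma>\<in>{\<sigma>. msize \<sigma> \<le> k}. \<Sum>\<gamma>\<in>{\<gamma>. msize \<gamma> \<le> k}. a \<sigma> \<gamma> x * P \<sigma> x * P \<gamma> x) \<partial>lebesgue_on T)"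
  proof -
    have "(\<integral>x. (\<Sum>\<sigma>\<in>{\<sigma>. msize \<sigma> \<le> k}. \<Sum>\<gamma>\<in>{\<gamma>. msize \<gamma> \<le> k}. a \<sigma> \<gamma> x * P \<sigma> x * P \<gamma> x) \<partial>lebesgue_on T)
        = (\<Sum>\<sigma>\<in>{\<sigma>. msize \<sigma> \<le> k}. \<integral>x. (\<Sum>\<gamma>\<in>{\<gamma>. msize \<gamma> \<le> k}. a \<sigma> \<gamma> x * P \<sigma> x * P \<gamma> x) \<partial>lebesgue_on T)"
      by (intro Bochner_Integration.integral_sum Bochner_Integration.integrable_sum int)
    also have "\<dots> = form_fam a k T P P"
      unfolding form_fam_def by (intro sum.cong refl Bochner_Integration.integral_sum int)
    finally show ?thesis by simp
  qed
  also have "\<dots> \<le> (\<integral>x. \<theta>k * (\<Sum>\<sigma>\<in>{\<sigma>. msize \<sigma> = k}. (P \<sigma> x)\<^sup>2)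
      + \<theta>0 * (\<Sum>\<sigma>\<in>{\<sigma>. msize \<sigma> < k}. (P \<sigma> x)\<^sup>2) \<partial>lebesgue_on T)"
  proof (rule integral_mono)
    show "integrable (lebesgue_on T) (\<lambda>x. \<Sum>\<sigma>\<in>{\<sigma>. msize \<sigma> \<le> k}. \<Sum>\<gamma>\<in>{\<gamma>. msize \<gamma> \<le> k}. a \<sigma> \<gamma> x * P \<sigma> x * P \<gamma> x)"
      by (intro Bochner_Integration.integrable_sum int)
    show "integrable (lebesgue_on T) (\<lambda>x. \<theta>k * (\<Sum>\<sigma>\<in>{\<sigma>. msize \<sigma> = k}. (P \<sigma> x)\<^sup>2)
      + \<theta>0 * (\<Sum>\<sigma>\<in>{\<sigma>. msize \<sigma> < k}. (P \<sigma> x)\<^sup>2))"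
      by (intro Bochner_Integration.integrable_add integrable_mult_right Bochner_Integration.integrable_sum L2D PL)
  qed (use upper T(2) in \<open>auto simp: space_restrict_space\<close>)
  also have "\<dots> = \<theta>k * (\<Sum>\<sigma>\<in>{\<sigma>. msize \<sigma> = k}. \<integral>x. (P \<sigma> x)\<^sup>2 \<partial>lebesgue_on T)
      + \<theta>0 * (\<Sum>\<sigma>\<in>{\<sigma>. msize \<sigma> < k}. \<integral>x. (P \<sigma> x)\<^sup>2 \<partial>lebesgue_on T)"
    using L2D(2)[OF PL] by (simp add: Bochner_Integration.integral_sum)
  also have "(\<Sum>\<sigma>\<in>{\<sigma>. msize \<sigma> = k}. \<integral>x. (P \<sigma> x)\<^sup>2 \<partial>lebesgue_on T) = (sobolev_seminorm k \<Omega> \<phi>)\<^sup>2"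
    by (simp add: sq sobolev_seminorm_test_function[OF \<Omega>(1) b\<Omega> \<phi>])
  also have "(\<Sum>\<sigma>\<in>{\<sigma>. msize \<sigma> < k}. \<integral>x. (P \<sigma> x)\<^sup>2 \<partial>lebesgue_on T) = (\<Sum>p<k. (sobolev_seminorm p \<Omega> \<phi>)\<^sup>2)"
  proof -
    have "(\<Sum>p<k. \<Sum>\<sigma>\<in>{\<sigma> \<in> {\<sigma>. msize \<sigma> < k}. msize \<sigma> = p}. (L2_norm \<Omega> (mderiv \<sigma> \<phi>))\<^sup>2)
        = (\<Sum>\<sigma>\<in>{\<sigma>. msize \<sigma> < k}. (L2_norm \<Omega> (mderiv \<sigma> \<phi>))\<^sup>2)"
      by (rule sum.group[OF fin]) auto
    moreover have "{\<sigma> \<in> {\<sigma> :: 'n mindex. msize \<sigma> < k}. msize \<sigma> = p} = {\<sigma>. msize \<sigma> = p}" if "p < k" for p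
      using that by auto
    ultimately show ?thesis
      by (simp add: sq sobolev_seminorm_test_function[OF \<Omega>(1) b\<Omega> \<phi>])
  qed
  finally show ?thesis .
qed

text \<open>Origin of the mesh condition: squaring Friedrichs' inequality of order \<open>p\<close>
  gives the power 2 (k - p), and for p < k these exponents run through 2, 4, ..., 2k. With t = h
  this is the sum that abbreviates the quotient in h.\<close>

lemma friedrichs_sum:
  fixes \<Omega> :: "(real^'n::finite) set"
  assumes friedrichs: "friedrichs_constant TYPE('n) k Cf"
    and \<Omega>: "smooth_open \<Omega>" "bounded \<Omega>" "diameter \<Omega> \<le> t" and u: "u \<in> sobolev0 k \<Omega>"
  shows "(\<Sum>p<k. (sobolev_seminorm p \<Omega> u)\<^sup>2) \<le> Cf\<^sup>2 * (\<Sum>j=1..k. t ^ (2 * j)) * (sobolev_seminorm k \<Omega> u)\<^sup>2"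
proof -
  have "(\<Sum>p<k. (sobolev_seminorm p \<Omega> u)\<^sup>2) \<le> (\<Sum>p<k. Cf\<^sup>2 * t ^ (2 * (k - p)) * (sobolev_seminorm k \<Omega> u)\<^sup>2)"
  proof (rule sum_mono)
    fix p assume "p \<in> {..<k}"
    then have "p \<le> k" by simp
    then have "sobolev_seminorm p \<Omega> u \<le> Cf * t ^ (k - p) * sobolev_seminorm k \<Omega> u"
      using friedrichs \<Omega> u unfolding friedrichs_constant_def by blast
    from power_mono[OF this sobolev_seminorm_nonneg, of 2]
    show "(sobolev_seminorm p \<Omega> u)\<^sup>2 \<le> Cf\<^sup>2 * t ^ (2 * (k - p)) * (sobolev_seminorm k \<Omega> u)\<^sup>2"
      by (simp add: power_mult_distrib power_mult[symmetric] mult.commute)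
  qed
  also have "\<dots> = Cf\<^sup>2 * (\<Sum>p<k. t ^ (2 * (k - p))) * (sobolev_seminorm k \<Omega> u)\<^sup>2"
    by (simp add: sum_distrib_left sum_distrib_right)
  also have "(\<Sum>p<k. t ^ (2 * (k - p))) = (\<Sum>j=1..k. t ^ (2 * j))"
    by (rule sum.reindex_bij_witness[of _ "\<lambda>j. k - j" "\<lambda>p. k - p"]) auto
  finally show ?thesis .
qed

text \<open>The scale \<open>t\<close> is any length for which the element has diameter at most
  \<open>t\<close> and contains a ball of diameter \<open>\<delta> * t\<close>. The number
  \<open>A\<close> is a common bound for the energy of test functions against the squared
  \<open>k\<close>-th seminorm, so that one proof serves both cases of the theorem.\<close>

lemma local_inverse_estimate:
  fixes D :: "(real^'n::finite) set"
  assumes D: "open D" "bounded D" and T: "open T" "T \<subseteq> D"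
    and a: "\<And>\<sigma> \<gamma>. msize \<sigma> \<le> k \<Longrightarrow> msize \<gamma> \<le> k \<Longrightarrow> a \<sigma> \<gamma> \<in> Linfty D"
    and sym: "\<And>u v. u \<in> sobolev0 k D \<Longrightarrow> v \<in> sobolev0 k D \<Longrightarrow>
          bilinear_form a k D u v = bilinear_form a k D v u"
    and nonneg: "\<And>\<psi>. \<psi> \<in> sobolev0 k D \<Longrightarrow> 0 \<le> form_on a k D T \<psi> \<psi>"
    and theta: "0 \<le> \<theta>0"
    and upper: "\<And>x \<zeta>. x \<in> D \<Longrightarrow>
          (\<Sum>\<sigma>\<in>{\<sigma>. msize \<sigma> \<le> k}. \<Sum>\<gamma>\<in>{\<gamma>. msize \<gamma> \<le> k}. a \<sigma> \<gamma> x * \<zeta> \<sigma> * \<zeta> \<gamma>)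
            \<le> \<theta>k * (\<Sum>\<sigma>\<in>{\<sigma>. msize \<sigma> = k}. (\<zeta> \<sigma>)\<^sup>2) + \<theta>0 * (\<Sum>\<sigma>\<in>{\<sigma>. msize \<sigma> < k}. (\<zeta> \<sigma>)\<^sup>2)"
    and friedrichs: "friedrichs_constant TYPE('n) k Cf"
    and inverse: "inverse_constant TYPE('n) k \<delta> C"
    and C: "0 \<le> C" and \<delta>: "0 < \<delta>" and t: "0 < t" "diameter T \<le> t" "\<delta> * t \<le> inscribed_diameter T"
    and A: "0 \<le> A" "\<theta>k + \<theta>0 * (Cf\<^sup>2 * (\<Sum>j=1..k. t ^ (2 * j))) \<le> A"
    and v: "weak_solution a k D g v" and p: "p \<in> poly_functions (k - 1)" "\<And>x. x \<in> T \<Longrightarrow> g x = p x"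
  shows "L2_norm T (L_op a k D v) \<le> sqrt A * C / t ^ k * energy_norm a k D T v"
proof -
  have T': "T \<in> sets lebesgue" and D': "D \<in> sets lebesgue"
    using T D by simp_all
  have bT: "bounded T" using D(2) T(2) bounded_subset by blast
  have vs: "v \<in> sobolev0 k D" and g: "g \<in> L2 D"
    and eq: "\<And>\<phi>. \<phi> \<in> sobolev0 k D \<Longrightarrow> bilinear_form a k D v \<phi> = (\<integral>x. g x * \<phi> x \<partial>lebesgue_on D)"
    using v by (auto simp: weak_solution_def)
  define M where "M = sqrt A * energy_norm a k D T v"
  have E: "0 \<le> energy_norm a k D T v"
    using nonneg[OF vs] by (simp add: energy_norm_def)
  have M: "0 \<le> M" using A(1) E by (simp add: M_def)
  obtain x0 where x0: "ball x0 (\<delta> * t / 2) \<subseteq> T"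
    using inscribed_ball_attained[OF bT _ t(3)] \<delta> t(1) by (auto simp: mult_pos_pos)
  have "L2_norm \<Omega> p \<le> C / t ^ k * M"
    if \<Omega>: "smooth_open \<Omega>" "ball x0 (\<delta> * t / 2) \<subseteq> \<Omega>" "\<Omega> \<subseteq> T" for \<Omega>
  proof -
    have op: "open \<Omega>" using \<Omega>(1) by (simp add: smooth_open_def)
    have bd: "bounded \<Omega>" using bT \<Omega>(3) bounded_subset by blast
    have diam: "diameter \<Omega> \<le> t"
      using diameter_subset[OF \<Omega>(3) bT] t(2) by simp
    have "\<bar>\<integral>x. p x * \<phi> x \<partial>lebesgue_on \<Omega>\<bar> \<le> M * sobolev_seminorm k \<Omega> \<phi>"
      if \<phi>: "\<phi> \<in> test_functions \<Omega>" for \<phi>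
    proof -
      have \<phi>T: "\<phi> \<in> test_functions T"
        using \<phi> test_functions_mono[OF \<Omega>(3)] by blast
      have \<phi>D: "\<phi> \<in> test_functions D"
        using \<phi>T test_functions_mono[OF T(2)] by blast
      have van: "\<phi> x = 0" if "x \<notin> \<Omega>" for x
        by (rule test_functionsD(4)[OF \<phi> that])
      \<comment> \<open>Since \<open>\<phi>\<close> vanishes off \<open>\<Omega>\<close> and
        \<open>g\<close> is \<open>p\<close> there, the integral extends to all of \<open>D\<close>,
        where the weak equation for \<open>v\<close> applies.\<close>
      have "(\<integral>x. p x * \<phi> x \<partial>lebesgue_on \<Omega>) = (\<integral>x. p x * \<phi> x \<partial>lebesgue)"
        using op van by (intro integral_lebesgue_on_vanishing) auto
      also have "\<dots> = (\<integral>x. g x * \<phi> x \<partial>lebesgue)"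
      proof (intro Bochner_Integration.integral_cong refl)
        show "p x * \<phi> x = g x * \<phi> x" for x
          using van[of x] p(2)[of x] \<Omega>(3) by (cases "x \<in> \<Omega>") auto
      qed
      also have "\<dots> = (\<integral>x. g x * \<phi> x \<partial>lebesgue_on D)"
        using D' test_functionsD(4)[OF \<phi>D] by (intro integral_lebesgue_on_vanishing[symmetric]) auto
      also have "\<dots> = bilinear_form a k D v \<phi>"
        by (rule eq[symmetric, OF test_functions_sobolev0[OF D \<phi>D]])
      finally have "\<bar>\<integral>x. p x * \<phi> x \<partial>lebesgue_on \<Omega>\<bar> \<le> energy_norm a k D T v * sqrt (form_on a k D T \<phi> \<phi>)"
        using energy_Cauchy_Schwarz[OF D T a sym nonneg vs \<phi>T] by simp
      also have "\<dots> \<le> energy_norm a k D T v * (sqrt A * sobolev_seminorm k \<Omega> \<phi>)"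
      proof (rule mult_left_mono[OF _ E])
        have "form_on a k D T \<phi> \<phi> \<le> \<theta>k * (sobolev_seminorm k \<Omega> \<phi>)\<^sup>2 + \<theta>0 * (\<Sum>p<k. (sobolev_seminorm p \<Omega> \<phi>)\<^sup>2)"
          by (rule form_upper_bound[OF D T op \<Omega>(3) a upper \<phi>])
        also have "\<dots> \<le> \<theta>k * (sobolev_seminorm k \<Omega> \<phi>)\<^sup>2
            + \<theta>0 * (Cf\<^sup>2 * (\<Sum>j=1..k. t ^ (2 * j)) * (sobolev_seminorm k \<Omega> \<phi>)\<^sup>2)"
          by (intro add_left_mono mult_left_mono theta
              friedrichs_sum[OF friedrichs \<Omega>(1) bd diam test_functions_sobolev0[OF op bd \<phi>]])
        also have "\<dots> = (\<theta>k + \<theta>0 * (Cf\<^sup>2 * (\<Sum>j=1..k. t ^ (2 * j)))) * (sobolev_seminorm k \<Omega> \<phi>)\<^sup>2"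
          by (simp only: distrib_right mult.assoc)
        also have "\<dots> \<le> A * (sobolev_seminorm k \<Omega> \<phi>)\<^sup>2"
          by (intro mult_right_mono A) simp
        finally have "sqrt (form_on a k D T \<phi> \<phi>) \<le> sqrt (A * (sobolev_seminorm k \<Omega> \<phi>)\<^sup>2)"
          by (rule real_sqrt_le_mono)
        then show "sqrt (form_on a k D T \<phi> \<phi>) \<le> sqrt A * sobolev_seminorm k \<Omega> \<phi>"
          by (simp add: real_sqrt_mult sobolev_seminorm_nonneg)
      qed
      finally show ?thesis
        by (simp add: M_def mult_ac)
    qed
    from inverse_estimate[OF friedrichs inverse \<Omega>(1) bd t(1) diam \<Omega>(2) p(1) M this]
    obtain s where "s \<le> M" "L2_norm \<Omega> p \<le> C / t ^ k * s" by blast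
    moreover have "C / t ^ k * s \<le> C / t ^ k * M"
      using \<open>s \<le> M\<close> C t(1) by (intro mult_left_mono) auto
    ultimately show ?thesis by linarith
  qed
  then have "L2_norm T p \<le> C / t ^ k * M"
    using \<delta> t(1) C M by (intro L2_norm_le_by_balls[OF T(1) _ x0] smooth_L2 poly_functions_smooth[OF p(1)] T(1) bT)
      (auto intro!: mult_nonneg_nonneg)
  \<comment> \<open>\<open>L_op\<close> picks some right-hand side of \<open>v\<close>. It agrees
    with \<open>g\<close> against every test function on \<open>D\<close>, hence almost everywhere,
    and \<open>g\<close> is \<open>p\<close> on \<open>T\<close>.\<close>
  moreover have "L2_norm T (L_op a k D v) = L2_norm T p"
  proof -
    have sol: "weak_solution a k D (L_op a k D v) v"
      unfolding L_op_def by (rule someI[of "\<lambda>g. weak_solution a k D g v", OF v])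
    have L: "L_op a k D v \<in> L2 D"
      using sol by (simp add: weak_solution_def)
    have "AE x in lebesgue_on D. L_op a k D v x = g x"
    proof (rule AE_eq_if_tested_equal[OF D L g])
      fix \<phi> assume "\<phi> \<in> test_functions D"
      then have "\<phi> \<in> sobolev0 k D" by (rule test_functions_sobolev0[OF D])
      then show "(\<integral>x. L_op a k D v x * \<phi> x \<partial>lebesgue_on D) = (\<integral>x. g x * \<phi> x \<partial>lebesgue_on D)"
        using sol eq by (simp add: weak_solution_def)
    qed
    then have "AE x in lebesgue_on T. L_op a k D v x = g x"
      using T(2) T' D' by (auto simp: AE_restrict_space_iff elim!: eventually_mono)
    then have "L2_norm T (L_op a k D v) = L2_norm T g"
      by (intro L2_norm_cong_AE L2_subset[OF L T(2) T' D'] L2_subset[OF g T(2) T' D'])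
    also have "\<dots> = L2_norm T p"
      unfolding L2_norm_def
      by (intro arg_cong[where f = sqrt] Bochner_Integration.integral_cong refl)
        (use p(2) in \<open>simp add: space_restrict_space\<close>)
    finally show ?thesis .
  qed
  ultimately show ?thesis
    by (simp add: M_def mult_ac)
qed

section \<open>From a single element to the whole partition\<close>

lemma element_open_nonempty:
  assumes "element T" shows "open T" "T \<noteq> {}"
proof -
  obtain \<P> where \<P>: "\<P> \<noteq> {}" "\<forall>P\<in>\<P>. polytope P \<and> interior P \<noteq> {}" "T = interior (\<Union>\<P>)"
    using assms unfolding element_def by blast
  then obtain P where P: "P \<in> \<P>" "interior P \<noteq> {}" "T = interior (\<Union>\<P>)"
    by blast
  then show "open T" by simp
  have "interior P \<subseteq> T"
    using P(1,3) by (simp add: Union_upper interior_mono)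
  with P(2) show "T \<noteq> {}" by blast
qed

lemma diameter_open_pos:
  fixes T :: "(real^'n::finite) set"
  assumes "open T" "T \<noteq> {}" "bounded T" shows "0 < diameter T"
proof -
  obtain x e where "e > 0" "ball x e \<subseteq> T"
    using assms(1,2) open_contains_ball by blast
  then have "2 * e \<le> diameter T"
    using diameter_subset[OF _ assms(3), of "ball x e"] by simp
  then show ?thesis
    using \<open>e > 0\<close> by simp
qed

text \<open>Regularity compares the inscribed ball with the diameter of its own element, so that
  diameter is the scale at which every element contains the ball required by the inverse constant.
  The mesh size is at least as large, and at this scale the estimate is stated for elements that
  contain a ball of diameter \<open>\<delta> * mesh_size m \<tau>\<close>. The case
  \<open>\<theta>0 = 0\<close> is listed separately because a quotient by zero is 0 in HOL, whereas
  it means infinity here.\<close>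

theorem lemma6p2:
  fixes D :: "(real^'n::finite) set"
    and a :: "'n mindex \<Rightarrow> 'n mindex \<Rightarrow> real^'n \<Rightarrow> real"
    and k m :: nat
    and \<tau> :: "nat \<Rightarrow> (real^'n) set"
    and a_min a_max \<theta>k \<theta>0 Cf C \<delta> :: real
  assumes k: "k \<ge> 1"
    and domain: "open D" "connected D" "D \<noteq> {}" "bounded D"
    and coefficients: "\<And>\<sigma> \<gamma>. msize \<sigma> \<le> k \<Longrightarrow> msize \<gamma> \<le> k \<Longrightarrow> a \<sigma> \<gamma> \<in> Linfty D"
    and self_adjoint: "\<And>u v. u \<in> sobolev0 k D \<Longrightarrow> v \<in> sobolev0 k D \<Longrightarrow>
          bilinear_form a k D u v = bilinear_form a k D v u"
    and a_bounds: "0 < a_min" "a_min \<le> a_max"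
    and coercive: "\<And>u. u \<in> sobolev0 k D \<Longrightarrow>
          a_min * (sobolev_seminorm k D u)\<^sup>2 \<le> bilinear_form a k D u u \<and>
          bilinear_form a k D u u \<le> a_max * (sobolev_seminorm k D u)\<^sup>2"
    and theta: "\<theta>k > 0" "\<theta>0 \<ge> 0"
    and upper: "\<And>x \<zeta>. x \<in> D \<Longrightarrow>
          (\<Sum>\<sigma>\<in>{\<sigma>. msize \<sigma> \<le> k}. \<Sum>\<gamma>\<in>{\<gamma>. msize \<gamma> \<le> k}. a \<sigma> \<gamma> x * \<zeta> \<sigma> * \<zeta> \<gamma>)
            \<le> \<theta>k * (\<Sum>\<sigma>\<in>{\<sigma>. msize \<sigma> = k}. (\<zeta> \<sigma>)\<^sup>2)
              + \<theta>0 * (\<Sum>\<sigma>\<in>{\<sigma>. msize \<sigma> < k}. (\<zeta> \<sigma>)\<^sup>2)"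
    and friedrichs: "friedrichs_constant TYPE('n) k Cf"
    and delta: "\<delta> > 0"
    and inverse: "inverse_constant TYPE('n) k \<delta> C"
    and partition: "domain_partition D m \<tau>" "regular_partition \<delta> m \<tau>"
    and local_energy_nonneg: "\<And>j \<psi>. j \<in> {1..m} \<Longrightarrow> \<psi> \<in> sobolev0 k D \<Longrightarrow>
          0 \<le> form_on a k D (\<tau> j) \<psi> \<psi>"
  shows "((\<theta>0 = 0 \<or> (\<Sum>j=1..k. mesh_size m \<tau> ^ (2 * j)) \<le> \<theta>k / (2 * \<theta>0 * Cf\<^sup>2)) \<longrightarrow>
           (\<forall>v\<in>Psi a k D m \<tau>. \<forall>j\<in>{1..m}.
              L2_norm (\<tau> j) (L_op a k D v)
                \<le> sqrt (2 * \<theta>k) * C / diameter (\<tau> j) ^ k * energy_norm a k D (\<tau> j) v \<and>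
              (\<delta> * mesh_size m \<tau> \<le> inscribed_diameter (\<tau> j) \<longrightarrow>
                L2_norm (\<tau> j) (L_op a k D v)
                  \<le> sqrt (2 * \<theta>k) * C / mesh_size m \<tau> ^ k * energy_norm a k D (\<tau> j) v)))
       \<and> ((\<forall>\<sigma> \<gamma>. msize \<sigma> \<le> k \<longrightarrow> msize \<gamma> \<le> k \<longrightarrow> (msize \<sigma> < k \<or> msize \<gamma> < k) \<longrightarrow>
              (\<forall>x\<in>D. a \<sigma> \<gamma> x = 0)) \<longrightarrow>
           (\<forall>v\<in>Psi a k D m \<tau>. \<forall>j\<in>{1..m}.
              L2_norm (\<tau> j) (L_op a k D v)
                \<le> sqrt \<theta>k * C / diameter (\<tau> j) ^ k * energy_norm a k D (\<tau> j) v \<and>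
              (\<delta> * mesh_size m \<tau> \<le> inscribed_diameter (\<tau> j) \<longrightarrow>
                L2_norm (\<tau> j) (L_op a k D v)
                  \<le> sqrt \<theta>k * C / mesh_size m \<tau> ^ k * energy_norm a k D (\<tau> j) v)))"
proof -
  have main: "L2_norm (\<tau> j) (L_op a k D v) \<le> sqrt A * C / t ^ k * energy_norm a k D (\<tau> j) v"
    if vj: "v \<in> Psi a k D m \<tau>" "j \<in> {1..m}"
      and t: "0 < t" "diameter (\<tau> j) \<le> t" "\<delta> * t \<le> inscribed_diameter (\<tau> j)"
      and \<theta>: "0 \<le> \<theta>" "0 \<le> A" "\<theta>k + \<theta> * (Cf\<^sup>2 * (\<Sum>j=1..k. t ^ (2 * j))) \<le> A"
      and upper': "\<And>x \<zeta>. x \<in> D \<Longrightarrow>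
          (\<Sum>\<sigma>\<in>{\<sigma>. msize \<sigma> \<le> k}. \<Sum>\<gamma>\<in>{\<gamma>. msize \<gamma> \<le> k}. a \<sigma> \<gamma> x * \<zeta> \<sigma> * \<zeta> \<gamma>)
            \<le> \<theta>k * (\<Sum>\<sigma>\<in>{\<sigma>. msize \<sigma> = k}. (\<zeta> \<sigma>)\<^sup>2) + \<theta> * (\<Sum>\<sigma>\<in>{\<sigma>. msize \<sigma> < k}. (\<zeta> \<sigma>)\<^sup>2)"
    for v j t \<theta> A
  proof -
    obtain g where g: "g \<in> Phi k m \<tau>" "weak_solution a k D g v"
      using vj(1) by (auto simp: Psi_def solution_class_def)
    obtain p where p: "p \<in> poly_functions (k - 1)" "\<And>x. x \<in> \<tau> j \<Longrightarrow> g x = p x"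
      using g(1) vj(2) unfolding Phi_def by blast
    have T: "open (\<tau> j)" "\<tau> j \<subseteq> D"
      using partition(1) vj(2) element_open_nonempty(1) unfolding domain_partition_def by blast+
    have bT: "bounded (\<tau> j)" using domain(4) T(2) bounded_subset by blast
    obtain x0 where x0: "ball x0 (\<delta> * t / 2) \<subseteq> \<tau> j"
      using inscribed_ball_attained[OF bT _ t(3)] delta t(1) by (auto simp: mult_pos_pos)
    \<comment> \<open>A ball of diameter \<open>\<delta> * t\<close> lies in an element of diameter
      at most \<open>t\<close>, so the existence of the element itself forces
      \<open>\<delta> \<le> 1\<close>.\<close>
    have "\<delta> * t \<le> diameter (\<tau> j)"
      using diameter_subset[OF x0 bT] mult_pos_pos[OF delta t(1)] by (simp add: not_less)
    then have "\<delta> * t \<le> 1 * t"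
      using t(2) by simp
    then have "\<delta> \<le> 1"
      using t(1) by simp
    then have C: "0 < C"
      by (rule inverse_constant_pos[OF friedrichs inverse delta])
    show ?thesis
      by (rule local_inverse_estimate[OF domain(1,4) T coefficients self_adjoint local_energy_nonneg[OF vj(2)]
            \<theta>(1) upper' friedrichs inverse less_imp_le[OF C] delta t \<theta>(2,3) g(2) p])
  qed
  have sizes: "0 < diameter (\<tau> j)" "diameter (\<tau> j) \<le> mesh_size m \<tau>"
      "\<delta> * diameter (\<tau> j) \<le> inscribed_diameter (\<tau> j)" if j: "j \<in> {1..m}" for j
  proof -
    have el: "element (\<tau> j)" "\<tau> j \<subseteq> D"
      using partition(1) j unfolding domain_partition_def by blast+
    have bT: "bounded (\<tau> j)" using domain(4) el(2) bounded_subset by blast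
    show pos: "0 < diameter (\<tau> j)"
      by (rule diameter_open_pos[OF element_open_nonempty[OF el(1)] bT])
    show "diameter (\<tau> j) \<le> mesh_size m \<tau>"
      unfolding mesh_size_def using j by (intro Max_ge) auto
    have "\<delta> \<le> inscribed_diameter (\<tau> j) / diameter (\<tau> j)"
      using partition(2) j unfolding regular_partition_def by blast
    then show "\<delta> * diameter (\<tau> j) \<le> inscribed_diameter (\<tau> j)"
      using pos by (simp add: pos_le_divide_eq)
  qed
  \<comment> \<open>The sum grows with \<open>t\<close>, so the condition on the mesh size covers
    the diameters too. It makes the lower-order part at most \<open>\<theta>k / 2\<close>. For
    \<open>Cf = 0\<close> this part vanishes outright; that case is split off because the quotient
    would have denominator zero.\<close>
  have first: "\<theta>k + \<theta>0 * (Cf\<^sup>2 * (\<Sum>j=1..k. t ^ (2 * j))) \<le> 2 * \<theta>k"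
    if cond: "\<theta>0 = 0 \<or> (\<Sum>j=1..k. mesh_size m \<tau> ^ (2 * j)) \<le> \<theta>k / (2 * \<theta>0 * Cf\<^sup>2)"
      and t: "0 \<le> t" "t \<le> mesh_size m \<tau>" for t
  proof (cases "\<theta>0 = 0 \<or> Cf = 0")
    case True
    then show ?thesis using theta by auto
  next
    case False
    then have pos: "0 < 2 * \<theta>0 * Cf\<^sup>2"
      using theta(2) by simp
    have "(\<Sum>j=1..k. t ^ (2 * j)) \<le> (\<Sum>j=1..k. mesh_size m \<tau> ^ (2 * j))"
      by (intro sum_mono power_mono t)
    also have "\<dots> \<le> \<theta>k / (2 * \<theta>0 * Cf\<^sup>2)"
      using cond False by blast
    finally have "(\<Sum>j=1..k. t ^ (2 * j)) * (2 * \<theta>0 * Cf\<^sup>2) \<le> \<theta>k"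
      using pos by (simp add: pos_le_divide_eq)
    then have "2 * (\<theta>0 * (Cf\<^sup>2 * (\<Sum>j=1..k. t ^ (2 * j)))) \<le> \<theta>k"
      by (simp add: mult_ac)
    then show ?thesis
      using theta(1) by linarith
  qed
  \<comment> \<open>If only the highest order occurs, the form ignores the lower components of
    \<open>\<zeta>\<close>. Setting them to zero removes the \<open>\<theta>0\<close> term, so the
    upper bound holds with 0 in its place and no restriction on the mesh size remains.\<close>
  have highest: "(\<Sum>\<sigma>\<in>{\<sigma>. msize \<sigma> \<le> k}. \<Sum>\<gamma>\<in>{\<gamma>. msize \<gamma> \<le> k}. a \<sigma> \<gamma> x * \<zeta> \<sigma> * \<zeta> \<gamma>)
      \<le> \<theta>k * (\<Sum>\<sigma>\<in>{\<sigma>. msize \<sigma> = k}. (\<zeta> \<sigma>)\<^sup>2) + 0 * (\<Sum>\<sigma>\<in>{\<sigma>. msize \<sigma> < k}. (\<zeta> \<sigma>)\<^sup>2)"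
    if low: "\<forall>\<sigma> \<gamma>. msize \<sigma> \<le> k \<longrightarrow> msize \<gamma> \<le> k \<longrightarrow> (msize \<sigma> < k \<or> msize \<gamma> < k) \<longrightarrow> (\<forall>x\<in>D. a \<sigma> \<gamma> x = 0)"
      and x: "x \<in> D" for x \<zeta>
  proof -
    define \<xi> where "\<xi> \<sigma> = (if msize \<sigma> = k then \<zeta> \<sigma> else 0)" for \<sigma>
    have "(\<Sum>\<sigma>\<in>{\<sigma>. msize \<sigma> \<le> k}. \<Sum>\<gamma>\<in>{\<gamma>. msize \<gamma> \<le> k}. a \<sigma> \<gamma> x * \<zeta> \<sigma> * \<zeta> \<gamma>)
        = (\<Sum>\<sigma>\<in>{\<sigma>. msize \<sigma> \<le> k}. \<Sum>\<gamma>\<in>{\<gamma>. msize \<gamma> \<le> k}. a \<sigma> \<gamma> x * \<xi> \<sigma> * \<xi> \<gamma>)"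
    proof (intro sum.cong refl)
      fix \<sigma> \<gamma> :: "'n mindex" assume "\<sigma> \<in> {\<sigma>. msize \<sigma> \<le> k}" "\<gamma> \<in> {\<gamma>. msize \<gamma> \<le> k}"
      then show "a \<sigma> \<gamma> x * \<zeta> \<sigma> * \<zeta> \<gamma> = a \<sigma> \<gamma> x * \<xi> \<sigma> * \<xi> \<gamma>"
        using low x by (cases "msize \<sigma> < k \<or> msize \<gamma> < k") (auto simp: \<xi>_def)
    qed
    also have "\<dots> \<le> \<theta>k * (\<Sum>\<sigma>\<in>{\<sigma>. msize \<sigma> = k}. (\<xi> \<sigma>)\<^sup>2) + \<theta>0 * (\<Sum>\<sigma>\<in>{\<sigma>. msize \<sigma> < k}. (\<xi> \<sigma>)\<^sup>2)"
      by (rule upper[OF x])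
    also have "(\<Sum>\<sigma>\<in>{\<sigma>. msize \<sigma> = k}. (\<xi> \<sigma>)\<^sup>2) = (\<Sum>\<sigma>\<in>{\<sigma>. msize \<sigma> = k}. (\<zeta> \<sigma>)\<^sup>2)"
      by (intro sum.cong) (auto simp: \<xi>_def)
    also have "(\<Sum>\<sigma>\<in>{\<sigma>. msize \<sigma> < k}. (\<xi> \<sigma>)\<^sup>2) = 0"
      by (intro sum.neutral) (auto simp: \<xi>_def)
    finally show ?thesis by simp
  qed
  show ?thesis
  proof (intro conjI impI ballI)
    fix v j
    assume cond: "\<theta>0 = 0 \<or> (\<Sum>j=1..k. mesh_size m \<tau> ^ (2 * j)) \<le> \<theta>k / (2 * \<theta>0 * Cf\<^sup>2)"
      and v: "v \<in> Psi a k D m \<tau>" and j: "j \<in> {1..m}"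
    note s = sizes[OF j]
    have A: "0 \<le> 2 * \<theta>k" using theta by simp
    show "L2_norm (\<tau> j) (L_op a k D v)
        \<le> sqrt (2 * \<theta>k) * C / diameter (\<tau> j) ^ k * energy_norm a k D (\<tau> j) v"
      by (rule main[OF v j s(1) order_refl s(3) theta(2) A first[OF cond less_imp_le[OF s(1)] s(2)] upper])
    assume h: "\<delta> * mesh_size m \<tau> \<le> inscribed_diameter (\<tau> j)"
    have h0: "0 < mesh_size m \<tau>" using s(1,2) by linarith
    show "L2_norm (\<tau> j) (L_op a k D v)
        \<le> sqrt (2 * \<theta>k) * C / mesh_size m \<tau> ^ k * energy_norm a k D (\<tau> j) v"
      by (rule main[OF v j h0 s(2) h theta(2) A first[OF cond less_imp_le[OF h0] order_refl] upper])
  next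
    fix v j
    assume low: "\<forall>\<sigma> \<gamma>. msize \<sigma> \<le> k \<longrightarrow> msize \<gamma> \<le> k \<longrightarrow> (msize \<sigma> < k \<or> msize \<gamma> < k) \<longrightarrow> (\<forall>x\<in>D. a \<sigma> \<gamma> x = 0)"
      and v: "v \<in> Psi a k D m \<tau>" and j: "j \<in> {1..m}"
    note s = sizes[OF j]
    have A: "0 \<le> \<theta>k" using theta by simp
    have A': "\<theta>k + 0 * (Cf\<^sup>2 * (\<Sum>j=1..k. t ^ (2 * j))) \<le> \<theta>k" for t by simp
    show "L2_norm (\<tau> j) (L_op a k D v)
        \<le> sqrt \<theta>k * C / diameter (\<tau> j) ^ k * energy_norm a k D (\<tau> j) v"
      by (rule main[OF v j s(1) order_refl s(3) order_refl A A' highest[OF low]])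
    assume h: "\<delta> * mesh_size m \<tau> \<le> inscribed_diameter (\<tau> j)"
    have h0: "0 < mesh_size m \<tau>" using s(1,2) by linarith
    show "L2_norm (\<tau> j) (L_op a k D v)
        \<le> sqrt \<theta>k * C / mesh_size m \<tau> ^ k * energy_norm a k D (\<tau> j) v"
      by (rule main[OF v j h0 s(2) h order_refl A A' highest[OF low]])
  qed
qed

end
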